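(* Let $R$ be a commutative ring with unit and let $r\geq 0$ be an integer. The category $\mathbf{SpSe}_R$ of spectral sequences of $R$-modules, with the class $\mathcal{E}_r$ of $E_r$-quasi-isomorphisms as weak equivalences and the class $\mathcal{F}ib_r$ of $r$-fibrations as fibrations, is an almost Brown category with functorial factorization. Hence, with weak equivalences $\mathcal{E}_r$ and acyclic fibrations $\mathcal{E}_r\cap\mathcal{F}ib_r$, it is a partial Brown category of fibrant objects.
   Context: **Spectral sequences.** A bigraded $R$-module is a collection $A=\{A^{p,q}\}_{p,q\in\mathbb{Z}}$ of $R$-modules. For $m\geq 0$, an $m$-bigraded complex is a bigraded $R$-module with $R$-linear maps $d_m:A^{p,q}\to A^{p-m,q+1-m}$ with $d_m^2=0$; morphisms are maps of bigraded modules commuting with differentials; its homology $H_*$ is a bigraded $R$-module, and a quasi-isomorphism is a morphism inducing an isomorphism on homology. A spectral sequence $(A,\psi)$ is a family of $m$-bigraded complexes $(A_m,d_m)$, $m\geq 0$, together with isomorphisms of bigraded modules $\psi_m:H_*(A_m)\to A_{m+1}$ (characteristic maps) for $m\geq 0$. A morphism $f:(A,\psi)\to(B,\varphi)$ is a family of morphisms $f_m:A_m\to B_m$ of $m$-bigraded complexes, $m\ge 0$, compatible with characteristic maps: $f_{m+1}\psi_m=\varphi_m H_*(f_m)$. The resulting category is $\mathbf{SpSe}_R$. A morphism $f$ is an $E_r$-quasi-isomorphism if $f_r$ is a quasi-isomorphism of $r$-bigraded complexes (equivalently, $f_k$ is an isomorphism for all $k>r$). It is an $r$-fibration if $f_k$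 is (bidegreewise) surjective for $0\leq k\leq r$. **Almost Brown category.** This is a category $\mathcal{C}$ with finite products and a final object $e$ together with two distinguished classes of maps, weak equivalences and fibrations (an acyclic fibration is a map that is both; an object $X$ is fibrant if $X\to e$ is a fibration), such that: (A) Weak equivalences satisfy two-out-of-three; all isomorphisms are weak equivalences. (B) The composite of two fibrations is a fibration; all isomorphisms are fibrations. (C) The pullback of an acyclic fibration along any map exists and is an acyclic fibration. (D) Any morphism $u:X\to Y$ can be factored $u=pi$ with $p$ a fibration and $i$ right inverse to an acyclic fibration (i.e. there is an acyclic fibration $s$ with $si=1_X$). (E) Every object is fibrant. It is an almost Brown category with functorial factorization if in addition (D) holds functorially, i.e. the data $p,i,s$ can be chosen functorially in $u$ (as functors on the arrow category of $\mathcal{C}$). **Partial Brown category of fibrant objects.** This is a category $\mathcal{C}$ with two subcategories $w\mathcal{C}$ and $f\mathcal{C}$, whose maps are called weak equivalences and acyclic fibrations, such that (writing $\mathcal{D}^{[1]}$ for the arrow category of a category $\mathcal{D}$): (1) Both $w\mathcal{C}$ and $f\mathcal{C}$ contain the isomorphisms of $\mathcal{C}$, and $f\mathcal{C}\subseteq w\mathcal{C}$. (2) Weak equivalences satisfy two-out-of-three. (3) The pullback of an acyclic fibration along any map exists and is an acyclic fibration. (4) There are three functors $f,w,s:w\mathcal{C}^{[1]}\to w\mathcal{C}^{[1]}$ such that for each weak equivalence $g$ we have $g=f(g)\circ w(g)$, $s(g)\circ w(g)=1$, and $f(g)$ and $s(g)$ are in $f\mathcal{C}^{[1]}$ (i.e.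 are acyclic fibrations). *)

theory Defs
  imports "HOL-Algebra.Module" "HOL-Algebra.AbelCoset"
begin

section \<open>Categories\<close>

text \<open>Arrow-based presentation. \<open>Comp C g f\<close> is the composite \<open>g\<close> after \<open>f\<close>; it is a total function
  in HOL and is only meaningful if \<open>Cod C f = Dom C g\<close>.\<close>

record ('o, 'f) cat =
  Ob :: "'o set"
  Arr :: "'f set"
  Dom :: "'f \<Rightarrow> 'o"
  Cod :: "'f \<Rightarrow> 'o"
  Id :: "'o \<Rightarrow> 'f"
  Comp :: "'f \<Rightarrow> 'f \<Rightarrow> 'f"

definition Hom :: "('o, 'f) cat \<Rightarrow> 'o \<Rightarrow> 'o \<Rightarrow> 'f set" where
  "Hom C X Y = {f \<in> Arr C. Dom C f = X \<and> Cod C f = Y}"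

locale category =
  fixes C :: "('o, 'f) cat"
  assumes Dom_Ob: "f \<in> Arr C \<Longrightarrow> Dom C f \<in> Ob C"
    and Cod_Ob: "f \<in> Arr C \<Longrightarrow> Cod C f \<in> Ob C"
    and Id_Hom: "X \<in> Ob C \<Longrightarrow> Id C X \<in> Hom C X X"
    and Comp_Hom: "f \<in> Hom C X Y \<Longrightarrow> g \<in> Hom C Y Z \<Longrightarrow> Comp C g f \<in> Hom C X Z"
    and Comp_Id: "f \<in> Hom C X Y \<Longrightarrow> Comp C f (Id C X) = f"
    and Id_Comp: "f \<in> Hom C X Y \<Longrightarrow> Comp C (Id C Y) f = f"
    and Comp_assoc: "f \<in> Hom C X Y \<Longrightarrow> g \<in> Hom C Y Z \<Longrightarrow> h \<in> Hom C Z V \<Longrightarrow>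
      Comp C h (Comp C g f) = Comp C (Comp C h g) f"

definition isos :: "('o, 'f) cat \<Rightarrow> 'f set" where
  "isos C = {f \<in> Arr C. \<exists>g \<in> Hom C (Cod C f) (Dom C f).
     Comp C g f = Id C (Dom C f) \<and> Comp C f g = Id C (Cod C f)}"

definition final_object :: "('o, 'f) cat \<Rightarrow> 'o \<Rightarrow> bool" where
  "final_object C e \<longleftrightarrow> e \<in> Ob C \<and> (\<forall>X \<in> Ob C. \<exists>!t. t \<in> Hom C X e)"

definition is_product :: "('o, 'f) cat \<Rightarrow> nat \<Rightarrow> (nat \<Rightarrow> 'o) \<Rightarrow> 'o \<Rightarrow> (nat \<Rightarrow> 'f) \<Rightarrow> bool" where
  "is_product C n X P \<pi> \<longleftrightarrow> P \<in> Ob C \<and> (\<forall>i<n. \<pi> i \<in> Hom C P (X i)) \<and>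
     (\<forall>Z \<in> Ob C. \<forall>g. (\<forall>i<n. g i \<in> Hom C Z (X i)) \<longrightarrow>
        (\<exists>!h. h \<in> Hom C Z P \<and> (\<forall>i<n. Comp C (\<pi> i) h = g i)))"

definition has_finite_products :: "('o, 'f) cat \<Rightarrow> bool" where
  "has_finite_products C \<longleftrightarrow> (\<forall>n X. (\<forall>i<n. X i \<in> Ob C) \<longrightarrow> (\<exists>P \<pi>. is_product C n X P \<pi>))"

text \<open>\<open>is_pullback C p g p' g'\<close>: \<open>p'\<close> is the pullback of \<open>p : X \<rightarrow> Y\<close> along \<open>g : Z \<rightarrow> Y\<close>,
  with \<open>p' : P \<rightarrow> Z\<close> and \<open>g' : P \<rightarrow> X\<close>.\<close>

definition is_pullback :: "('o, 'f) cat \<Rightarrow> 'f \<Rightarrow> 'f \<Rightarrow> 'f \<Rightarrow> 'f \<Rightarrow> bool" where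
  "is_pullback C p g p' g' \<longleftrightarrow>
     p \<in> Arr C \<and> g \<in> Arr C \<and> Cod C p = Cod C g \<and>
     p' \<in> Hom C (Dom C p') (Dom C g) \<and> g' \<in> Hom C (Dom C p') (Dom C p) \<and>
     Comp C p g' = Comp C g p' \<and>
     (\<forall>T a b. a \<in> Hom C T (Dom C g) \<and> b \<in> Hom C T (Dom C p) \<and> Comp C p b = Comp C g a \<longrightarrow>
        (\<exists>!h. h \<in> Hom C T (Dom C p') \<and> Comp C p' h = a \<and> Comp C g' h = b))"

definition subcategory :: "('o, 'f) cat \<Rightarrow> 'f set \<Rightarrow> bool" where
  "subcategory C W \<longleftrightarrow> W \<subseteq> Arr C \<and> (\<forall>X \<in> Ob C. Id C X \<in> W) \<and>
     (\<forall>f \<in> W. \<forall>g \<in> W. Cod C f = Dom C g \<longrightarrow> Comp C g f \<in> W)"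

definition wide_subcat :: "('o, 'f) cat \<Rightarrow> 'f set \<Rightarrow> ('o, 'f) cat" where
  "wide_subcat C W = C\<lparr>Arr := W\<rparr>"

text \<open>A morphism \<open>u \<rightarrow> v\<close> of the arrow category is a commutative square with the arrows \<open>u\<close>, \<open>v\<close>
  as source and target, \<open>sq_dom : Dom u \<rightarrow> Dom v\<close> and \<open>sq_cod : Cod u \<rightarrow> Cod v\<close>.\<close>

record 'f square =
  sq_src :: 'f
  sq_tgt :: 'f
  sq_dom :: 'f
  sq_cod :: 'f

definition arrow_cat :: "('o, 'f) cat \<Rightarrow> ('f, 'f square) cat" where
  "arrow_cat C = \<lparr>
     Ob = Arr C,
     Arr = {\<sigma>. sq_src \<sigma> \<in> Arr C \<and> sq_tgt \<sigma> \<in> Arr C \<and>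
               sq_dom \<sigma> \<in> Hom C (Dom C (sq_src \<sigma>)) (Dom C (sq_tgt \<sigma>)) \<and>
               sq_cod \<sigma> \<in> Hom C (Cod C (sq_src \<sigma>)) (Cod C (sq_tgt \<sigma>)) \<and>
               Comp C (sq_tgt \<sigma>) (sq_dom \<sigma>) = Comp C (sq_cod \<sigma>) (sq_src \<sigma>)},
     Dom = sq_src,
     Cod = sq_tgt,
     Id = (\<lambda>u. \<lparr>sq_src = u, sq_tgt = u, sq_dom = Id C (Dom C u), sq_cod = Id C (Cod C u)\<rparr>),
     Comp = (\<lambda>\<tau> \<sigma>. \<lparr>sq_src = sq_src \<sigma>, sq_tgt = sq_tgt \<tau>,
               sq_dom = Comp C (sq_dom \<tau>) (sq_dom \<sigma>),
               sq_cod = Comp C (sq_cod \<tau>) (sq_cod \<sigma>)\<rparr>)\<rparr>"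

record ('o1, 'f1, 'o2, 'f2) func =
  on_ob :: "'o1 \<Rightarrow> 'o2"
  on_arr :: "'f1 \<Rightarrow> 'f2"

definition is_functor ::
  "('o1, 'f1) cat \<Rightarrow> ('o2, 'f2) cat \<Rightarrow> ('o1, 'f1, 'o2, 'f2) func \<Rightarrow> bool" where
  "is_functor C D T \<longleftrightarrow> category C \<and> category D \<and>
     (\<forall>X \<in> Ob C. on_ob T X \<in> Ob D) \<and>
     (\<forall>f \<in> Arr C. on_arr T f \<in> Hom D (on_ob T (Dom C f)) (on_ob T (Cod C f))) \<and>
     (\<forall>X \<in> Ob C. on_arr T (Id C X) = Id D (on_ob T X)) \<and>
     (\<forall>f \<in> Arr C. \<forall>g \<in> Arr C. Cod C f = Dom C g \<longrightarrow>
        on_arr T (Comp C g f) = Comp D (on_arr T g) (on_arr T f))"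

section \<open>Brown categories\<close>

text \<open>\<open>u = p i\<close> with \<open>s i = 1\<close>, as a diagram \<open>Dom u \<rightarrow> P \<rightarrow> Cod u\<close> with \<open>s : P \<rightarrow> Dom u\<close>.\<close>

definition factors :: "('o, 'f) cat \<Rightarrow> 'f \<Rightarrow> 'f \<Rightarrow> 'f \<Rightarrow> 'f \<Rightarrow> bool" where
  "factors C u p i s \<longleftrightarrow>
     i \<in> Hom C (Dom C u) (Cod C i) \<and> p \<in> Hom C (Cod C i) (Cod C u) \<and> s \<in> Hom C (Cod C i) (Dom C u) \<and>
     Comp C p i = u \<and> Comp C s i = Id C (Dom C u)"

text \<open>The identities \<open>u = p(u) i(u)\<close> and \<open>s(u) i(u) = 1\<close> are natural in \<open>u\<close>: on a square \<open>\<sigma> : u \<rightarrow> v\<close> the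
  functors act by \<open>sq_dom \<sigma>\<close> and \<open>sq_cod \<sigma>\<close> on the ends and by one common map \<open>P(u) \<rightarrow> P(v)\<close> in
  the middle.\<close>

definition functorial_factorization :: "('o, 'f) cat \<Rightarrow> 'f set \<Rightarrow> 'f set \<Rightarrow> bool" where
  "functorial_factorization C F A \<longleftrightarrow> (\<exists>p i s.
     is_functor (arrow_cat C) (arrow_cat C) p \<and>
     is_functor (arrow_cat C) (arrow_cat C) i \<and>
     is_functor (arrow_cat C) (arrow_cat C) s \<and>
     (\<forall>u \<in> Arr C. factors C u (on_ob p u) (on_ob i u) (on_ob s u) \<and>
        on_ob p u \<in> F \<and> on_ob s u \<in> A) \<and>
     (\<forall>\<sigma> \<in> Arr (arrow_cat C).
        sq_dom (on_arr i \<sigma>) = sq_dom \<sigma> \<and>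
        sq_cod (on_arr p \<sigma>) = sq_cod \<sigma> \<and>
        sq_cod (on_arr s \<sigma>) = sq_dom \<sigma> \<and>
        sq_dom (on_arr p \<sigma>) = sq_cod (on_arr i \<sigma>) \<and>
        sq_dom (on_arr s \<sigma>) = sq_cod (on_arr i \<sigma>)))"

definition two_out_of_three :: "('o, 'f) cat \<Rightarrow> 'f set \<Rightarrow> bool" where
  "two_out_of_three C W \<longleftrightarrow> (\<forall>f \<in> Arr C. \<forall>g \<in> Arr C. Cod C f = Dom C g \<longrightarrow>
     (f \<in> W \<and> g \<in> W \<longrightarrow> Comp C g f \<in> W) \<and>
     (f \<in> W \<and> Comp C g f \<in> W \<longrightarrow> g \<in> W) \<and>
     (g \<in> W \<and> Comp C g f \<in> W \<longrightarrow> f \<in> W))"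

definition pullback_closed :: "('o, 'f) cat \<Rightarrow> 'f set \<Rightarrow> bool" where
  "pullback_closed C A \<longleftrightarrow> (\<forall>p \<in> A. \<forall>g \<in> Arr C. Cod C p = Cod C g \<longrightarrow>
     (\<exists>p' g'. is_pullback C p g p' g') \<and>
     (\<forall>p' g'. is_pullback C p g p' g' \<longrightarrow> p' \<in> A))"

text \<open>The choice of the final object does not matter since fibrations contain the isomorphisms and
  are closed under composition; fibrancy is required with respect to every one.\<close>

locale almost_brown_category = category C for C :: "('o, 'f) cat" +
  fixes W :: "'f set" and F :: "'f set"
  assumes finite_products: "has_finite_products C"
    and final: "\<exists>e. final_object C e"
    and W_Arr: "W \<subseteq> Arr C"
    and F_Arr: "F \<subseteq> Arr C"
    and W_two_out_of_three: "two_out_of_three C W"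
    and W_isos: "isos C \<subseteq> W"
    and F_Comp: "f \<in> F \<Longrightarrow> g \<in> F \<Longrightarrow> Cod C f = Dom C g \<Longrightarrow> Comp C g f \<in> F"
    and F_isos: "isos C \<subseteq> F"
    and acyclic_pullback: "pullback_closed C (W \<inter> F)"
    and factorization: "u \<in> Arr C \<Longrightarrow> \<exists>p i s. factors C u p i s \<and> p \<in> F \<and> s \<in> W \<inter> F"
    and fibrant: "final_object C e \<Longrightarrow> t \<in> Hom C X e \<Longrightarrow> t \<in> F"

locale almost_brown_category_functorial = almost_brown_category +
  assumes functorial: "functorial_factorization C F (W \<inter> F)"

text \<open>\<open>W\<close> and \<open>A\<close> are the arrows of the subcategories of weak equivalences and of acyclic
  fibrations.\<close>

locale partial_brown_category = category C for C :: "('o, 'f) cat" +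
  fixes W :: "'f set" and A :: "'f set"
  assumes W_subcategory: "subcategory C W"
    and A_subcategory: "subcategory C A"
    and W_isos: "isos C \<subseteq> W"
    and A_isos: "isos C \<subseteq> A"
    and A_W: "A \<subseteq> W"
    and W_two_out_of_three: "two_out_of_three C W"
    and A_pullback: "pullback_closed C A"
    and functorial: "functorial_factorization (wide_subcat C W) A A"

section \<open>Bigraded complexes\<close>

definition mod_hom ::
  "('a, 'b) ring_scheme \<Rightarrow> ('a, 'm) module \<Rightarrow> ('a, 'n) module \<Rightarrow> ('m \<Rightarrow> 'n) set" where
  "mod_hom R M N = {h \<in> hom (add_monoid M) (add_monoid N).
     \<forall>a \<in> carrier R. \<forall>x \<in> carrier M. h (a \<odot>\<^bsub>M\<^esub> x) = a \<odot>\<^bsub>N\<^esub> h x}"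

definition mod_iso ::
  "('a, 'b) ring_scheme \<Rightarrow> ('a, 'm) module \<Rightarrow> ('a, 'n) module \<Rightarrow> ('m \<Rightarrow> 'n) set" where
  "mod_iso R M N = {h \<in> mod_hom R M N. bij_betw h (carrier M) (carrier N)}"

text \<open>The module record extends the ring record, whose multiplicative fields play no role for
  modules.\<close>

definition quot_mod :: "('a, 'm) module \<Rightarrow> 'm set \<Rightarrow> ('a, 'm set) module" where
  "quot_mod M N = \<lparr>
     carrier = a_rcosets\<^bsub>M\<^esub> N, mult = undefined, one = undefined,
     zero = N, add = set_add M,
     smult = (\<lambda>a X. \<Union>x \<in> X. N +>\<^bsub>M\<^esub> (a \<odot>\<^bsub>M\<^esub> x))\<rparr>"

record ('a, 'm) bicomplex =
  cmod :: "int \<Rightarrow> int \<Rightarrow> ('a, 'm) module"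
  cdiff :: "int \<Rightarrow> int \<Rightarrow> 'm \<Rightarrow> 'm"

definition bigraded_complex ::
  "('a, 'b) ring_scheme \<Rightarrow> nat \<Rightarrow> ('a, 'm) bicomplex \<Rightarrow> bool" where
  "bigraded_complex R m A \<longleftrightarrow> (\<forall>p q.
     module R (cmod A p q) \<and>
     cdiff A p q \<in> mod_hom R (cmod A p q) (cmod A (p - int m) (q + 1 - int m)) \<and>
     (\<forall>x \<in> carrier (cmod A p q).
        cdiff A (p - int m) (q + 1 - int m) (cdiff A p q x)
          = \<zero>\<^bsub>cmod A (p - 2 * int m) (q + 2 - 2 * int m)\<^esub>))"

definition complex_mor ::
  "('a, 'b) ring_scheme \<Rightarrow> nat \<Rightarrow> ('a, 'm) bicomplex \<Rightarrow> ('a, 'm) bicomplex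
     \<Rightarrow> (int \<Rightarrow> int \<Rightarrow> 'm \<Rightarrow> 'm) \<Rightarrow> bool" where
  "complex_mor R m A B f \<longleftrightarrow> (\<forall>p q.
     f p q \<in> mod_hom R (cmod A p q) (cmod B p q) \<and>
     (\<forall>x \<in> carrier (cmod A p q).
        f (p - int m) (q + 1 - int m) (cdiff A p q x) = cdiff B p q (f p q x)))"

definition cycles :: "nat \<Rightarrow> ('a, 'm) bicomplex \<Rightarrow> int \<Rightarrow> int \<Rightarrow> 'm set" where
  "cycles m A p q =
     {x \<in> carrier (cmod A p q). cdiff A p q x = \<zero>\<^bsub>cmod A (p - int m) (q + 1 - int m)\<^esub>}"

definition boundaries :: "nat \<Rightarrow> ('a, 'm) bicomplex \<Rightarrow> int \<Rightarrow> int \<Rightarrow> 'm set" where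
  "boundaries m A p q =
     cdiff A (p + int m) (q - 1 + int m) ` carrier (cmod A (p + int m) (q - 1 + int m))"

definition homology ::
  "nat \<Rightarrow> ('a, 'm) bicomplex \<Rightarrow> int \<Rightarrow> int \<Rightarrow> ('a, 'm set) module" where
  "homology m A p q =
     quot_mod ((cmod A p q)\<lparr>carrier := cycles m A p q\<rparr>) (boundaries m A p q)"

text \<open>The induced map on homology: a class \<open>X\<close> goes to the common class of all \<open>f x\<close>, \<open>x \<in> X\<close>.\<close>

definition homology_map ::
  "nat \<Rightarrow> ('a, 'm) bicomplex \<Rightarrow> (int \<Rightarrow> int \<Rightarrow> 'm \<Rightarrow> 'm) \<Rightarrow> int \<Rightarrow> int \<Rightarrow> 'm set \<Rightarrow> 'm set" where
  "homology_map m B f p q X = (\<Union>x \<in> X. boundaries m B p q +>\<^bsub>cmod B p q\<^esub> f p q x)"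

definition quasi_iso ::
  "('a, 'b) ring_scheme \<Rightarrow> nat \<Rightarrow> ('a, 'm) bicomplex \<Rightarrow> ('a, 'm) bicomplex
     \<Rightarrow> (int \<Rightarrow> int \<Rightarrow> 'm \<Rightarrow> 'm) \<Rightarrow> bool" where
  "quasi_iso R m A B f \<longleftrightarrow> complex_mor R m A B f \<and>
     (\<forall>p q. homology_map m B f p q \<in> mod_iso R (homology m A p q) (homology m B p q))"

section \<open>Spectral sequences\<close>

text \<open>The type \<open>'m\<close> is the universe of the category: the underlying sets of all modules on the pages
  are subsets of \<open>'m\<close>. Homology modules live on \<open>'m set\<close>, so it is the characteristic maps that
  carry them back to \<open>'m\<close>. A finite \<open>'m\<close> is in general too small for products.\<close>

record ('a, 'm) spse =
  page :: "nat \<Rightarrow> ('a, 'm) bicomplex"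
  chi :: "nat \<Rightarrow> int \<Rightarrow> int \<Rightarrow> 'm set \<Rightarrow> 'm"

definition spectral_sequence :: "('a, 'b) ring_scheme \<Rightarrow> ('a, 'm) spse \<Rightarrow> bool" where
  "spectral_sequence R S \<longleftrightarrow> (\<forall>m.
     bigraded_complex R m (page S m) \<and>
     (\<forall>p q. chi S m p q \<in> mod_iso R (homology m (page S m) p q) (cmod (page S (Suc m)) p q)))"

record ('a, 'm) spse_mor =
  src :: "('a, 'm) spse"
  tgt :: "('a, 'm) spse"
  fmap :: "nat \<Rightarrow> int \<Rightarrow> int \<Rightarrow> 'm \<Rightarrow> 'm"

text \<open>Components are extensional, so that two morphisms are equal as soon as they agree on carriers.\<close>

definition spse_morphism :: "('a, 'b) ring_scheme \<Rightarrow> ('a, 'm) spse_mor \<Rightarrow> bool" where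
  "spse_morphism R f \<longleftrightarrow> spectral_sequence R (src f) \<and> spectral_sequence R (tgt f) \<and> (\<forall>m.
     complex_mor R m (page (src f) m) (page (tgt f) m) (fmap f m) \<and>
     (\<forall>p q. fmap f m p q \<in> extensional (carrier (cmod (page (src f) m) p q)) \<and>
        (\<forall>X \<in> carrier (homology m (page (src f) m) p q).
           fmap f (Suc m) p q (chi (src f) m p q X)
             = chi (tgt f) m p q (homology_map m (page (tgt f) m) (fmap f m) p q X))))"

definition SpSe :: "('a, 'b) ring_scheme \<Rightarrow> (('a, 'm) spse, ('a, 'm) spse_mor) cat" where
  "SpSe R = \<lparr>
     Ob = {S. spectral_sequence R S},
     Arr = {f. spse_morphism R f},
     Dom = src,
     Cod = tgt,
     Id = (\<lambda>S. \<lparr>src = S, tgt = S,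
             fmap = (\<lambda>m p q. restrict (\<lambda>x. x) (carrier (cmod (page S m) p q)))\<rparr>),
     Comp = (\<lambda>g f. \<lparr>src = src f, tgt = tgt g,
             fmap = (\<lambda>m p q. compose (carrier (cmod (page (src f) m) p q))
                               (fmap g m p q) (fmap f m p q))\<rparr>)\<rparr>"

definition E_quasi_isos :: "('a, 'b) ring_scheme \<Rightarrow> nat \<Rightarrow> ('a, 'm) spse_mor set" where
  "E_quasi_isos R r = {f \<in> Arr (SpSe R).
     quasi_iso R r (page (src f) r) (page (tgt f) r) (fmap f r)}"

definition r_fibrations :: "('a, 'b) ring_scheme \<Rightarrow> nat \<Rightarrow> ('a, 'm) spse_mor set" where
  "r_fibrations R r = {f \<in> Arr (SpSe R). \<forall>k \<le> r. \<forall>p q.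
     fmap f k p q ` carrier (cmod (page (src f) k) p q) = carrier (cmod (page (tgt f) k) p q)}"

end

theory Submission
  imports Defs
begin

text \<open>Composing a characteristic map with the projection of cycles onto homology gives a linear
  surjection from the cycles of page \<open>m\<close> onto page \<open>m + 1\<close> whose kernel is the boundaries. Through
  these surjections, \<open>f\<close> is an \<open>E\<^sub>r\<close>-quasi-isomorphism iff it is bijective on
  page \<open>r + 1\<close>, hence on all later pages.

  An acyclic \<open>r\<close>-fibration is therefore surjective on every page. For such a map the degreewise fibre
  product with any map is again a spectral sequence, since surjectivity on a page and on the next one
  makes the connecting maps vanish.

  For the factorization of \<open>u : A \<rightarrow> B\<close>, let \<open>C(B)\<close> be \<open>B \<oplus> B[r]\<close> on the pages below \<open>r\<close>, the cone with
  \<open>d(x, y) = (dx, x - dy)\<close> on page \<open>r\<close>, and zero beyond. It is acyclic at page \<open>r\<close> and projects onto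
  \<open>B\<close> on the pages up to \<open>r\<close>, so \<open>A \<rightarrow> A \<times> C(B) \<rightarrow> B\<close>, with second map \<open>u + proj\<close>, is the required
  factorization.\<close>

section \<open>Modules and their quotients\<close>

text \<open>Homology does not commute with fibre products in general, so a degreewise fibre product
  of spectral sequences need not be one. Along a map f : X -> Y that is onto on all pages, 0 -> X
  \<times>_Y Z -> X \<oplus> Z -> Y -> 0 is an exact sequence of complexes and H(X) -> H(Y) is onto,
  so the long exact sequence breaks up and H(X \<times>_Y Z) is the fibre product of H(X) and H(Z)
  over H(Y). The proof chases elements to the same effect. The shift by (r, r - 1) in B[r] is
  opposite to the bidegree (-r, 1 - r) of the differential on page r; it lets the summand x of x -
  dy land in the right bidegree. The minus sign makes the square vanish, and (y, 0) bounds (dy, y).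
  Acyclicity on page r forces all later pages to be zero, which is harmless because an r-fibration
  is tested only up to page r. Since every module has its elements in the one type
  \<open>'m\<close>, pairs are coded as elements of \<open>'m\<close>; an infinite type absorbs its
  own square.\<close>

lemma mod_homD:
  assumes "h \<in> mod_hom R M N"
  shows "x \<in> carrier M \<Longrightarrow> h x \<in> carrier N"
    and "x \<in> carrier M \<Longrightarrow> y \<in> carrier M \<Longrightarrow> h (x \<oplus>\<^bsub>M\<^esub> y) = h x \<oplus>\<^bsub>N\<^esub> h y"
    and "a \<in> carrier R \<Longrightarrow> x \<in> carrier M \<Longrightarrow> h (a \<odot>\<^bsub>M\<^esub> x) = a \<odot>\<^bsub>N\<^esub> h x"
  using assms by (auto simp: mod_hom_def hom_def)

lemma mod_homI:
  assumes "\<And>x. x \<in> carrier M \<Longrightarrow> h x \<in> carrier N"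
    and "\<And>x y. x \<in> carrier M \<Longrightarrow> y \<in> carrier M \<Longrightarrow> h (x \<oplus>\<^bsub>M\<^esub> y) = h x \<oplus>\<^bsub>N\<^esub> h y"
    and "\<And>a x. a \<in> carrier R \<Longrightarrow> x \<in> carrier M \<Longrightarrow> h (a \<odot>\<^bsub>M\<^esub> x) = a \<odot>\<^bsub>N\<^esub> h x"
  shows "h \<in> mod_hom R M N"
  using assms by (auto simp: mod_hom_def hom_def)

lemma mod_hom_zero:
  assumes "module R M" "module R N" "h \<in> mod_hom R M N"
  shows "h \<zero>\<^bsub>M\<^esub> = \<zero>\<^bsub>N\<^esub>"
proof -
  interpret M: module R M by fact
  interpret N: module R N by fact
  have "h \<zero>\<^bsub>M\<^esub> = h \<zero>\<^bsub>M\<^esub> \<oplus>\<^bsub>N\<^esub> h \<zero>\<^bsub>M\<^esub>"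
    using mod_homD(2)[OF assms(3), of "\<zero>\<^bsub>M\<^esub>" "\<zero>\<^bsub>M\<^esub>"] by simp
  with mod_homD(1)[OF assms(3), of "\<zero>\<^bsub>M\<^esub>"] show ?thesis
    by (metis M.M.zero_closed N.M.l_zero N.M.add.right_cancel N.M.zero_closed)
qed

lemma mod_hom_minus:
  assumes "module R M" "module R N" "h \<in> mod_hom R M N" "x \<in> carrier M" "y \<in> carrier M"
  shows "h (x \<ominus>\<^bsub>M\<^esub> y) = h x \<ominus>\<^bsub>N\<^esub> h y"
proof -
  interpret M: module R M by fact
  interpret N: module R N by fact
  have c: "h x \<in> carrier N" "h y \<in> carrier N" "h (x \<ominus>\<^bsub>M\<^esub> y) \<in> carrier N"
    using assms mod_homD(1)[OF assms(3)] by auto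
  have "h x = h (x \<ominus>\<^bsub>M\<^esub> y) \<oplus>\<^bsub>N\<^esub> h y"
    using assms(4,5) mod_homD(2)[OF assms(3), of "x \<ominus>\<^bsub>M\<^esub> y" y]
    by (simp add: M.M.minus_eq M.M.add.m_assoc M.M.l_neg)
  then show ?thesis
    using c by (simp add: N.M.minus_eq N.M.add.m_assoc N.M.r_neg)
qed

text \<open>The modules built here (cycles, fibre products, zero) are records with explicit
  operations, so the axioms are wanted in elementary form. Negatives are asked to exist: for cycles
  and fibre products the scalar multiple by -1 serves, because linear maps respect it.\<close>

lemma moduleI':
  fixes M :: "('a, 'm) module"
  assumes "cring R"
    and "\<zero>\<^bsub>M\<^esub> \<in> carrier M"
    and "\<And>x y. x \<in> carrier M \<Longrightarrow> y \<in> carrier M \<Longrightarrow> x \<oplus>\<^bsub>M\<^esub> y \<in> carrier M"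
    and "\<And>x y z. x \<in> carrier M \<Longrightarrow> y \<in> carrier M \<Longrightarrow> z \<in> carrier M \<Longrightarrow>
      x \<oplus>\<^bsub>M\<^esub> y \<oplus>\<^bsub>M\<^esub> z = x \<oplus>\<^bsub>M\<^esub> (y \<oplus>\<^bsub>M\<^esub> z)"
    and "\<And>x y. x \<in> carrier M \<Longrightarrow> y \<in> carrier M \<Longrightarrow> x \<oplus>\<^bsub>M\<^esub> y = y \<oplus>\<^bsub>M\<^esub> x"
    and "\<And>x. x \<in> carrier M \<Longrightarrow> \<zero>\<^bsub>M\<^esub> \<oplus>\<^bsub>M\<^esub> x = x"
    and "\<And>x. x \<in> carrier M \<Longrightarrow> \<exists>y \<in> carrier M. y \<oplus>\<^bsub>M\<^esub> x = \<zero>\<^bsub>M\<^esub>"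
    and "\<And>a x. a \<in> carrier R \<Longrightarrow> x \<in> carrier M \<Longrightarrow> a \<odot>\<^bsub>M\<^esub> x \<in> carrier M"
    and "\<And>a b x. a \<in> carrier R \<Longrightarrow> b \<in> carrier R \<Longrightarrow> x \<in> carrier M \<Longrightarrow>
      (a \<oplus>\<^bsub>R\<^esub> b) \<odot>\<^bsub>M\<^esub> x = (a \<odot>\<^bsub>M\<^esub> x) \<oplus>\<^bsub>M\<^esub> (b \<odot>\<^bsub>M\<^esub> x)"
    and "\<And>a x y. a \<in> carrier R \<Longrightarrow> x \<in> carrier M \<Longrightarrow> y \<in> carrier M \<Longrightarrow>
      a \<odot>\<^bsub>M\<^esub> (x \<oplus>\<^bsub>M\<^esub> y) = (a \<odot>\<^bsub>M\<^esub> x) \<oplus>\<^bsub>M\<^esub> (a \<odot>\<^bsub>M\<^esub> y)"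
    and "\<And>a b x. a \<in> carrier R \<Longrightarrow> b \<in> carrier R \<Longrightarrow> x \<in> carrier M \<Longrightarrow>
      (a \<otimes>\<^bsub>R\<^esub> b) \<odot>\<^bsub>M\<^esub> x = a \<odot>\<^bsub>M\<^esub> (b \<odot>\<^bsub>M\<^esub> x)"
    and "\<And>x. x \<in> carrier M \<Longrightarrow> \<one>\<^bsub>R\<^esub> \<odot>\<^bsub>M\<^esub> x = x"
  shows "module R M"
proof (rule moduleI)
  show "abelian_group M"
    by (rule abelian_groupI) (use assms in auto)
qed (use assms in auto)

lemma (in abelian_group) a_inv_zero: "\<ominus> \<zero> = \<zero>"
  by (metis add.inv_closed l_zero r_neg zero_closed)

lemma (in abelian_group) diff_eq_zero_iff:
  "x \<in> carrier G \<Longrightarrow> y \<in> carrier G \<Longrightarrow> x \<ominus> y = \<zero> \<longleftrightarrow> x = y"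
  by (metis a_minus_def add.inv_closed minus_equality minus_minus r_neg)

lemma (in abelian_group) diff_zero: "x \<in> carrier G \<Longrightarrow> x \<ominus> \<zero> = x"
  by (simp add: minus_eq a_inv_zero)

lemma (in abelian_group) diff_self: "x \<in> carrier G \<Longrightarrow> x \<ominus> x = \<zero>"
  by (simp add: minus_eq r_neg)

lemma (in abelian_group) add_diff_cancel:
  "x \<in> carrier G \<Longrightarrow> y \<in> carrier G \<Longrightarrow> x \<oplus> (y \<ominus> x) = y"
  by (subst minus_eq, subst a_lcomm) (auto simp: r_neg)

lemma (in abelian_group) diff_diff_cancel:
  "x \<in> carrier G \<Longrightarrow> y \<in> carrier G \<Longrightarrow> x \<ominus> (x \<ominus> y) = y"
  by (simp add: minus_eq minus_add a_assoc[symmetric] r_neg)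

text \<open>Meant for \<open>M\<close> the cycles and \<open>B\<close> the boundaries of one
  bidegree. Closure under negatives comes from scaling by -1.\<close>

locale quotient_module = module R M for R :: "('a, 'b) ring_scheme" and M :: "('a, 'm) module" +
  fixes B :: "'m set"
  assumes B_sub: "B \<subseteq> carrier M"
    and B_zero: "\<zero>\<^bsub>M\<^esub> \<in> B"
    and B_add: "x \<in> B \<Longrightarrow> y \<in> B \<Longrightarrow> x \<oplus>\<^bsub>M\<^esub> y \<in> B"
    and B_smult: "a \<in> carrier R \<Longrightarrow> x \<in> B \<Longrightarrow> a \<odot>\<^bsub>M\<^esub> x \<in> B"
begin

lemma B_neg: "x \<in> B \<Longrightarrow> \<ominus>\<^bsub>M\<^esub> x \<in> B"
  using B_smult[of "\<ominus>\<^bsub>R\<^esub> \<one>\<^bsub>R\<^esub>" x] B_sub by (auto simp: smult_l_minus)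

lemma B_subgroup: "abelian_subgroup B M"
proof (rule abelian_subgroupI3)
  show "additive_subgroup B M"
    unfolding additive_subgroup_def
    by (rule group.subgroupI) (use B_sub B_zero B_add B_neg in \<open>auto simp: a_inv_def[symmetric] M.a_group\<close>)
qed (rule M.abelian_group_axioms)

sublocale abelian_subgroup B M
  by (rule B_subgroup)

lemma coset_iff: "z \<in> B +>\<^bsub>M\<^esub> x \<longleftrightarrow> (\<exists>b \<in> B. z = b \<oplus>\<^bsub>M\<^esub> x)"
  by (auto simp: a_r_coset_def')

lemma coset_eq_iff:
  assumes "x \<in> carrier M" "y \<in> carrier M"
  shows "B +>\<^bsub>M\<^esub> x = B +>\<^bsub>M\<^esub> y \<longleftrightarrow> x \<ominus>\<^bsub>M\<^esub> y \<in> B"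
proof -
  have "B +>\<^bsub>M\<^esub> x = B +>\<^bsub>M\<^esub> y \<longleftrightarrow> x \<in> B +>\<^bsub>M\<^esub> y"
    using a_repr_independence'[of x y] a_repr_independenceD[of x y] assms by auto
  then show ?thesis
    using a_rcos_module[of y x] assms by (simp add: M.minus_eq)
qed

lemma coset_self: "x \<in> carrier M \<Longrightarrow> x \<in> B +>\<^bsub>M\<^esub> x"
  by (rule a_rcos_self)

lemma carrier_quot: "carrier (quot_mod M B) = (\<lambda>x. B +>\<^bsub>M\<^esub> x) ` carrier M"
  by (auto simp: quot_mod_def A_RCOSETS_def')

lemma add_quot:
  assumes "x \<in> carrier M" "y \<in> carrier M"
  shows "(B +>\<^bsub>M\<^esub> x) \<oplus>\<^bsub>quot_mod M B\<^esub> (B +>\<^bsub>M\<^esub> y) = B +>\<^bsub>M\<^esub> (x \<oplus>\<^bsub>M\<^esub> y)"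
  using a_rcos_sum[OF assms] by (simp add: quot_mod_def)

text \<open>Scaling in \<open>quot_mod\<close> takes a union over all representatives. Changing the
  representative by an element of \<open>B\<close> moves the result by an element of
  \<open>B\<close>, so the union is a single coset.\<close>

lemma smult_quot:
  assumes "a \<in> carrier R" "x \<in> carrier M"
  shows "a \<odot>\<^bsub>quot_mod M B\<^esub> (B +>\<^bsub>M\<^esub> x) = B +>\<^bsub>M\<^esub> (a \<odot>\<^bsub>M\<^esub> x)"
proof -
  have "B +>\<^bsub>M\<^esub> (a \<odot>\<^bsub>M\<^esub> z) = B +>\<^bsub>M\<^esub> (a \<odot>\<^bsub>M\<^esub> x)" if z: "z \<in> B +>\<^bsub>M\<^esub> x" for z
  proof -
    from z obtain b where b: "b \<in> B" "z = b \<oplus>\<^bsub>M\<^esub> x" by (auto simp: coset_iff)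
    have "a \<odot>\<^bsub>M\<^esub> b \<in> B" using b B_smult assms by auto
    moreover have "a \<odot>\<^bsub>M\<^esub> z \<ominus>\<^bsub>M\<^esub> a \<odot>\<^bsub>M\<^esub> x = a \<odot>\<^bsub>M\<^esub> b"
      using b B_sub assms by (auto simp: smult_r_distr M.minus_eq M.add.m_assoc M.r_neg subset_iff)
    moreover have "z \<in> carrier M" using b B_sub assms by auto
    ultimately show ?thesis using assms by (subst coset_eq_iff) auto
  qed
  then have "(\<Union>z \<in> B +>\<^bsub>M\<^esub> x. B +>\<^bsub>M\<^esub> (a \<odot>\<^bsub>M\<^esub> z)) = B +>\<^bsub>M\<^esub> (a \<odot>\<^bsub>M\<^esub> x)"
    using coset_self[OF assms(2)] by blast
  then show ?thesis by (simp add: quot_mod_def)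
qed

text \<open>The first isomorphism theorem, in the direction that builds characteristic maps.
  \<open>h\<close> is constrained on cosets alone, so it may be defined by choosing
  representatives.\<close>

lemma mod_iso_of_surjection:
  assumes N: "module R N" and c: "c \<in> mod_hom R M N" and surj: "c ` carrier M = carrier N"
    and ker: "\<And>x. x \<in> carrier M \<Longrightarrow> c x = \<zero>\<^bsub>N\<^esub> \<longleftrightarrow> x \<in> B"
    and h: "\<And>x. x \<in> carrier M \<Longrightarrow> h (B +>\<^bsub>M\<^esub> x) = c x"
  shows "h \<in> mod_iso R (quot_mod M B) N"
proof -
  interpret N: module R N by fact
  note cD = mod_homD[OF c]
  have "h \<in> mod_hom R (quot_mod M B) N"
    by (rule mod_homI) (auto simp: carrier_quot h cD add_quot smult_quot)
  moreover have "inj_on h (carrier (quot_mod M B))"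
  proof (rule inj_onI)
    fix X Y assume XY: "X \<in> carrier (quot_mod M B)" "Y \<in> carrier (quot_mod M B)" "h X = h Y"
    from XY obtain x y where x: "x \<in> carrier M" "X = B +>\<^bsub>M\<^esub> x" and y: "y \<in> carrier M" "Y = B +>\<^bsub>M\<^esub> y"
      by (auto simp: carrier_quot)
    have "c (x \<ominus>\<^bsub>M\<^esub> y) = c x \<ominus>\<^bsub>N\<^esub> c y"
      by (rule mod_hom_minus[OF module_axioms N c]) (use x y in auto)
    also have "\<dots> = \<zero>\<^bsub>N\<^esub>"
      using XY(3) x y cD(1) by (simp add: h N.M.minus_eq N.M.r_neg)
    finally have "x \<ominus>\<^bsub>M\<^esub> y \<in> B" using ker x y by auto
    then show "X = Y" using x y by (simp add: coset_eq_iff)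
  qed
  moreover have "h ` carrier (quot_mod M B) = carrier N"
    using surj by (auto simp: carrier_quot h image_image)
  ultimately show ?thesis by (simp add: mod_iso_def bij_betw_def)
qed

text \<open>The converse direction: it takes a characteristic map apart, so that later arguments can
  speak of cycles and boundaries instead of cosets.\<close>

lemma surjection_of_mod_iso:
  assumes N: "module R N" and h: "h \<in> mod_iso R (quot_mod M B) N"
  defines "c \<equiv> \<lambda>x. h (B +>\<^bsub>M\<^esub> x)"
  shows "c \<in> mod_hom R M N" "c ` carrier M = carrier N"
    "x \<in> carrier M \<Longrightarrow> c x = \<zero>\<^bsub>N\<^esub> \<longleftrightarrow> x \<in> B"
proof -
  interpret N: module R N by fact
  have hh: "h \<in> mod_hom R (quot_mod M B) N" and inj: "inj_on h (carrier (quot_mod M B))"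
    and sur: "h ` carrier (quot_mod M B) = carrier N"
    using h by (auto simp: mod_iso_def bij_betw_def)
  note hD = mod_homD[OF hh]
  show c: "c \<in> mod_hom R M N"
  proof (rule mod_homI)
    show "c x \<in> carrier N" if "x \<in> carrier M" for x
      using that hD(1) by (auto simp: c_def carrier_quot)
    show "c (x \<oplus>\<^bsub>M\<^esub> y) = c x \<oplus>\<^bsub>N\<^esub> c y" if "x \<in> carrier M" "y \<in> carrier M" for x y
      using that hD(2) by (auto simp: c_def carrier_quot add_quot[symmetric])
    show "c (a \<odot>\<^bsub>M\<^esub> x) = a \<odot>\<^bsub>N\<^esub> c x" if "a \<in> carrier R" "x \<in> carrier M" for a x
      using that hD(3) by (auto simp: c_def carrier_quot smult_quot[symmetric])
  qed
  show "c ` carrier M = carrier N"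
    using sur by (auto simp: c_def carrier_quot image_image)
  assume x: "x \<in> carrier M"
  have "c \<zero>\<^bsub>M\<^esub> = \<zero>\<^bsub>N\<^esub>" by (rule mod_hom_zero[OF module_axioms N c])
  then have "c x = \<zero>\<^bsub>N\<^esub> \<longleftrightarrow> c x = c \<zero>\<^bsub>M\<^esub>" by simp
  also have "\<dots> \<longleftrightarrow> B +>\<^bsub>M\<^esub> x = B +>\<^bsub>M\<^esub> \<zero>\<^bsub>M\<^esub>"
    using inj x by (auto simp: c_def carrier_quot inj_on_def)
  also have "\<dots> \<longleftrightarrow> x \<in> B"
    using x by (simp add: coset_eq_iff M.minus_eq M.a_inv_zero)
  finally show "c x = \<zero>\<^bsub>N\<^esub> \<longleftrightarrow> x \<in> B" .
qed

end

section \<open>Brown categories\<close>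

context category
begin

lemma HomD: "f \<in> Hom C X Y \<Longrightarrow> f \<in> Arr C" "f \<in> Hom C X Y \<Longrightarrow> Dom C f = X"
    "f \<in> Hom C X Y \<Longrightarrow> Cod C f = Y" "f \<in> Hom C X Y \<Longrightarrow> X \<in> Ob C" "f \<in> Hom C X Y \<Longrightarrow> Y \<in> Ob C"
  using Dom_Ob Cod_Ob by (auto simp: Hom_def)

lemma Arr_Hom: "f \<in> Arr C \<Longrightarrow> f \<in> Hom C (Dom C f) (Cod C f)"
  by (simp add: Hom_def)

lemma Id_isos: "X \<in> Ob C \<Longrightarrow> Id C X \<in> isos C"
  using Id_Hom[of X] Comp_Id[OF Id_Hom[of X]] HomD[OF Id_Hom[of X]]
  by (force simp: isos_def)

lemma category_wide_subcat:
  assumes "subcategory C W"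
  shows "category (wide_subcat C W)"
proof -
  have Hom: "Hom (wide_subcat C W) X Y = Hom C X Y \<inter> W" for X Y
    using assms by (auto simp: Hom_def wide_subcat_def subcategory_def)
  have W: "W \<subseteq> Arr C" "\<And>X. X \<in> Ob C \<Longrightarrow> Id C X \<in> W"
    "\<And>f g. f \<in> W \<Longrightarrow> g \<in> W \<Longrightarrow> Cod C f = Dom C g \<Longrightarrow> Comp C g f \<in> W"
    using assms by (auto simp: subcategory_def)
  have s: "Ob (wide_subcat C W) = Ob C" "Arr (wide_subcat C W) = W" "Dom (wide_subcat C W) = Dom C"
    "Cod (wide_subcat C W) = Cod C" "Id (wide_subcat C W) = Id C" "Comp (wide_subcat C W) = Comp C"
    by (auto simp: wide_subcat_def)
  show ?thesis
  proof (unfold_locales, unfold s Hom)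
    show "Comp C g f \<in> Hom C X Z \<inter> W" if "f \<in> Hom C X Y \<inter> W" "g \<in> Hom C Y Z \<inter> W" for f g X Y Z
      using that Comp_Hom[of f X Y g Z] W(3)[of f g] HomD(2,3) by auto
  qed (use W Dom_Ob Cod_Ob Id_Hom Comp_Id Id_Comp Comp_assoc in auto)
qed

lemma arrow_cat_simps:
  "Ob (arrow_cat D) = Arr D" "Dom (arrow_cat D) = sq_src" "Cod (arrow_cat D) = sq_tgt"
  "Id (arrow_cat D) u = \<lparr>sq_src = u, sq_tgt = u, sq_dom = Id D (Dom D u), sq_cod = Id D (Cod D u)\<rparr>"
  "Comp (arrow_cat D) \<tau> \<sigma> = \<lparr>sq_src = sq_src \<sigma>, sq_tgt = sq_tgt \<tau>,
     sq_dom = Comp D (sq_dom \<tau>) (sq_dom \<sigma>), sq_cod = Comp D (sq_cod \<tau>) (sq_cod \<sigma>)\<rparr>"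
  "\<sigma> \<in> Arr (arrow_cat D) \<longleftrightarrow> sq_src \<sigma> \<in> Arr D \<and> sq_tgt \<sigma> \<in> Arr D \<and>
     sq_dom \<sigma> \<in> Hom D (Dom D (sq_src \<sigma>)) (Dom D (sq_tgt \<sigma>)) \<and>
     sq_cod \<sigma> \<in> Hom D (Cod D (sq_src \<sigma>)) (Cod D (sq_tgt \<sigma>)) \<and>
     Comp D (sq_tgt \<sigma>) (sq_dom \<sigma>) = Comp D (sq_cod \<sigma>) (sq_src \<sigma>)"
  by (simp_all add: arrow_cat_def)

lemma category_arrow_cat: "category (arrow_cat C)"
proof
  fix X assume "X \<in> Ob (arrow_cat C)"
  then have X: "X \<in> Arr C" by (simp add: arrow_cat_simps)
  then show "Id (arrow_cat C) X \<in> Hom (arrow_cat C) X X"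
    using Comp_Id[OF Arr_Hom[OF X]] Id_Comp[OF Arr_Hom[OF X]] Id_Hom Dom_Ob Cod_Ob
    by (simp add: Hom_def[of "arrow_cat C"] arrow_cat_simps)
next
  fix f X Y g Z
  assume f: "f \<in> Hom (arrow_cat C) X Y" and g: "g \<in> Hom (arrow_cat C) Y Z"
  then have f': "sq_src f = X" "sq_tgt f = Y" "X \<in> Arr C" "Y \<in> Arr C"
      "sq_dom f \<in> Hom C (Dom C X) (Dom C Y)" "sq_cod f \<in> Hom C (Cod C X) (Cod C Y)"
      "Comp C Y (sq_dom f) = Comp C (sq_cod f) X"
    and g': "sq_src g = Y" "sq_tgt g = Z" "Z \<in> Arr C"
      "sq_dom g \<in> Hom C (Dom C Y) (Dom C Z)" "sq_cod g \<in> Hom C (Cod C Y) (Cod C Z)"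
      "Comp C Z (sq_dom g) = Comp C (sq_cod g) Y"
    by (auto simp: Hom_def[of "arrow_cat C"] arrow_cat_simps)
  \<comment> \<open>Pasting of the two commuting squares.\<close>
  have "Comp C Z (Comp C (sq_dom g) (sq_dom f)) = Comp C (Comp C Z (sq_dom g)) (sq_dom f)"
    using Comp_assoc[OF f'(5) g'(4) Arr_Hom[OF g'(3)]] .
  also have "\<dots> = Comp C (sq_cod g) (Comp C Y (sq_dom f))"
    using Comp_assoc[OF f'(5) Arr_Hom[OF f'(4)] g'(5)] g'(6) by simp
  also have "\<dots> = Comp C (Comp C (sq_cod g) (sq_cod f)) X"
    using Comp_assoc[OF Arr_Hom[OF f'(3)] f'(6) g'(5)] f'(7) by simp
  finally show "Comp (arrow_cat C) g f \<in> Hom (arrow_cat C) X Z"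
    using f' g' Comp_Hom[OF f'(5) g'(4)] Comp_Hom[OF f'(6) g'(5)]
    by (simp add: Hom_def[of "arrow_cat C"] arrow_cat_simps)
next
  fix f X Y assume f: "f \<in> Hom (arrow_cat C) X Y"
  then show "Comp (arrow_cat C) f (Id (arrow_cat C) X) = f"
    by (auto simp: Hom_def[of "arrow_cat C"] arrow_cat_simps Comp_Id intro!: square.equality)
  from f show "Comp (arrow_cat C) (Id (arrow_cat C) Y) f = f"
    by (auto simp: Hom_def[of "arrow_cat C"] arrow_cat_simps Id_Comp intro!: square.equality)
next
  fix f X Y g Z h V
  assume "f \<in> Hom (arrow_cat C) X Y" "g \<in> Hom (arrow_cat C) Y Z" "h \<in> Hom (arrow_cat C) Z V"
  then show "Comp (arrow_cat C) h (Comp (arrow_cat C) g f) = Comp (arrow_cat C) (Comp (arrow_cat C) h g) f"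
    by (auto simp: Hom_def[of "arrow_cat C"] arrow_cat_simps intro!: Comp_assoc)
qed (simp_all add: arrow_cat_simps)

text \<open>Once the action \<open>T\<close> on objects is fixed, the source and target of the image
  of a square are forced, and only its two edges \<open>a\<close> and \<open>b\<close> remain to be
  given. All conditions become equations in \<open>C\<close>.\<close>

lemma is_functor_arrow_catI:
  assumes ob: "\<And>u. u \<in> Arr C \<Longrightarrow> T u \<in> Arr C"
    and hom: "\<And>\<sigma>. \<sigma> \<in> Arr (arrow_cat C) \<Longrightarrow>
      a \<sigma> \<in> Hom C (Dom C (T (sq_src \<sigma>))) (Dom C (T (sq_tgt \<sigma>))) \<and>
      b \<sigma> \<in> Hom C (Cod C (T (sq_src \<sigma>))) (Cod C (T (sq_tgt \<sigma>))) \<and>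
      Comp C (T (sq_tgt \<sigma>)) (a \<sigma>) = Comp C (b \<sigma>) (T (sq_src \<sigma>))"
    and ident: "\<And>u. u \<in> Arr C \<Longrightarrow> a (Id (arrow_cat C) u) = Id C (Dom C (T u)) \<and>
      b (Id (arrow_cat C) u) = Id C (Cod C (T u))"
    and comp: "\<And>\<sigma> \<tau>. \<sigma> \<in> Arr (arrow_cat C) \<Longrightarrow> \<tau> \<in> Arr (arrow_cat C) \<Longrightarrow> sq_tgt \<sigma> = sq_src \<tau> \<Longrightarrow>
      a (Comp (arrow_cat C) \<tau> \<sigma>) = Comp C (a \<tau>) (a \<sigma>) \<and>
      b (Comp (arrow_cat C) \<tau> \<sigma>) = Comp C (b \<tau>) (b \<sigma>)"
  shows "is_functor (arrow_cat C) (arrow_cat C) \<lparr>on_ob = T, on_arr = \<lambda>\<sigma>.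
    \<lparr>sq_src = T (sq_src \<sigma>), sq_tgt = T (sq_tgt \<sigma>), sq_dom = a \<sigma>, sq_cod = b \<sigma>\<rparr>\<rparr>"
  unfolding is_functor_def func.simps
proof (intro conjI ballI impI)
  fix \<sigma> assume \<sigma>: "\<sigma> \<in> Arr (arrow_cat C)"
  then have "sq_src \<sigma> \<in> Arr C" "sq_tgt \<sigma> \<in> Arr C" by (simp_all add: arrow_cat_simps)
  with hom[OF \<sigma>] ob show "\<lparr>sq_src = T (sq_src \<sigma>), sq_tgt = T (sq_tgt \<sigma>), sq_dom = a \<sigma>, sq_cod = b \<sigma>\<rparr>
      \<in> Hom (arrow_cat C) (T (Dom (arrow_cat C) \<sigma>)) (T (Cod (arrow_cat C) \<sigma>))"
    by (simp only: Hom_def[of "arrow_cat C"] arrow_cat_simps square.simps mem_Collect_eq)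
  fix \<tau> assume \<tau>: "\<tau> \<in> Arr (arrow_cat C)" "Cod (arrow_cat C) \<sigma> = Dom (arrow_cat C) \<tau>"
  then have "sq_tgt \<sigma> = sq_src \<tau>" by (simp add: arrow_cat_simps)
  note comp[OF \<sigma> \<tau>(1) this]
  moreover have "sq_src (Comp (arrow_cat C) \<tau> \<sigma>) = sq_src \<sigma>" "sq_tgt (Comp (arrow_cat C) \<tau> \<sigma>) = sq_tgt \<tau>"
    by (simp_all add: arrow_cat_simps)
  ultimately show "\<lparr>sq_src = T (sq_src (Comp (arrow_cat C) \<tau> \<sigma>)), sq_tgt = T (sq_tgt (Comp (arrow_cat C) \<tau> \<sigma>)),
      sq_dom = a (Comp (arrow_cat C) \<tau> \<sigma>), sq_cod = b (Comp (arrow_cat C) \<tau> \<sigma>)\<rparr> =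
    Comp (arrow_cat C) \<lparr>sq_src = T (sq_src \<tau>), sq_tgt = T (sq_tgt \<tau>), sq_dom = a \<tau>, sq_cod = b \<tau>\<rparr>
      \<lparr>sq_src = T (sq_src \<sigma>), sq_tgt = T (sq_tgt \<sigma>), sq_dom = a \<sigma>, sq_cod = b \<sigma>\<rparr>"
    by (simp only: arrow_cat_simps(5)[of C "\<lparr>sq_src = T (sq_src \<tau>), sq_tgt = T (sq_tgt \<tau>), sq_dom = a \<tau>, sq_cod = b \<tau>\<rparr>"] square.simps)
next
  fix u assume "u \<in> Ob (arrow_cat C)"
  then have u: "u \<in> Arr C" by (simp add: arrow_cat_simps)
  show "T u \<in> Ob (arrow_cat C)" using ob[OF u] by (simp add: arrow_cat_simps)
  have "sq_src (Id (arrow_cat C) u) = u" "sq_tgt (Id (arrow_cat C) u) = u"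
    by (simp_all add: arrow_cat_simps)
  with ident[OF u] show "\<lparr>sq_src = T (sq_src (Id (arrow_cat C) u)), sq_tgt = T (sq_tgt (Id (arrow_cat C) u)),
      sq_dom = a (Id (arrow_cat C) u), sq_cod = b (Id (arrow_cat C) u)\<rparr> = Id (arrow_cat C) (T u)"
    by (simp only: arrow_cat_simps(4)[of C "T u"])
qed (rule category_arrow_cat)+

text \<open>The three functors share a single new datum, the map \<open>mid\<close> between the
  middle objects; the outer edges are those of the given square. Functoriality of all three
  therefore reduces to functoriality of \<open>mid\<close>.\<close>

lemma functorial_factorizationI:
  assumes fac: "\<And>u. u \<in> Arr C \<Longrightarrow> factors C u (p u) (i u) (s u) \<and> p u \<in> F \<and> s u \<in> A"
    and mid: "\<And>\<sigma>. \<sigma> \<in> Arr (arrow_cat C) \<Longrightarrow>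
      mid \<sigma> \<in> Hom C (Cod C (i (sq_src \<sigma>))) (Cod C (i (sq_tgt \<sigma>))) \<and>
      Comp C (p (sq_tgt \<sigma>)) (mid \<sigma>) = Comp C (sq_cod \<sigma>) (p (sq_src \<sigma>)) \<and>
      Comp C (s (sq_tgt \<sigma>)) (mid \<sigma>) = Comp C (sq_dom \<sigma>) (s (sq_src \<sigma>)) \<and>
      Comp C (i (sq_tgt \<sigma>)) (sq_dom \<sigma>) = Comp C (mid \<sigma>) (i (sq_src \<sigma>))"
    and mid_Id: "\<And>u. u \<in> Arr C \<Longrightarrow> mid (Id (arrow_cat C) u) = Id C (Cod C (i u))"
    and mid_Comp: "\<And>\<sigma> \<tau>. \<sigma> \<in> Arr (arrow_cat C) \<Longrightarrow> \<tau> \<in> Arr (arrow_cat C) \<Longrightarrow> sq_tgt \<sigma> = sq_src \<tau> \<Longrightarrow>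
      mid (Comp (arrow_cat C) \<tau> \<sigma>) = Comp C (mid \<tau>) (mid \<sigma>)"
  shows "functorial_factorization C F A"
proof -
  have ends: "i u \<in> Arr C" "p u \<in> Arr C" "s u \<in> Arr C" "Dom C (i u) = Dom C u" "Dom C (p u) = Cod C (i u)"
      "Cod C (p u) = Cod C u" "Dom C (s u) = Cod C (i u)" "Cod C (s u) = Dom C u" if "u \<in> Arr C" for u
    using fac[OF that] by (auto simp: factors_def Hom_def)
  let ?p = "\<lparr>on_ob = p, on_arr = \<lambda>\<sigma>. \<lparr>sq_src = p (sq_src \<sigma>), sq_tgt = p (sq_tgt \<sigma>), sq_dom = mid \<sigma>, sq_cod = sq_cod \<sigma>\<rparr>\<rparr>"
  let ?i = "\<lparr>on_ob = i, on_arr = \<lambda>\<sigma>. \<lparr>sq_src = i (sq_src \<sigma>), sq_tgt = i (sq_tgt \<sigma>), sq_dom = sq_dom \<sigma>, sq_cod = mid \<sigma>\<rparr>\<rparr>"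
  let ?s = "\<lparr>on_ob = s, on_arr = \<lambda>\<sigma>. \<lparr>sq_src = s (sq_src \<sigma>), sq_tgt = s (sq_tgt \<sigma>), sq_dom = mid \<sigma>, sq_cod = sq_dom \<sigma>\<rparr>\<rparr>"
  have Arrs: "sq_src \<sigma> \<in> Arr C" "sq_tgt \<sigma> \<in> Arr C"
    "sq_dom \<sigma> \<in> Hom C (Dom C (sq_src \<sigma>)) (Dom C (sq_tgt \<sigma>))"
    "sq_cod \<sigma> \<in> Hom C (Cod C (sq_src \<sigma>)) (Cod C (sq_tgt \<sigma>))"
    if "\<sigma> \<in> Arr (arrow_cat C)" for \<sigma>
    using that by (simp_all add: arrow_cat_simps)
  have sqs: "sq_src (Id (arrow_cat C) u) = u" "sq_tgt (Id (arrow_cat C) u) = u"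
    "sq_dom (Id (arrow_cat C) u) = Id C (Dom C u)" "sq_cod (Id (arrow_cat C) u) = Id C (Cod C u)"
    "sq_dom (Comp (arrow_cat C) \<tau> \<sigma>) = Comp C (sq_dom \<tau>) (sq_dom \<sigma>)"
    "sq_cod (Comp (arrow_cat C) \<tau> \<sigma>) = Comp C (sq_cod \<tau>) (sq_cod \<sigma>)" for u \<sigma> \<tau>
    by (simp_all add: arrow_cat_simps)
  have "is_functor (arrow_cat C) (arrow_cat C) ?p"
    by (rule is_functor_arrow_catI) (simp_all only: ends Arrs mid mid_Id mid_Comp sqs simp_thms)
  moreover have "is_functor (arrow_cat C) (arrow_cat C) ?i"
    by (rule is_functor_arrow_catI) (simp_all only: ends Arrs mid mid_Id mid_Comp sqs simp_thms)
  moreover have "is_functor (arrow_cat C) (arrow_cat C) ?s"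
    by (rule is_functor_arrow_catI) (simp_all only: ends Arrs mid mid_Id mid_Comp sqs simp_thms)
  ultimately show ?thesis
    unfolding functorial_factorization_def
    using fac by (intro exI[of _ ?p] exI[of _ ?i] exI[of _ ?s]) simp
qed

text \<open>Two pullbacks of the same pair are isomorphic over both legs; the leg \<open>p'\<close>
  is the one recorded because closure of a class under pullback concerns that leg.\<close>

lemma pullback_unique:
  assumes "is_pullback C p g p' g'" "is_pullback C p g p'' g''"
  shows "\<exists>k \<in> isos C. Cod C k = Dom C p' \<and> Comp C p' k = p''"
proof -
  have H: "p' \<in> Hom C (Dom C p') (Dom C g)" "g' \<in> Hom C (Dom C p') (Dom C p)"
    "p'' \<in> Hom C (Dom C p'') (Dom C g)" "g'' \<in> Hom C (Dom C p'') (Dom C p)"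
    "Comp C p g' = Comp C g p'" "Comp C p g'' = Comp C g p''"
    using assms by (auto simp: is_pullback_def)
  have U': "\<exists>!h. h \<in> Hom C T (Dom C p') \<and> Comp C p' h = a \<and> Comp C g' h = b"
    if "a \<in> Hom C T (Dom C g)" "b \<in> Hom C T (Dom C p)" "Comp C p b = Comp C g a" for T a b
    using assms(1) that unfolding is_pullback_def by blast
  have U'': "\<exists>!h. h \<in> Hom C T (Dom C p'') \<and> Comp C p'' h = a \<and> Comp C g'' h = b"
    if "a \<in> Hom C T (Dom C g)" "b \<in> Hom C T (Dom C p)" "Comp C p b = Comp C g a" for T a b
    using assms(2) that unfolding is_pullback_def by blast
  obtain k where k: "k \<in> Hom C (Dom C p'') (Dom C p')" "Comp C p' k = p''" "Comp C g' k = g''"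
    using U'[OF H(3,4,6)] by blast
  obtain l where l: "l \<in> Hom C (Dom C p') (Dom C p'')" "Comp C p'' l = p'" "Comp C g'' l = g'"
    using U''[OF H(1,2,5)] by blast
  have kl: "Comp C k l \<in> Hom C (Dom C p') (Dom C p')" "Comp C l k \<in> Hom C (Dom C p'') (Dom C p'')"
    using Comp_Hom k(1) l(1) by blast+
  have "Comp C p' (Comp C k l) = p'" "Comp C g' (Comp C k l) = g'"
    using Comp_assoc[OF l(1) k(1) H(1)] Comp_assoc[OF l(1) k(1) H(2)] k l by auto
  moreover have "Comp C p'' (Comp C l k) = p''" "Comp C g'' (Comp C l k) = g''"
    using Comp_assoc[OF k(1) l(1) H(3)] Comp_assoc[OF k(1) l(1) H(4)] k l by auto
  moreover have "Id C (Dom C p') \<in> Hom C (Dom C p') (Dom C p')" "Id C (Dom C p'') \<in> Hom C (Dom C p'') (Dom C p'')"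
    using Id_Hom HomD(4)[OF H(1)] HomD(4)[OF H(3)] by blast+
  moreover have "Comp C p' (Id C (Dom C p')) = p'" "Comp C g' (Id C (Dom C p')) = g'"
    "Comp C p'' (Id C (Dom C p'')) = p''" "Comp C g'' (Id C (Dom C p'')) = g''"
    using H Comp_Id by blast+
  \<comment> \<open>Each round trip and the identity solve the same universal problem.\<close>
  ultimately have "Comp C k l = Id C (Dom C p')" "Comp C l k = Id C (Dom C p'')"
    using U'[OF H(1,2,5)] U''[OF H(3,4,6)] kl by blast+
  then have "k \<in> isos C"
    using k(1) l(1) HomD[OF k(1)] by (auto simp: isos_def intro!: bexI[of _ l])
  then show ?thesis using k HomD[OF k(1)] by blast
qed

text \<open>One pullback in \<open>A\<close> for each pair suffices: any other one differs from it
  by an isomorphism, which \<open>A\<close> absorbs by composition.\<close>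

lemma pullback_closedI:
  assumes "isos C \<subseteq> A"
    and comp: "\<And>f g. f \<in> A \<Longrightarrow> g \<in> A \<Longrightarrow> Cod C f = Dom C g \<Longrightarrow> Comp C g f \<in> A"
    and ex: "\<And>p g. p \<in> A \<Longrightarrow> g \<in> Arr C \<Longrightarrow> Cod C p = Cod C g \<Longrightarrow> \<exists>p' g'. is_pullback C p g p' g' \<and> p' \<in> A"
  shows "pullback_closed C A"
  unfolding pullback_closed_def
proof (intro ballI impI conjI allI)
  fix p g assume pg: "p \<in> A" "g \<in> Arr C" "Cod C p = Cod C g"
  from ex[OF this] obtain p' g' where *: "is_pullback C p g p' g'" "p' \<in> A" by blast
  then show "\<exists>p' g'. is_pullback C p g p' g'" by blast
  fix p'' g'' assume "is_pullback C p g p'' g''"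
  from pullback_unique[OF *(1) this] obtain k where
    "k \<in> isos C" "Cod C k = Dom C p'" "Comp C p' k = p''" by blast
  then show "p'' \<in> A" using comp[of k p'] assms(1) *(2) by auto
qed

text \<open>Induction on the number of factors: the empty product is the final object, and one more
  factor is added by a binary product of \<open>Q\<close> with \<open>X n\<close>, through which the
  old projections are composed.\<close>

lemma has_finite_productsI:
  assumes e: "final_object C e"
    and bin: "\<And>X Y. X \<in> Ob C \<Longrightarrow> Y \<in> Ob C \<Longrightarrow> \<exists>P a b. a \<in> Hom C P X \<and> b \<in> Hom C P Y \<and>
      (\<forall>Z f g. f \<in> Hom C Z X \<longrightarrow> g \<in> Hom C Z Y \<longrightarrow> (\<exists>!h. h \<in> Hom C Z P \<and> Comp C a h = f \<and> Comp C b h = g))"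
  shows "has_finite_products C"
  unfolding has_finite_products_def
proof (intro allI impI)
  fix n :: nat and X assume "\<forall>i<n. X i \<in> Ob C"
  then show "\<exists>P \<pi>. is_product C n X P \<pi>"
  proof (induction n)
    case 0
    show ?case using e by (auto simp: is_product_def final_object_def)
  next
    case (Suc n)
    then obtain Q \<rho> where Q: "is_product C n X Q \<rho>" by auto
    then have Qo: "Q \<in> Ob C" "\<And>i. i < n \<Longrightarrow> \<rho> i \<in> Hom C Q (X i)" by (auto simp: is_product_def)
    have QU: "\<exists>!h. h \<in> Hom C Z Q \<and> (\<forall>i<n. Comp C (\<rho> i) h = g i)"
      if "Z \<in> Ob C" "\<And>i. i < n \<Longrightarrow> g i \<in> Hom C Z (X i)" for Z g
      using Q that unfolding is_product_def by blast
    have "X n \<in> Ob C" using Suc.prems by simp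
    from bin[OF Qo(1) this] obtain P a b where P: "a \<in> Hom C P Q" "b \<in> Hom C P (X n)" and
      PU: "\<And>Z f g. f \<in> Hom C Z Q \<Longrightarrow> g \<in> Hom C Z (X n) \<Longrightarrow>
        \<exists>!h. h \<in> Hom C Z P \<and> Comp C a h = f \<and> Comp C b h = g"
      by (elim exE conjE) blast
    define \<pi> where "\<pi> i = (if i < n then Comp C (\<rho> i) a else b)" for i
    have \<pi>: "\<pi> i \<in> Hom C P (X i)" if "i < Suc n" for i
    proof (cases "i < n")
      case True
      then show ?thesis using Comp_Hom[OF P(1) Qo(2)] by (simp add: \<pi>_def)
    next
      case False
      then have "i = n" using that by simp
      then show ?thesis using P(2) by (simp add: \<pi>_def)
    qed
    have "is_product C (Suc n) X P \<pi>"
      unfolding is_product_def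
    proof (intro conjI allI impI ballI)
      show "P \<in> Ob C" using HomD(4)[OF P(1)] .
      show "\<pi> i \<in> Hom C P (X i)" if "i < Suc n" for i using \<pi>[OF that] .
      fix Z g assume Z: "Z \<in> Ob C" and g: "\<forall>i<Suc n. g i \<in> Hom C Z (X i)"
      obtain f where f: "f \<in> Hom C Z Q" "\<And>i. i < n \<Longrightarrow> Comp C (\<rho> i) f = g i"
        using QU[OF Z, of g] g by auto
      obtain h where h: "h \<in> Hom C Z P" "Comp C a h = f" "Comp C b h = g n"
        using PU[OF f(1), of "g n"] g by auto
      have comp: "Comp C (\<pi> i) k = (if i < n then Comp C (\<rho> i) (Comp C a k) else Comp C b k)"
        if "k \<in> Hom C Z P" "i < Suc n" for i k
        using Comp_assoc[OF that(1) P(1) Qo(2)] by (simp add: \<pi>_def)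
      show "\<exists>!h. h \<in> Hom C Z P \<and> (\<forall>i<Suc n. Comp C (\<pi> i) h = g i)"
      proof (rule ex1I)
        show "h \<in> Hom C Z P \<and> (\<forall>i<Suc n. Comp C (\<pi> i) h = g i)"
          using h f by (auto simp: comp less_Suc_eq)
        fix k assume k: "k \<in> Hom C Z P \<and> (\<forall>i<Suc n. Comp C (\<pi> i) k = g i)"
        have ak: "Comp C a k \<in> Hom C Z Q" using Comp_Hom k P(1) by blast
        have "Comp C (\<rho> i) (Comp C a k) = g i" if "i < n" for i
          using comp[of k i] k that by simp
        then have "Comp C a k = f"
          using QU[OF Z, of g] g f ak by (metis less_SucI)
        moreover have "Comp C b k = g n"
          using comp[of k n] k by simp
        ultimately show "k = h"
          using PU[OF f(1), of "g n"] g h k by blast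
      qed
    qed
    then show ?case by blast
  qed
qed

end

section \<open>From almost Brown categories to partial Brown categories of fibrant objects\<close>

text \<open>The conditions on subcategories and pullbacks are inherited directly. The point is that
  the factorization functors restrict to arrows and squares inside \<open>W\<close>, and each
  membership in \<open>W\<close> follows from two-out-of-three.\<close>

lemma (in almost_brown_category_functorial) partial_brown_category:
  "partial_brown_category C W (W \<inter> F)"
proof -
  have W3: "f \<in> Arr C \<Longrightarrow> g \<in> Arr C \<Longrightarrow> Cod C f = Dom C g \<Longrightarrow> f \<in> W \<Longrightarrow> g \<in> W \<Longrightarrow> Comp C g f \<in> W"
    "f \<in> Arr C \<Longrightarrow> g \<in> Arr C \<Longrightarrow> Cod C f = Dom C g \<Longrightarrow> f \<in> W \<Longrightarrow> Comp C g f \<in> W \<Longrightarrow> g \<in> W"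
    "f \<in> Arr C \<Longrightarrow> g \<in> Arr C \<Longrightarrow> Cod C f = Dom C g \<Longrightarrow> g \<in> W \<Longrightarrow> Comp C g f \<in> W \<Longrightarrow> f \<in> W" for f g
    using W_two_out_of_three unfolding two_out_of_three_def by blast+
  have W: "subcategory C W"
    unfolding subcategory_def using W_Arr W_isos Id_isos W3(1) by blast
  have A: "subcategory C (W \<inter> F)"
    unfolding subcategory_def using W_Arr W_isos F_isos Id_isos W3(1) F_Comp by blast
  let ?D = "wide_subcat C W"
  interpret D: category ?D by (rule category_wide_subcat[OF W])
  have s: "Ob ?D = Ob C" "Arr ?D = W" "Dom ?D = Dom C" "Cod ?D = Cod C" "Id ?D = Id C" "Comp ?D = Comp C"
    by (auto simp: wide_subcat_def)
  have Hom: "Hom ?D X Y = Hom C X Y \<inter> W" for X Y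
    using W_Arr by (auto simp: Hom_def s)
  obtain p i s where fnc: "is_functor (arrow_cat C) (arrow_cat C) p"
     "is_functor (arrow_cat C) (arrow_cat C) i"
     "is_functor (arrow_cat C) (arrow_cat C) s"
    and fac: "\<And>u. u \<in> Arr C \<Longrightarrow> factors C u (on_ob p u) (on_ob i u) (on_ob s u) \<and>
        on_ob p u \<in> F \<and> on_ob s u \<in> W \<inter> F"
    and nat: "\<And>\<sigma>. \<sigma> \<in> Arr (arrow_cat C) \<Longrightarrow>
        sq_dom (on_arr i \<sigma>) = sq_dom \<sigma> \<and>
        sq_cod (on_arr p \<sigma>) = sq_cod \<sigma> \<and>
        sq_cod (on_arr s \<sigma>) = sq_dom \<sigma> \<and>
        sq_dom (on_arr p \<sigma>) = sq_cod (on_arr i \<sigma>) \<and>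
        sq_dom (on_arr s \<sigma>) = sq_cod (on_arr i \<sigma>)"
    using functorial unfolding functorial_factorization_def by blast
  \<comment> \<open>From \<open>s i = 1\<close>, with \<open>s\<close> and the identity in
    \<open>W\<close>, follows \<open>i \<in> W\<close>; then \<open>p i = u\<close> gives
    \<open>p \<in> W\<close>.\<close>
  have obW: "on_ob p u \<in> W" "on_ob i u \<in> W" "on_ob s u \<in> W" if u: "u \<in> W" for u
  proof -
    have uA: "u \<in> Arr C" using u W_Arr by blast
    note f = fac[OF uA, unfolded factors_def]
    have h: "on_ob i u \<in> Arr C" "on_ob p u \<in> Arr C" "on_ob s u \<in> Arr C"
      "Cod C (on_ob i u) = Dom C (on_ob p u)" "Cod C (on_ob i u) = Dom C (on_ob s u)"
      using f by (auto simp: Hom_def)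
    show sW: "on_ob s u \<in> W" using f by blast
    have "Id C (Dom C u) \<in> W" using Id_isos Dom_Ob uA W_isos by blast
    then show iW: "on_ob i u \<in> W" using W3(3)[OF h(1,3,5) sW] f by simp
    show "on_ob p u \<in> W" using W3(2)[OF h(1,2,4) iW] f u by simp
  qed
  have D_arr: "\<sigma> \<in> Arr (arrow_cat ?D) \<longleftrightarrow> \<sigma> \<in> Arr (arrow_cat C) \<and>
      sq_src \<sigma> \<in> W \<and> sq_tgt \<sigma> \<in> W \<and> sq_dom \<sigma> \<in> W \<and> sq_cod \<sigma> \<in> W" for \<sigma>
    using W_Arr by (auto simp: arrow_cat_simps s Hom)
  have arr: "on_arr T \<sigma> \<in> Arr (arrow_cat C) \<and> sq_src (on_arr T \<sigma>) = on_ob T (sq_src \<sigma>) \<and>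
      sq_tgt (on_arr T \<sigma>) = on_ob T (sq_tgt \<sigma>)"
    if "is_functor (arrow_cat C) (arrow_cat C) T" "\<sigma> \<in> Arr (arrow_cat C)" for T \<sigma>
  proof -
    have "on_arr T \<sigma> \<in> Hom (arrow_cat C) (on_ob T (Dom (arrow_cat C) \<sigma>)) (on_ob T (Cod (arrow_cat C) \<sigma>))"
      using that unfolding is_functor_def by blast
    then show ?thesis by (simp only: Hom_def[of "arrow_cat C"] mem_Collect_eq arrow_cat_simps(2,3) simp_thms)
  qed
  \<comment> \<open>In the square of \<open>s\<close>, the middle map followed by \<open>?v\<close>
    equals \<open>?u\<close> followed by \<open>sq_dom \<sigma>\<close>, a composite in
    \<open>W\<close>; two-out-of-three then cancels \<open>?v\<close>.\<close>
  have midW: "sq_cod (on_arr i \<sigma>) \<in> W" if \<sigma>: "\<sigma> \<in> Arr (arrow_cat ?D)" for \<sigma>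
  proof -
    have \<sigma>C: "\<sigma> \<in> Arr (arrow_cat C)" and \<sigma>W: "sq_src \<sigma> \<in> W" "sq_tgt \<sigma> \<in> W" "sq_dom \<sigma> \<in> W"
      using \<sigma> D_arr by auto
    let ?m = "sq_cod (on_arr i \<sigma>)" and ?u = "on_ob s (sq_src \<sigma>)" and ?v = "on_ob s (sq_tgt \<sigma>)"
    have n: "sq_dom (on_arr s \<sigma>) = ?m" "sq_cod (on_arr s \<sigma>) = sq_dom \<sigma>" using nat[OF \<sigma>C] by auto
    have m: "?m \<in> Hom C (Dom C ?u) (Dom C ?v)" and d: "sq_dom \<sigma> \<in> Hom C (Cod C ?u) (Cod C ?v)"
      and sq: "Comp C ?v ?m = Comp C (sq_dom \<sigma>) ?u"
      using arr[OF fnc(3) \<sigma>C] n by (auto simp: arrow_cat_simps)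
    have uv: "?u \<in> W" "?v \<in> W" using obW \<sigma>W by auto
    have "Comp C (sq_dom \<sigma>) ?u \<in> W"
      using W3(1)[of ?u "sq_dom \<sigma>"] uv \<sigma>W W_Arr HomD(2)[OF d] by auto
    then show ?thesis
      using W3(3)[of ?m ?v] uv W_Arr HomD(1,3)[OF m] sq by auto
  qed
  \<comment> \<open>The wide subcategory shares identities and composition with \<open>C\<close>, so
    only membership in \<open>W\<close> has to be checked.\<close>
  have restrict: "is_functor (arrow_cat ?D) (arrow_cat ?D) T"
    if T: "is_functor (arrow_cat C) (arrow_cat C) T" and ob: "\<And>u. u \<in> W \<Longrightarrow> on_ob T u \<in> W"
      and sq: "\<And>\<sigma>. \<sigma> \<in> Arr (arrow_cat ?D) \<Longrightarrow> sq_dom (on_arr T \<sigma>) \<in> W \<and> sq_cod (on_arr T \<sigma>) \<in> W" for T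
  proof -
    have o: "Ob (arrow_cat ?D) = W" "Dom (arrow_cat ?D) = sq_src" "Cod (arrow_cat ?D) = sq_tgt"
      "Id (arrow_cat ?D) = Id (arrow_cat C)" "Comp (arrow_cat ?D) = Comp (arrow_cat C)"
      by (auto simp: arrow_cat_simps s fun_eq_iff)
    have h: "on_arr T \<sigma> \<in> Hom (arrow_cat ?D) (on_ob T (sq_src \<sigma>)) (on_ob T (sq_tgt \<sigma>))"
      if "\<sigma> \<in> Arr (arrow_cat ?D)" for \<sigma>
      using arr[OF T, of \<sigma>] that ob sq D_arr by (auto simp: Hom_def[of "arrow_cat ?D"] o)
    have "on_arr T (Id (arrow_cat C) X) = Id (arrow_cat C) (on_ob T X)" if "X \<in> W" for X
      using T that W_Arr by (auto simp: is_functor_def arrow_cat_simps(1))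
    moreover have "on_arr T (Comp (arrow_cat C) g f) = Comp (arrow_cat C) (on_arr T g) (on_arr T f)"
      if "f \<in> Arr (arrow_cat ?D)" "g \<in> Arr (arrow_cat ?D)" "sq_tgt f = sq_src g" for f g
      using T that unfolding D_arr by (auto simp: is_functor_def arrow_cat_simps(2,3))
    ultimately show ?thesis
      unfolding is_functor_def o using h ob D.category_arrow_cat by blast
  qed
  have "functorial_factorization ?D (W \<inter> F) (W \<inter> F)"
    unfolding functorial_factorization_def
  proof (intro exI conjI ballI)
    show "is_functor (arrow_cat ?D) (arrow_cat ?D) p"
      by (rule restrict[OF fnc(1) obW(1)]) (use nat midW D_arr in auto)
    show "is_functor (arrow_cat ?D) (arrow_cat ?D) i"
      by (rule restrict[OF fnc(2) obW(2)]) (use nat midW D_arr in auto)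
    show "is_functor (arrow_cat ?D) (arrow_cat ?D) s"
      by (rule restrict[OF fnc(3) obW(3)]) (use nat midW D_arr in auto)
    fix u assume "u \<in> Arr ?D"
    then have u: "u \<in> W" by (simp add: s)
    have u': "u \<in> Arr C" using u W_Arr by blast
    show "factors ?D u (on_ob p u) (on_ob i u) (on_ob s u)"
      using fac[OF u'] obW[OF u] by (simp add: factors_def s Hom)
    show "on_ob p u \<in> W \<inter> F" "on_ob s u \<in> W \<inter> F" using fac[OF u'] obW[OF u] by auto
  qed (use nat D_arr in auto)
  then show ?thesis
    by unfold_locales
      (use W A W_isos F_isos W_two_out_of_three acyclic_pullback in auto)
qed

section \<open>Homology and characteristic maps\<close>

text \<open>The differential that ends in bidegree \<open>(p, q)\<close> starts in
  \<open>(p + m, q - 1 + m)\<close>. The last two facts restate the axioms from there with the index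
  arithmetic carried out, since indices that are equal but not identical block rewriting.\<close>

lemma bigraded_complexD:
  assumes "bigraded_complex R m A"
  shows "module R (cmod A p q)"
    and "cdiff A p q \<in> mod_hom R (cmod A p q) (cmod A (p - int m) (q + 1 - int m))"
    and "cdiff A (p + int m) (q - 1 + int m) \<in>
      mod_hom R (cmod A (p + int m) (q - 1 + int m)) (cmod A p q)"
    and "w \<in> carrier (cmod A (p + int m) (q - 1 + int m)) \<Longrightarrow>
      cdiff A p q (cdiff A (p + int m) (q - 1 + int m) w) = \<zero>\<^bsub>cmod A (p - int m) (q + 1 - int m)\<^esub>"
proof -
  have e': "p + int m - int m = p" "q - 1 + int m + 1 - int m = q" by simp_all
  have e'': "p + int m - 2 * int m = p - int m" "q - 1 + int m + 2 - 2 * int m = q + 1 - int m"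
    by simp_all
  note a = assms[unfolded bigraded_complex_def, rule_format]
  show "module R (cmod A p q)"
    and "cdiff A p q \<in> mod_hom R (cmod A p q) (cmod A (p - int m) (q + 1 - int m))"
    using a[of p q] by blast+
  show "cdiff A (p + int m) (q - 1 + int m) \<in>
      mod_hom R (cmod A (p + int m) (q - 1 + int m)) (cmod A p q)"
    using a[of "p + int m" "q - 1 + int m"] unfolding e' by blast
  show "cdiff A p q (cdiff A (p + int m) (q - 1 + int m) w) = \<zero>\<^bsub>cmod A (p - int m) (q + 1 - int m)\<^esub>"
    if "w \<in> carrier (cmod A (p + int m) (q - 1 + int m))"
    using a[of "p + int m" "q - 1 + int m"] that unfolding e' e'' by blast
qed

text \<open>A coset depends on the addition alone. This identifies the cosets in
  \<open>homology\<close>, taken inside the cycles, with those in \<open>homology_map\<close>, taken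
  in the full module.\<close>

lemma a_r_coset_carrier_update [simp]:
  "B +>\<^bsub>(M :: ('a, 'm) module)\<lparr>carrier := Z\<rparr>\<^esub> x = B +>\<^bsub>M\<^esub> x"
  by (simp add: a_r_coset_def')

abbreviation cycle_mod :: "nat \<Rightarrow> ('a, 'm) bicomplex \<Rightarrow> int \<Rightarrow> int \<Rightarrow> ('a, 'm) module" where
  "cycle_mod m A p q \<equiv> (cmod A p q)\<lparr>carrier := cycles m A p q\<rparr>"

text \<open>Boundaries are cycles because the differential squares to zero; the closure properties
  are linearity of the two differentials that leave and enter \<open>(p, q)\<close>.\<close>

lemma homology_quotient:
  assumes A: "bigraded_complex R m A"
  shows "quotient_module R (cycle_mod m A p q) (boundaries m A p q)"
proof -
  interpret M: module R "cmod A p q" by (rule bigraded_complexD(1)[OF A])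
  let ?N = "cmod A (p - int m) (q + 1 - int m)"
  interpret N: module R ?N by (rule bigraded_complexD(1)[OF A])
  let ?P = "cmod A (p + int m) (q - 1 + int m)"
  interpret P: module R ?P by (rule bigraded_complexD(1)[OF A])
  let ?d = "cdiff A p q" and ?e = "cdiff A (p + int m) (q - 1 + int m)"
  have d: "?d \<in> mod_hom R (cmod A p q) ?N" by (rule bigraded_complexD(2)[OF A])
  have e: "?e \<in> mod_hom R ?P (cmod A p q)" by (rule bigraded_complexD(3)[OF A])
  note dD = mod_homD[OF d] and eD = mod_homD[OF e]
  have d0: "?d \<zero>\<^bsub>cmod A p q\<^esub> = \<zero>\<^bsub>?N\<^esub>"
    by (rule mod_hom_zero[OF M.module_axioms N.module_axioms d])
  have e0: "?e \<zero>\<^bsub>?P\<^esub> = \<zero>\<^bsub>cmod A p q\<^esub>"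
    by (rule mod_hom_zero[OF P.module_axioms M.module_axioms e])
  show ?thesis
  proof (rule quotient_module.intro)
    show "module R (cycle_mod m A p q)"
    proof (rule moduleI')
      fix x assume x: "x \<in> carrier (cycle_mod m A p q)"
      have n: "\<ominus>\<^bsub>R\<^esub> \<one>\<^bsub>R\<^esub> \<in> carrier R" by simp
      have x': "x \<in> carrier (cmod A p q)" "?d x = \<zero>\<^bsub>?N\<^esub>"
        using x by (auto simp: cycles_def)
      let ?y = "(\<ominus>\<^bsub>R\<^esub> \<one>\<^bsub>R\<^esub>) \<odot>\<^bsub>cmod A p q\<^esub> x"
      have "?y \<in> cycles m A p q"
        using x' n by (auto simp: cycles_def dD)
      moreover have "?y \<oplus>\<^bsub>cmod A p q\<^esub> x = \<zero>\<^bsub>cmod A p q\<^esub>"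
        using x' n by (simp add: M.smult_l_minus M.M.l_neg)
      ultimately show "\<exists>y \<in> carrier (cycle_mod m A p q). y \<oplus>\<^bsub>cycle_mod m A p q\<^esub> x = \<zero>\<^bsub>cycle_mod m A p q\<^esub>"
        by auto
    qed (auto simp: cycles_def dD d0 M.M.a_ac M.smult_l_distr M.smult_r_distr
        M.smult_assoc1 M.R.cring_axioms intro: M.is_cring)
    show "quotient_module_axioms R (cycle_mod m A p q) (boundaries m A p q)"
    proof
      show "boundaries m A p q \<subseteq> carrier (cycle_mod m A p q)"
        using eD(1) bigraded_complexD(4)[OF A] by (auto simp: boundaries_def cycles_def)
      show "\<zero>\<^bsub>cycle_mod m A p q\<^esub> \<in> boundaries m A p q"
        using e0 by (force simp: boundaries_def)
      show "x \<oplus>\<^bsub>cycle_mod m A p q\<^esub> y \<in> boundaries m A p q"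
        if "x \<in> boundaries m A p q" "y \<in> boundaries m A p q" for x y
        using that by (force simp: boundaries_def eD(2)[symmetric])
      show "a \<odot>\<^bsub>cycle_mod m A p q\<^esub> x \<in> boundaries m A p q"
        if "a \<in> carrier R" "x \<in> boundaries m A p q" for a x
        using that by (force simp: boundaries_def eD(3)[symmetric])
    qed
  qed
qed

lemma carrier_homology:
  assumes "bigraded_complex R m A"
  shows "carrier (homology m A p q) = (\<lambda>x. boundaries m A p q +>\<^bsub>cmod A p q\<^esub> x) ` cycles m A p q"
  using quotient_module.carrier_quot[OF homology_quotient[OF assms]]
  by (simp add: homology_def)

lemma complex_morD:
  assumes "complex_mor R m A B f"
  shows "f p q \<in> mod_hom R (cmod A p q) (cmod B p q)"
    and "x \<in> carrier (cmod A p q) \<Longrightarrow>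
      f (p - int m) (q + 1 - int m) (cdiff A p q x) = cdiff B p q (f p q x)"
    and "w \<in> carrier (cmod A (p + int m) (q - 1 + int m)) \<Longrightarrow>
      f p q (cdiff A (p + int m) (q - 1 + int m) w) =
      cdiff B (p + int m) (q - 1 + int m) (f (p + int m) (q - 1 + int m) w)"
proof -
  have e': "p + int m - int m = p" "q - 1 + int m + 1 - int m = q" by simp_all
  note a = assms[unfolded complex_mor_def, rule_format]
  show "f p q \<in> mod_hom R (cmod A p q) (cmod B p q)" using a[of p q] by blast
  show "f (p - int m) (q + 1 - int m) (cdiff A p q x) = cdiff B p q (f p q x)"
    if "x \<in> carrier (cmod A p q)"
    using a[of p q] that by blast
  show "f p q (cdiff A (p + int m) (q - 1 + int m) w) =
      cdiff B (p + int m) (q - 1 + int m) (f (p + int m) (q - 1 + int m) w)"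
    if "w \<in> carrier (cmod A (p + int m) (q - 1 + int m))"
    using a[of "p + int m" "q - 1 + int m"] that unfolding e' by blast
qed

lemma complex_mor_cycles:
  assumes A: "bigraded_complex R m A" and B: "bigraded_complex R m B" and f: "complex_mor R m A B f"
  shows "x \<in> cycles m A p q \<Longrightarrow> f p q x \<in> cycles m B p q"
    and "x \<in> boundaries m A p q \<Longrightarrow> f p q x \<in> boundaries m B p q"
proof -
  have z: "f (p - int m) (q + 1 - int m) \<zero>\<^bsub>cmod A (p - int m) (q + 1 - int m)\<^esub>
      = \<zero>\<^bsub>cmod B (p - int m) (q + 1 - int m)\<^esub>"
    by (rule mod_hom_zero[OF bigraded_complexD(1)[OF A] bigraded_complexD(1)[OF B] complex_morD(1)[OF f]])
  show "f p q x \<in> cycles m B p q" if "x \<in> cycles m A p q"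
    using that mod_homD(1)[OF complex_morD(1)[OF f]] complex_morD(2)[OF f, of x p q] z
    by (auto simp: cycles_def)
  show "f p q x \<in> boundaries m B p q" if "x \<in> boundaries m A p q"
    using that mod_homD(1)[OF complex_morD(1)[OF f]] complex_morD(3)[OF f]
    by (auto simp: boundaries_def)
qed

text \<open>Boundaries go to boundaries, so all members of a class are sent to the same coset and
  the union that defines \<open>homology_map\<close> collapses to it.\<close>

lemma homology_map_coset:
  assumes A: "bigraded_complex R m A" and B: "bigraded_complex R m B" and f: "complex_mor R m A B f"
    and x: "x \<in> cycles m A p q"
  shows "homology_map m B f p q (boundaries m A p q +>\<^bsub>cmod A p q\<^esub> x) =
    boundaries m B p q +>\<^bsub>cmod B p q\<^esub> f p q x"
proof -
  interpret QA: quotient_module R "cycle_mod m A p q" "boundaries m A p q"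
    by (rule homology_quotient[OF A])
  interpret QB: quotient_module R "cycle_mod m B p q" "boundaries m B p q"
    by (rule homology_quotient[OF B])
  note fD = mod_homD[OF complex_morD(1)[OF f]]
  have "boundaries m B p q +>\<^bsub>cmod B p q\<^esub> f p q z = boundaries m B p q +>\<^bsub>cmod B p q\<^esub> f p q x"
    if z: "z \<in> boundaries m A p q +>\<^bsub>cmod A p q\<^esub> x" for z
  proof -
    obtain b where b: "b \<in> boundaries m A p q" "z = b \<oplus>\<^bsub>cmod A p q\<^esub> x"
      using z QA.coset_iff[of z x] by auto
    have "b \<in> cycles m A p q" using b QA.B_sub by auto
    then have "f p q z = f p q b \<oplus>\<^bsub>cmod B p q\<^esub> f p q x"
      using b x fD(2) by (auto simp: cycles_def)
    moreover have "f p q b \<in> boundaries m B p q" "f p q x \<in> cycles m B p q"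
      using complex_mor_cycles[OF A B f] b x by auto
    ultimately show ?thesis
      using QB.a_repr_independence'[of "f p q z" "f p q x"] QB.coset_iff[of "f p q z" "f p q x"]
      by auto
  qed
  moreover have "x \<in> boundaries m A p q +>\<^bsub>cmod A p q\<^esub> x"
    using QA.coset_self[of x] x by auto
  ultimately show ?thesis
    unfolding homology_map_def by blast
qed

lemma homology_map_hom:
  assumes A: "bigraded_complex R m A" and B: "bigraded_complex R m B" and f: "complex_mor R m A B f"
  shows "homology_map m B f p q \<in> mod_hom R (homology m A p q) (homology m B p q)"
proof -
  interpret QA: quotient_module R "cycle_mod m A p q" "boundaries m A p q"
    by (rule homology_quotient[OF A])
  interpret QB: quotient_module R "cycle_mod m B p q" "boundaries m B p q"
    by (rule homology_quotient[OF B])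
  note fD = mod_homD[OF complex_morD(1)[OF f]]
  note cyc = complex_mor_cycles[OF A B f]
  have c: "x \<in> carrier (cmod A p q)" if "x \<in> cycles m A p q" for x
    using that by (simp add: cycles_def)
  note hm = homology_map_coset[OF A B f]
  show ?thesis
  proof (rule mod_homI)
    fix X assume X: "X \<in> carrier (homology m A p q)"
    then obtain x where x: "x \<in> cycles m A p q" "X = boundaries m A p q +>\<^bsub>cmod A p q\<^esub> x"
      by (auto simp: carrier_homology[OF A])
    show "homology_map m B f p q X \<in> carrier (homology m B p q)"
      using x by (auto simp: hm cyc carrier_homology[OF B])
    show "homology_map m B f p q (a \<odot>\<^bsub>homology m A p q\<^esub> X) =
      a \<odot>\<^bsub>homology m B p q\<^esub> homology_map m B f p q X" if a: "a \<in> carrier R" for a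
      using QA.smult_quot[of a x] QB.smult_quot[of a "f p q x"] QA.smult_closed[of a x] a x c
      by (simp add: homology_def hm cyc fD)
    fix Y assume Y: "Y \<in> carrier (homology m A p q)"
    then obtain y where y: "y \<in> cycles m A p q" "Y = boundaries m A p q +>\<^bsub>cmod A p q\<^esub> y"
      by (auto simp: carrier_homology[OF A])
    show "homology_map m B f p q (X \<oplus>\<^bsub>homology m A p q\<^esub> Y) =
      homology_map m B f p q X \<oplus>\<^bsub>homology m B p q\<^esub> homology_map m B f p q Y"
      using QA.add_quot[of x y] QB.add_quot[of "f p q x" "f p q y"] QA.M.a_closed[of x y] x y c
      by (simp add: homology_def hm cyc fD)
  qed
qed

section \<open>Characteristic maps as surjections from the cycles\<close>

abbreviation pmod :: "('a, 'm) spse \<Rightarrow> nat \<Rightarrow> int \<Rightarrow> int \<Rightarrow> ('a, 'm) module" where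
  "pmod S m p q \<equiv> cmod (page S m) p q"

abbreviation pdiff :: "('a, 'm) spse \<Rightarrow> nat \<Rightarrow> int \<Rightarrow> int \<Rightarrow> 'm \<Rightarrow> 'm" where
  "pdiff S m p q \<equiv> cdiff (page S m) p q"

text \<open>Taking elements of \<open>'m\<close> to elements of \<open>'m\<close>, it keeps cosets
  out of most later arguments.\<close>

definition cls :: "('a, 'm) spse \<Rightarrow> nat \<Rightarrow> int \<Rightarrow> int \<Rightarrow> 'm \<Rightarrow> 'm" where
  "cls S m p q x = chi S m p q (boundaries m (page S m) p q +>\<^bsub>pmod S m p q\<^esub> x)"

lemma spectral_sequence_page: "spectral_sequence R S \<Longrightarrow> bigraded_complex R m (page S m)"
  by (simp add: spectral_sequence_def)

lemma spectral_sequence_module: "spectral_sequence R S \<Longrightarrow> module R (pmod S m p q)"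
  by (rule bigraded_complexD(1)[OF spectral_sequence_page])

lemma spectral_sequence_cls:
  assumes S: "spectral_sequence R S"
  shows "cls S m p q \<in> mod_hom R (cycle_mod m (page S m) p q) (pmod S (Suc m) p q)"
    and "cls S m p q ` cycles m (page S m) p q = carrier (pmod S (Suc m) p q)"
    and "x \<in> cycles m (page S m) p q \<Longrightarrow>
      cls S m p q x = \<zero>\<^bsub>pmod S (Suc m) p q\<^esub> \<longleftrightarrow> x \<in> boundaries m (page S m) p q"
proof -
  interpret Q: quotient_module R "cycle_mod m (page S m) p q" "boundaries m (page S m) p q"
    by (rule homology_quotient[OF spectral_sequence_page[OF S]])
  have "chi S m p q \<in> mod_iso R
      (quot_mod (cycle_mod m (page S m) p q) (boundaries m (page S m) p q)) (pmod S (Suc m) p q)"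
    using S by (simp add: spectral_sequence_def homology_def)
  note * = Q.surjection_of_mod_iso[OF spectral_sequence_module[OF S] this, simplified,
      folded cls_def]
  show "cls S m p q \<in> mod_hom R (cycle_mod m (page S m) p q) (pmod S (Suc m) p q)"
    and "cls S m p q ` cycles m (page S m) p q = carrier (pmod S (Suc m) p q)"
    using *(1,2) unfolding cls_def by auto
  show "cls S m p q x = \<zero>\<^bsub>pmod S (Suc m) p q\<^esub> \<longleftrightarrow> x \<in> boundaries m (page S m) p q"
    if "x \<in> cycles m (page S m) p q"
    using *(3)[OF that] .
qed

text \<open>The characteristic map sends a class to the value of \<open>c\<close> at some
  representative, which makes sense as soon as \<open>c\<close> is additive and kills the
  boundaries.\<close>

definition spse_of :: "(nat \<Rightarrow> ('a, 'm) bicomplex) \<Rightarrow> (nat \<Rightarrow> int \<Rightarrow> int \<Rightarrow> 'm \<Rightarrow> 'm) \<Rightarrow> ('a, 'm) spse" where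
  "spse_of C c = \<lparr>page = C, chi = (\<lambda>m p q X. c m p q (SOME x. x \<in> X))\<rparr>"

lemma page_spse_of [simp]: "page (spse_of C c) = C"
  by (simp add: spse_of_def)

text \<open>Here a spectral sequence is assembled from its pages and prescribed surjections from the
  cycles; the zero, fibre product and truncated spectral sequences all arise this way.\<close>

lemma spse_of:
  assumes C: "\<And>m. bigraded_complex R m (C m)"
    and c: "\<And>m p q. c m p q \<in> mod_hom R (cycle_mod m (C m) p q) (cmod (C (Suc m)) p q)"
    and surj: "\<And>m p q y. y \<in> carrier (cmod (C (Suc m)) p q) \<Longrightarrow> \<exists>x \<in> cycles m (C m) p q. y = c m p q x"
    and ker: "\<And>m p q x. x \<in> cycles m (C m) p q \<Longrightarrow>
      c m p q x = \<zero>\<^bsub>cmod (C (Suc m)) p q\<^esub> \<Longrightarrow> x \<in> boundaries m (C m) p q"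
    and bd: "\<And>m p q x. x \<in> boundaries m (C m) p q \<Longrightarrow> c m p q x = \<zero>\<^bsub>cmod (C (Suc m)) p q\<^esub>"
  shows "spectral_sequence R (spse_of C c)"
    and "x \<in> cycles m (C m) p q \<Longrightarrow> cls (spse_of C c) m p q x = c m p q x"
proof -
  \<comment> \<open>Representatives of one class differ by a boundary, on which \<open>c\<close>
    vanishes, so the choice does not matter.\<close>
  have *: "c m p q (SOME z. z \<in> boundaries m (C m) p q +>\<^bsub>cmod (C m) p q\<^esub> x) = c m p q x"
    if x: "x \<in> cycles m (C m) p q" for m p q x
  proof (rule someI2)
    interpret Q: quotient_module R "cycle_mod m (C m) p q" "boundaries m (C m) p q"
      by (rule homology_quotient[OF C])
    interpret N: module R "cmod (C (Suc m)) p q" by (rule bigraded_complexD(1)[OF C])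
    show "x \<in> boundaries m (C m) p q +>\<^bsub>cmod (C m) p q\<^esub> x"
      using Q.coset_self[of x] x by simp
    fix z assume "z \<in> boundaries m (C m) p q +>\<^bsub>cmod (C m) p q\<^esub> x"
    then obtain b where b: "b \<in> boundaries m (C m) p q" "z = b \<oplus>\<^bsub>cmod (C m) p q\<^esub> x"
      using Q.coset_iff[of z x] by auto
    then have "b \<in> cycles m (C m) p q" using Q.B_sub by auto
    then show "c m p q z = c m p q x"
      using mod_homD(1,2)[OF c, of _ m p q] x b bd by simp
  qed
  show "cls (spse_of C c) m p q x = c m p q x" if "x \<in> cycles m (C m) p q"
    using *[OF that] by (simp add: cls_def spse_of_def)
  show "spectral_sequence R (spse_of C c)"
    unfolding spectral_sequence_def
  proof (intro allI conjI)
    fix m p q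
    interpret Q: quotient_module R "cycle_mod m (C m) p q" "boundaries m (C m) p q"
      by (rule homology_quotient[OF C])
    show "bigraded_complex R m (page (spse_of C c) m)" using C by simp
    show "chi (spse_of C c) m p q \<in>
        mod_iso R (homology m (page (spse_of C c) m) p q) (cmod (page (spse_of C c) (Suc m)) p q)"
      unfolding page_spse_of homology_def
    proof (rule Q.mod_iso_of_surjection)
      show "module R (cmod (C (Suc m)) p q)" by (rule bigraded_complexD(1)[OF C])
      show "c m p q \<in> mod_hom R (cycle_mod m (C m) p q) (cmod (C (Suc m)) p q)" by (rule c)
      show "c m p q ` carrier (cycle_mod m (C m) p q) = carrier (cmod (C (Suc m)) p q)"
        using surj mod_homD(1)[OF c] by fastforce
      show "c m p q x = \<zero>\<^bsub>cmod (C (Suc m)) p q\<^esub> \<longleftrightarrow> x \<in> boundaries m (C m) p q"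
        if "x \<in> carrier (cycle_mod m (C m) p q)" for x
        using ker bd that by auto
      show "chi (spse_of C c) m p q (boundaries m (C m) p q +>\<^bsub>cycle_mod m (C m) p q\<^esub> x) = c m p q x"
        if "x \<in> carrier (cycle_mod m (C m) p q)" for x
        using *[of x] that by (simp add: spse_of_def)
    qed
  qed
qed

text \<open>Every homology class is the coset of a cycle, so compatibility with the characteristic
  maps can be tested on cycles.\<close>

lemma spse_morphism_iff:
  "spse_morphism R f \<longleftrightarrow> spectral_sequence R (src f) \<and> spectral_sequence R (tgt f) \<and> (\<forall>m.
     complex_mor R m (page (src f) m) (page (tgt f) m) (fmap f m) \<and>
     (\<forall>p q. fmap f m p q \<in> extensional (carrier (pmod (src f) m p q)) \<and>
        (\<forall>x \<in> cycles m (page (src f) m) p q.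
           fmap f (Suc m) p q (cls (src f) m p q x) = cls (tgt f) m p q (fmap f m p q x))))"
  (is "?L \<longleftrightarrow> ?R")
proof -
  have "(\<forall>X \<in> carrier (homology m (page (src f) m) p q).
           fmap f (Suc m) p q (chi (src f) m p q X)
             = chi (tgt f) m p q (homology_map m (page (tgt f) m) (fmap f m) p q X)) \<longleftrightarrow>
        (\<forall>x \<in> cycles m (page (src f) m) p q.
           fmap f (Suc m) p q (cls (src f) m p q x) = cls (tgt f) m p q (fmap f m p q x))"
    if "spectral_sequence R (src f)" "spectral_sequence R (tgt f)"
      "complex_mor R m (page (src f) m) (page (tgt f) m) (fmap f m)" for m p q
    using that
    by (simp add: carrier_homology[OF spectral_sequence_page] cls_def
        homology_map_coset[OF spectral_sequence_page spectral_sequence_page])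
  then show ?thesis
    unfolding spse_morphism_def by blast
qed

lemma spse_morphismD:
  assumes "spse_morphism R f"
  shows "spectral_sequence R (src f)" "spectral_sequence R (tgt f)"
    and "complex_mor R m (page (src f) m) (page (tgt f) m) (fmap f m)"
    and "fmap f m p q \<in> mod_hom R (pmod (src f) m p q) (pmod (tgt f) m p q)"
    and "fmap f m p q \<in> extensional (carrier (pmod (src f) m p q))"
    and "x \<in> cycles m (page (src f) m) p q \<Longrightarrow>
      fmap f (Suc m) p q (cls (src f) m p q x) = cls (tgt f) m p q (fmap f m p q x)"
  using assms by (auto simp: spse_morphism_iff intro: complex_morD(1))

text \<open>Through the characteristic maps, \<open>H(f\<^sub>r)\<close> is conjugate to \<open>f\<^sub>r\<^sub>+\<^sub>1\<close>.\<close>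

lemma E_quasi_isos_iff:
  "f \<in> E_quasi_isos R r \<longleftrightarrow> spse_morphism R f \<and>
    (\<forall>p q. bij_betw (fmap f (Suc r) p q) (carrier (pmod (src f) (Suc r) p q)) (carrier (pmod (tgt f) (Suc r) p q)))"
proof (cases "spse_morphism R f")
  case True
  note fD = spse_morphismD[OF True]
  have "homology_map r (page (tgt f) r) (fmap f r) p q \<in>
      mod_iso R (homology r (page (src f) r) p q) (homology r (page (tgt f) r) p q) \<longleftrightarrow>
    bij_betw (fmap f (Suc r) p q) (carrier (pmod (src f) (Suc r) p q)) (carrier (pmod (tgt f) (Suc r) p q))"
    for p q
  proof -
    let ?H = "homology_map r (page (tgt f) r) (fmap f r) p q"
    let ?A = "carrier (homology r (page (src f) r) p q)" and ?B = "carrier (homology r (page (tgt f) r) p q)"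
    have H: "?H \<in> mod_hom R (homology r (page (src f) r) p q) (homology r (page (tgt f) r) p q)"
      by (rule homology_map_hom) (use fD in \<open>auto intro: spectral_sequence_page\<close>)
    have s: "bij_betw (chi (src f) r p q) ?A (carrier (pmod (src f) (Suc r) p q))"
      and t: "bij_betw (chi (tgt f) r p q) ?B (carrier (pmod (tgt f) (Suc r) p q))"
      using fD(1,2) by (simp_all add: spectral_sequence_def mod_iso_def)
    have eq: "fmap f (Suc r) p q (chi (src f) r p q X) = chi (tgt f) r p q (?H X)" if "X \<in> ?A" for X
      using True that by (simp add: spse_morphism_def)
    have "bij_betw ?H ?A ?B \<longleftrightarrow> bij_betw (chi (tgt f) r p q \<circ> ?H) ?A (carrier (pmod (tgt f) (Suc r) p q))"
      by (rule bij_betw_comp_iff2[OF t]) (use mod_homD(1)[OF H] in blast)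
    also have "\<dots> \<longleftrightarrow> bij_betw (fmap f (Suc r) p q \<circ> chi (src f) r p q) ?A (carrier (pmod (tgt f) (Suc r) p q))"
      by (rule bij_betw_cong) (simp add: eq)
    also have "\<dots> \<longleftrightarrow> bij_betw (fmap f (Suc r) p q) (carrier (pmod (src f) (Suc r) p q)) (carrier (pmod (tgt f) (Suc r) p q))"
      by (rule bij_betw_comp_iff[OF s, symmetric])
    finally show ?thesis using H by (simp add: mod_iso_def)
  qed
  then show ?thesis
    using True fD(3) by (auto simp: E_quasi_isos_def SpSe_def quasi_iso_def)
next
  case False
  then show ?thesis by (simp add: E_quasi_isos_def SpSe_def)
qed

text \<open>A bijective chain map reflects cycles and boundaries as well as preserving them, so it
  induces a bijection of classes, that is, of the next page; induction carries this upwards from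
  page \<open>n\<close>.\<close>

lemma bij_betw_all_pages:
  assumes f: "spse_morphism R f"
    and b: "\<And>p q. bij_betw (fmap f n p q) (carrier (pmod (src f) n p q)) (carrier (pmod (tgt f) n p q))"
    and "n \<le> k"
  shows "bij_betw (fmap f k p q) (carrier (pmod (src f) k p q)) (carrier (pmod (tgt f) k p q))"
  using \<open>n \<le> k\<close>
proof (induction k arbitrary: p q rule: dec_induct)
  case base
  show ?case by (rule b)
next
  case (step k)
  note fD = spse_morphismD[OF f] and fc = complex_morD[OF spse_morphismD(3)[OF f]]
  let ?S = "src f" and ?T = "tgt f"
  have inj: "x \<in> carrier (pmod ?S k p q) \<Longrightarrow> y \<in> carrier (pmod ?S k p q) \<Longrightarrow>
      fmap f k p q x = fmap f k p q y \<Longrightarrow> x = y" for x y p q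
    using step.IH[of p q] by (auto simp: bij_betw_def inj_on_def)
  have sur: "y \<in> carrier (pmod ?T k p q) \<Longrightarrow> \<exists>x \<in> carrier (pmod ?S k p q). y = fmap f k p q x" for y p q
    using step.IH[of p q] by (auto simp: bij_betw_def)
  have z: "fmap f k p q \<zero>\<^bsub>pmod ?S k p q\<^esub> = \<zero>\<^bsub>pmod ?T k p q\<^esub>" for p q
    by (rule mod_hom_zero) (use fD spectral_sequence_module in auto)
  have zc: "\<zero>\<^bsub>pmod ?S k p q\<^esub> \<in> carrier (pmod ?S k p q)" for p q
    using spectral_sequence_module[OF fD(1)] by (meson abelian_group.axioms(1) abelian_monoid.zero_closed module_def)
  note cS = spectral_sequence_cls[OF fD(1)] and cT = spectral_sequence_cls[OF fD(2)]
  have h: "fmap f (Suc k) p q \<in> mod_hom R (pmod ?S (Suc k) p q) (pmod ?T (Suc k) p q)"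
    by (rule fD)
  \<comment> \<open>Injectivity in the bidegree where the differential lands reflects
    cycles.\<close>
  have cyc: "x \<in> cycles k (page ?S k) p q" 
    if x: "x \<in> carrier (pmod ?S k p q)" "fmap f k p q x \<in> cycles k (page ?T k) p q" for x
  proof -
    have d: "pdiff ?S k p q x \<in> carrier (pmod ?S k (p - int k) (q + 1 - int k))"
      using mod_homD(1)[OF bigraded_complexD(2)[OF spectral_sequence_page[OF fD(1)]]] x by blast
    have "fmap f k (p - int k) (q + 1 - int k) (pdiff ?S k p q x) =
      fmap f k (p - int k) (q + 1 - int k) \<zero>\<^bsub>pmod ?S k (p - int k) (q + 1 - int k)\<^esub>"
      using fc(2)[OF x(1)] x(2) z by (simp add: cycles_def)
    then show ?thesis using inj[OF d zc] x by (simp add: cycles_def)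
  qed
  \<comment> \<open>Surjectivity in the bidegree where the differential starts lifts the bounding
    element; injectivity at \<open>(p, q)\<close> then identifies \<open>x\<close> with the boundary
    of the lift.\<close>
  have bd: "x \<in> boundaries k (page ?S k) p q"
    if x: "x \<in> carrier (pmod ?S k p q)" "fmap f k p q x \<in> boundaries k (page ?T k) p q" for x
  proof -
    obtain w where w: "w \<in> carrier (pmod ?T k (p + int k) (q - 1 + int k))"
      "fmap f k p q x = pdiff ?T k (p + int k) (q - 1 + int k) w"
      using x(2) by (auto simp: boundaries_def)
    obtain v where v: "v \<in> carrier (pmod ?S k (p + int k) (q - 1 + int k))"
      "w = fmap f k (p + int k) (q - 1 + int k) v"
      using sur[OF w(1)] by blast
    have "fmap f k p q x = fmap f k p q (pdiff ?S k (p + int k) (q - 1 + int k) v)"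
      using fc(3)[OF v(1)] v w by simp
    moreover have "pdiff ?S k (p + int k) (q - 1 + int k) v \<in> carrier (pmod ?S k p q)"
      using mod_homD(1)[OF bigraded_complexD(3)[OF spectral_sequence_page[OF fD(1)]]] v(1) by blast
    ultimately have "x = pdiff ?S k (p + int k) (q - 1 + int k) v"
      using inj x(1) by blast
    then show ?thesis using v(1) by (auto simp: boundaries_def)
  qed
  interpret M: module R "pmod ?S (Suc k) p q" by (rule spectral_sequence_module[OF fD(1)])
  interpret N: module R "pmod ?T (Suc k) p q" by (rule spectral_sequence_module[OF fD(2)])
  \<comment> \<open>The difference is the class of a cycle \<open>u\<close> whose image has class
    zero. So the image is a boundary, hence \<open>u\<close> is one too and the difference is
    zero.\<close>
  have "x = y" if xy: "x \<in> carrier (pmod ?S (Suc k) p q)" "y \<in> carrier (pmod ?S (Suc k) p q)"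
    "fmap f (Suc k) p q x = fmap f (Suc k) p q y" for x y
  proof -
    have d: "x \<ominus>\<^bsub>pmod ?S (Suc k) p q\<^esub> y \<in> carrier (pmod ?S (Suc k) p q)" using xy by simp
    have "fmap f (Suc k) p q (x \<ominus>\<^bsub>pmod ?S (Suc k) p q\<^esub> y) = \<zero>\<^bsub>pmod ?T (Suc k) p q\<^esub>"
      using mod_hom_minus[OF M.module_axioms N.module_axioms h xy(1,2)] xy(3) mod_homD(1)[OF h xy(2)]
      by (simp add: N.M.minus_eq N.M.r_neg)
    moreover obtain u where u: "u \<in> cycles k (page ?S k) p q"
      "x \<ominus>\<^bsub>pmod ?S (Suc k) p q\<^esub> y = cls ?S k p q u"
      using d cS(2)[of k p q] by blast
    ultimately have "cls ?T k p q (fmap f k p q u) = \<zero>\<^bsub>pmod ?T (Suc k) p q\<^esub>"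
      using fD(6) by simp
    then have "fmap f k p q u \<in> boundaries k (page ?T k) p q"
      using cT(3) complex_mor_cycles(1)[OF spectral_sequence_page[OF fD(1)] spectral_sequence_page[OF fD(2)] fD(3) u(1)]
      by blast
    then have "u \<in> boundaries k (page ?S k) p q"
      using bd u(1) by (auto simp: cycles_def)
    then have "x \<ominus>\<^bsub>pmod ?S (Suc k) p q\<^esub> y = \<zero>\<^bsub>pmod ?S (Suc k) p q\<^esub>"
      using u cS(3) by simp
    then show "x = y" using xy by (simp add: M.M.diff_eq_zero_iff)
  qed
  moreover have "\<exists>x \<in> carrier (pmod ?S (Suc k) p q). y = fmap f (Suc k) p q x"
    if y: "y \<in> carrier (pmod ?T (Suc k) p q)" for y
  proof -
    obtain v where v: "v \<in> cycles k (page ?T k) p q" "y = cls ?T k p q v"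
      using y cT(2)[of k p q] by blast
    then obtain u where u: "u \<in> carrier (pmod ?S k p q)" "v = fmap f k p q u"
      using sur[of v p q] by (auto simp: cycles_def)
    then have "u \<in> cycles k (page ?S k) p q" using cyc v by simp
    then show ?thesis
      using fD(6)[of u k p q] u v cS(2)[of k p q] by (intro bexI[of _ "cls ?S k p q u"]) auto
  qed
  ultimately show ?case
    using mod_homD(1)[OF h] by (auto simp: bij_betw_def inj_on_def image_def)
qed

section \<open>The category of spectral sequences\<close>

text \<open>Restricting to the carriers yields the extensional components that a morphism must have,
  so any function on all of \<open>'m\<close> may be supplied.\<close>

definition mor_of :: "('a, 'm) spse \<Rightarrow> ('a, 'm) spse \<Rightarrow> (nat \<Rightarrow> int \<Rightarrow> int \<Rightarrow> 'm \<Rightarrow> 'm) \<Rightarrow> ('a, 'm) spse_mor" where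
  "mor_of S T h = \<lparr>src = S, tgt = T, fmap = (\<lambda>m p q. restrict (h m p q) (carrier (pmod S m p q)))\<rparr>"

lemma mor_of_simps [simp]:
  "src (mor_of S T h) = S" "tgt (mor_of S T h) = T"
  "x \<in> carrier (pmod S m p q) \<Longrightarrow> fmap (mor_of S T h) m p q x = h m p q x"
  by (simp_all add: mor_of_def)

lemma spectral_sequence_pdiff:
  assumes "spectral_sequence R S" "x \<in> carrier (pmod S m p q)"
  shows "pdiff S m p q x \<in> carrier (pmod S m (p - int m) (q + 1 - int m))"
  using mod_homD(1)[OF bigraded_complexD(2)[OF spectral_sequence_page[OF assms(1)]] assms(2)] .

lemma spectral_sequence_cls_closed:
  assumes "spectral_sequence R S" "x \<in> cycles m (page S m) p q"
  shows "cls S m p q x \<in> carrier (pmod S (Suc m) p q)"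
  using spectral_sequence_cls(2)[OF assms(1), of m p q] assms(2) by blast

lemma cycles_carrier: "x \<in> cycles m (page S m) p q \<Longrightarrow> x \<in> carrier (pmod S m p q)"
  by (simp add: cycles_def)

lemma mor_of_morphism:
  assumes S: "spectral_sequence R S" and T: "spectral_sequence R T"
    and h: "\<And>m p q. h m p q \<in> mod_hom R (pmod S m p q) (pmod T m p q)"
    and d: "\<And>m p q x. x \<in> carrier (pmod S m p q) \<Longrightarrow>
      h m (p - int m) (q + 1 - int m) (pdiff S m p q x) = pdiff T m p q (h m p q x)"
    and c: "\<And>m p q x. x \<in> cycles m (page S m) p q \<Longrightarrow>
      h (Suc m) p q (cls S m p q x) = cls T m p q (h m p q x)"
  shows "spse_morphism R (mor_of S T h)"
  unfolding spse_morphism_iff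
proof (intro conjI allI ballI)
  fix m
  show "complex_mor R m (page (src (mor_of S T h)) m) (page (tgt (mor_of S T h)) m) (fmap (mor_of S T h) m)"
    unfolding complex_mor_def
  proof (intro allI conjI ballI)
    fix p q
    interpret M: module R "pmod S m p q" by (rule spectral_sequence_module[OF S])
    show "fmap (mor_of S T h) m p q \<in>
        mod_hom R (pmod (src (mor_of S T h)) m p q) (pmod (tgt (mor_of S T h)) m p q)"
      by (rule mod_homI) (simp_all add: mod_homD[OF h])
    show "fmap (mor_of S T h) m (p - int m) (q + 1 - int m) (pdiff (src (mor_of S T h)) m p q x) =
        pdiff (tgt (mor_of S T h)) m p q (fmap (mor_of S T h) m p q x)"
      if "x \<in> carrier (pmod (src (mor_of S T h)) m p q)" for x
      using that spectral_sequence_pdiff[OF S] by (simp add: d)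
  qed
  fix p q
  show "fmap (mor_of S T h) m p q \<in> extensional (carrier (pmod (src (mor_of S T h)) m p q))"
    by (simp add: mor_of_def)
  show "fmap (mor_of S T h) (Suc m) p q (cls (src (mor_of S T h)) m p q x) =
      cls (tgt (mor_of S T h)) m p q (fmap (mor_of S T h) m p q x)"
    if "x \<in> cycles m (page (src (mor_of S T h)) m) p q" for x
    using that spectral_sequence_cls_closed[OF S] cycles_carrier[of x m S p q] by (simp add: c)
qed (use S T in simp_all)

lemma SpSe_simps:
  "Ob (SpSe R) = {S. spectral_sequence R S}" "Arr (SpSe R) = {f. spse_morphism R f}"
  "Dom (SpSe R) = src" "Cod (SpSe R) = tgt"
  "Id (SpSe R) S = mor_of S S (\<lambda>m p q x. x)"
  "Comp (SpSe R) g f = mor_of (src f) (tgt g) (\<lambda>m p q x. fmap g m p q (fmap f m p q x))"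
  by (simp_all add: SpSe_def mor_of_def compose_def)

lemma Hom_SpSe: "f \<in> Hom (SpSe R) S T \<longleftrightarrow> spse_morphism R f \<and> src f = S \<and> tgt f = T"
  by (simp add: Hom_def SpSe_simps)

lemma morphism_Id:
  assumes "spectral_sequence R S"
  shows "spse_morphism R (mor_of S S (\<lambda>m p q x. x))"
  by (rule mor_of_morphism) (use assms in \<open>auto intro: mod_homI\<close>)

lemma morphism_closed:
  assumes "spse_morphism R f" "x \<in> carrier (pmod (src f) m p q)"
  shows "fmap f m p q x \<in> carrier (pmod (tgt f) m p q)"
  using mod_homD(1)[OF spse_morphismD(4)[OF assms(1)] assms(2)] .

lemma morphism_add:
  assumes "spse_morphism R f" "x \<in> carrier (pmod (src f) m p q)" "y \<in> carrier (pmod (src f) m p q)"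
  shows "fmap f m p q (x \<oplus>\<^bsub>pmod (src f) m p q\<^esub> y) = fmap f m p q x \<oplus>\<^bsub>pmod (tgt f) m p q\<^esub> fmap f m p q y"
  using mod_homD(2)[OF spse_morphismD(4)[OF assms(1)] assms(2,3)] .

lemma morphism_smult:
  assumes "spse_morphism R f" "a \<in> carrier R" "x \<in> carrier (pmod (src f) m p q)"
  shows "fmap f m p q (a \<odot>\<^bsub>pmod (src f) m p q\<^esub> x) = a \<odot>\<^bsub>pmod (tgt f) m p q\<^esub> fmap f m p q x"
  using mod_homD(3)[OF spse_morphismD(4)[OF assms(1)] assms(2,3)] .

lemma morphism_zero:
  assumes "spse_morphism R f"
  shows "fmap f m p q \<zero>\<^bsub>pmod (src f) m p q\<^esub> = \<zero>\<^bsub>pmod (tgt f) m p q\<^esub>"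
  by (rule mod_hom_zero[OF spectral_sequence_module[OF spse_morphismD(1)[OF assms]]
        spectral_sequence_module[OF spse_morphismD(2)[OF assms]] spse_morphismD(4)[OF assms]])

lemma morphism_diff:
  assumes "spse_morphism R f" "x \<in> carrier (pmod (src f) m p q)"
  shows "fmap f m (p - int m) (q + 1 - int m) (pdiff (src f) m p q x) = pdiff (tgt f) m p q (fmap f m p q x)"
  using complex_morD(2)[OF spse_morphismD(3)[OF assms(1)] assms(2)] .

lemma morphism_cycles:
  assumes "spse_morphism R f" "x \<in> cycles m (page (src f) m) p q"
  shows "fmap f m p q x \<in> cycles m (page (tgt f) m) p q"
  using complex_mor_cycles(1)[OF _ _ spse_morphismD(3)[OF assms(1)] assms(2)]
    spectral_sequence_page[OF spse_morphismD(1)[OF assms(1)]]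
    spectral_sequence_page[OF spse_morphismD(2)[OF assms(1)]] by blast

lemma morphism_Comp:
  assumes f: "spse_morphism R f" and g: "spse_morphism R g" and e: "tgt f = src g"
  shows "spse_morphism R (mor_of (src f) (tgt g) (\<lambda>m p q x. fmap g m p q (fmap f m p q x)))"
proof (rule mor_of_morphism)
  show "spectral_sequence R (src f)" "spectral_sequence R (tgt g)"
    using spse_morphismD(1)[OF f] spse_morphismD(2)[OF g] .
  note g' = morphism_closed[OF g, folded e] morphism_add[OF g, folded e] morphism_smult[OF g, folded e]
    morphism_diff[OF g, folded e] spse_morphismD(6)[OF g, folded e]
  show "(\<lambda>x. fmap g m p q (fmap f m p q x)) \<in> mod_hom R (pmod (src f) m p q) (pmod (tgt g) m p q)" for m p q
    by (rule mod_homI) (simp_all add: g' morphism_closed[OF f] morphism_add[OF f] morphism_smult[OF f])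
  show "fmap g m (p - int m) (q + 1 - int m) (fmap f m (p - int m) (q + 1 - int m) (pdiff (src f) m p q x)) =
      pdiff (tgt g) m p q (fmap g m p q (fmap f m p q x))" if "x \<in> carrier (pmod (src f) m p q)" for m p q x
    using that by (simp add: morphism_diff[OF f] g' morphism_closed[OF f])
  show "fmap g (Suc m) p q (fmap f (Suc m) p q (cls (src f) m p q x)) =
      cls (tgt g) m p q (fmap g m p q (fmap f m p q x))"
    if "x \<in> cycles m (page (src f) m) p q" for m p q x
    using that by (simp add: spse_morphismD(6)[OF f] g' morphism_cycles[OF f])
qed

text \<open>Both sides are extensional, so agreement on the carriers of the source decides
  equality.\<close>

lemma spse_mor_of_eqI:
  fixes f :: "('a, 'm) spse_mor"
  assumes "spse_morphism R f" "src f = S" "tgt f = T"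
    and "\<And>m p q x. x \<in> carrier (pmod S m p q) \<Longrightarrow> h m p q x = fmap f m p q x"
  shows "mor_of S T h = f"
proof -
  have "restrict (h m p q) (carrier (pmod S m p q)) = fmap f m p q" for m p q
    using spse_morphismD(5)[OF assms(1), of m p q] assms(2,4)
    by (intro extensionalityI[of _ "carrier (pmod S m p q)"]) auto
  then have "(\<lambda>m p q. restrict (h m p q) (carrier (pmod S m p q))) = fmap f" by blast
  with assms(2,3) show ?thesis by (simp add: mor_of_def)
qed

lemma mor_of_cong:
  assumes "\<And>m p q x. x \<in> carrier (pmod S m p q) \<Longrightarrow> h m p q x = k m p q x"
  shows "mor_of S T h = mor_of S T k"
proof -
  have "restrict (h m p q) (carrier (pmod S m p q)) = restrict (k m p q) (carrier (pmod S m p q))" for m p q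
    using assms by (auto simp: restrict_def)
  then show ?thesis by (simp add: mor_of_def)
qed

lemma category_SpSe: "category (SpSe R)"
proof
  fix f X Y g Z assume f: "f \<in> Hom (SpSe R) X Y" and g: "g \<in> Hom (SpSe R) Y Z"
  show "Comp (SpSe R) g f \<in> Hom (SpSe R) X Z"
    using f g morphism_Comp[of R f g] by (simp add: Hom_SpSe SpSe_simps)
next
  fix f X Y assume f: "f \<in> Hom (SpSe R) X Y"
  then show "Comp (SpSe R) f (Id (SpSe R) X) = f" "Comp (SpSe R) (Id (SpSe R) Y) f = f"
    using morphism_closed[of R f]
    by (auto simp: Hom_SpSe SpSe_simps intro!: spse_mor_of_eqI[of R])
next
  fix f X Y g Z h V
  assume "f \<in> Hom (SpSe R) X Y" "g \<in> Hom (SpSe R) Y Z" "h \<in> Hom (SpSe R) Z V"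
  then show "Comp (SpSe R) h (Comp (SpSe R) g f) = Comp (SpSe R) (Comp (SpSe R) h g) f"
    using morphism_closed[of R f] by (auto simp: Hom_SpSe SpSe_simps intro!: mor_of_cong)
qed (simp_all add: SpSe_simps Hom_SpSe spse_morphismD(1,2) morphism_Id)

section \<open>Weak equivalences and fibrations of spectral sequences\<close>

abbreviation bij_at :: "('a, 'm) spse_mor \<Rightarrow> nat \<Rightarrow> int \<Rightarrow> int \<Rightarrow> bool" where
  "bij_at f m p q \<equiv> bij_betw (fmap f m p q) (carrier (pmod (src f) m p q)) (carrier (pmod (tgt f) m p q))"

abbreviation onto_at :: "('a, 'm) spse_mor \<Rightarrow> nat \<Rightarrow> int \<Rightarrow> int \<Rightarrow> bool" where
  "onto_at f m p q \<equiv> fmap f m p q ` carrier (pmod (src f) m p q) = carrier (pmod (tgt f) m p q)"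

lemma isos_SpSe_bij:
  assumes "f \<in> isos (SpSe R)"
  shows "spse_morphism R f" "bij_at f m p q"
proof -
  obtain g where f: "spse_morphism R f" and g: "spse_morphism R g" "src g = tgt f" "tgt g = src f"
    and gf: "Comp (SpSe R) g f = Id (SpSe R) (src f)" and fg: "Comp (SpSe R) f g = Id (SpSe R) (tgt f)"
    using assms by (auto simp: isos_def Hom_SpSe SpSe_simps(2-4))
  show "spse_morphism R f" by fact
  have "fmap g m p q (fmap f m p q x) = x" if "x \<in> carrier (pmod (src f) m p q)" for x
    using arg_cong[OF gf, of "\<lambda>h. fmap h m p q x"] that by (simp add: SpSe_simps)
  moreover have "fmap f m p q (fmap g m p q x) = x" if "x \<in> carrier (pmod (tgt f) m p q)" for x
    using arg_cong[OF fg, of "\<lambda>h. fmap h m p q x"] that g by (simp add: SpSe_simps)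
  ultimately show "bij_at f m p q"
    using morphism_closed[OF f] morphism_closed[OF g(1)] g(2,3)
    by (intro bij_betw_byWitness[where f' = "fmap g m p q"]) auto
qed

lemma r_fibrations_iff:
  "f \<in> r_fibrations R r \<longleftrightarrow> spse_morphism R f \<and> (\<forall>k\<le>r. \<forall>p q. onto_at f k p q)"
  by (simp add: r_fibrations_def SpSe_simps)

lemma isos_SpSe_acyclic_fibration: "isos (SpSe R) \<subseteq> E_quasi_isos R r \<inter> r_fibrations R r"
proof
  fix h :: "('a, 'm) spse_mor" assume h: "h \<in> isos (SpSe R)"
  have "onto_at h k p q" for k p q using isos_SpSe_bij(2)[OF h, of k p q] by (simp add: bij_betw_def)
  then show "h \<in> E_quasi_isos R r \<inter> r_fibrations R r"
    using isos_SpSe_bij[OF h] by (simp add: E_quasi_isos_iff r_fibrations_iff)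
qed

text \<open>Among morphisms, the weak equivalences are those bijective on page \<open>Suc r\<close>,
  so the claim is two-out-of-three for bijective functions in each bidegree.\<close>

lemma E_quasi_isos_two_out_of_three: "two_out_of_three (SpSe R) (E_quasi_isos R r)"
  unfolding two_out_of_three_def
proof (intro ballI impI)
  fix f g assume "f \<in> Arr (SpSe R)" "g \<in> Arr (SpSe R)" "Cod (SpSe R) f = Dom (SpSe R) g"
  then have f: "spse_morphism R f" and g: "spse_morphism R g" and e: "tgt f = src g"
    by (simp_all add: SpSe_simps)
  have cl: "fmap f m p q ` carrier (pmod (src f) m p q) \<subseteq> carrier (pmod (src g) m p q)" for m p q
    using morphism_closed[OF f] e by auto
  have c: "bij_at (Comp (SpSe R) g f) m p q \<longleftrightarrow>
      bij_betw (fmap g m p q \<circ> fmap f m p q) (carrier (pmod (src f) m p q)) (carrier (pmod (tgt g) m p q))" for m p q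
    unfolding SpSe_simps mor_of_simps by (rule bij_betw_cong) simp
  have gf: "spse_morphism R (Comp (SpSe R) g f)"
    using morphism_Comp[OF f g e] by (simp add: SpSe_simps)
  have 1: "bij_at (Comp (SpSe R) g f) m p q" if "bij_at f m p q" "bij_at g m p q" for m p q
    unfolding c by (rule bij_betw_trans[OF that(1)]) (use that(2) e in simp)
  have 2: "bij_at g m p q" if "bij_at f m p q" "bij_at (Comp (SpSe R) g f) m p q" for m p q
    using bij_betw_comp_iff[OF that(1), of "fmap g m p q"] that(2) e unfolding c by simp
  have 3: "bij_at f m p q" if "bij_at g m p q" "bij_at (Comp (SpSe R) g f) m p q" for m p q
    using bij_betw_comp_iff2[OF that(1) cl] that(2) e unfolding c by simp
  show "(f \<in> E_quasi_isos R r \<and> g \<in> E_quasi_isos R r \<longrightarrow> Comp (SpSe R) g f \<in> E_quasi_isos R r) \<and>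
     (f \<in> E_quasi_isos R r \<and> Comp (SpSe R) g f \<in> E_quasi_isos R r \<longrightarrow> g \<in> E_quasi_isos R r) \<and>
     (g \<in> E_quasi_isos R r \<and> Comp (SpSe R) g f \<in> E_quasi_isos R r \<longrightarrow> f \<in> E_quasi_isos R r)"
    unfolding E_quasi_isos_iff using f g gf 1 2 3 by blast
qed

lemma r_fibrations_Comp:
  assumes "f \<in> r_fibrations R r" "g \<in> r_fibrations R r" "Cod (SpSe R) f = Dom (SpSe R) g"
  shows "Comp (SpSe R) g f \<in> r_fibrations R r"
proof -
  have f: "spse_morphism R f" and g: "spse_morphism R g" and e: "tgt f = src g"
    and o: "\<And>k p q. k \<le> r \<Longrightarrow> onto_at f k p q" "\<And>k p q. k \<le> r \<Longrightarrow> onto_at g k p q"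
    using assms by (simp_all add: SpSe_simps r_fibrations_iff)
  have "onto_at (Comp (SpSe R) g f) k p q" if "k \<le> r" for k p q
  proof -
    have "fmap (Comp (SpSe R) g f) k p q ` carrier (pmod (src f) k p q) =
        fmap g k p q ` (fmap f k p q ` carrier (pmod (src f) k p q))"
      unfolding SpSe_simps mor_of_simps image_image by (rule image_cong) simp_all
    then show ?thesis using o[OF that] e by (simp add: SpSe_simps(6))
  qed
  then show ?thesis using morphism_Comp[OF f g e] by (simp add: r_fibrations_iff SpSe_simps)
qed

text \<open>The two properties cover complementary pages: those up to \<open>r\<close>, and those
  from \<open>Suc r\<close> on. The result supplies the assumption \<open>onto\<close> of the locale
  \<open>fibre_product\<close>.\<close>

lemma acyclic_fibration_onto:
  assumes "f \<in> E_quasi_isos R r \<inter> r_fibrations R r"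
  shows "onto_at f k p q"
proof (cases "k \<le> r")
  case True
  then show ?thesis using assms by (simp add: r_fibrations_iff)
next
  case False
  then have "Suc r \<le> k" by simp
  have "bij_at f k p q"
    by (rule bij_betw_all_pages[OF _ _ \<open>Suc r \<le> k\<close>, of R f])
      (use assms[THEN IntD1] in \<open>unfold E_quasi_isos_iff, blast\<close>)+
  then show ?thesis by (simp add: bij_betw_def)
qed

section \<open>The zero spectral sequence, final objects and fibrancy\<close>

text \<open>\<open>undefined\<close> serves as an element that every type provides without further
  assumptions.\<close>

definition zero_mod :: "('a, 'm) module" where
  "zero_mod = \<lparr>carrier = {undefined}, mult = undefined, one = undefined,
     zero = undefined, add = (\<lambda>x y. undefined), smult = (\<lambda>a x. undefined)\<rparr>"

lemma zero_mod_simps [simp]: "carrier zero_mod = {undefined}" "\<zero>\<^bsub>zero_mod\<^esub> = undefined"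
    "x \<oplus>\<^bsub>zero_mod\<^esub> y = undefined" "a \<odot>\<^bsub>zero_mod\<^esub> x = undefined"
  by (simp_all add: zero_mod_def)

lemma module_zero_mod: "cring R \<Longrightarrow> module R zero_mod"
  by (rule moduleI') auto

text \<open>Besides being a final object, it supplies the pages of a truncation beyond page
  \<open>r\<close>.\<close>

definition zero_spse :: "('a, 'm) spse" where
  "zero_spse = spse_of (\<lambda>m. \<lparr>cmod = (\<lambda>p q. zero_mod), cdiff = (\<lambda>p q x. undefined)\<rparr>) (\<lambda>m p q x. undefined)"

lemma page_zero_spse [simp]: "page zero_spse m = \<lparr>cmod = (\<lambda>p q. zero_mod), cdiff = (\<lambda>p q x. undefined)\<rparr>"
  by (simp add: zero_spse_def)

lemma zero_spse: "cring R \<Longrightarrow> spectral_sequence R zero_spse"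
  unfolding zero_spse_def
  by (rule spse_of(1))
    (auto simp: bigraded_complex_def module_zero_mod cycles_def boundaries_def intro!: mod_homI)

lemma spectral_sequence_zero_maps:
  assumes T: "spectral_sequence R T"
  shows "\<zero>\<^bsub>pmod T m p q\<^esub> \<in> cycles m (page T m) p q"
    and "pdiff T m p q \<zero>\<^bsub>pmod T m p q\<^esub> = \<zero>\<^bsub>pmod T m (p - int m) (q + 1 - int m)\<^esub>"
    and "cls T m p q \<zero>\<^bsub>pmod T m p q\<^esub> = \<zero>\<^bsub>pmod T (Suc m) p q\<^esub>"
proof -
  interpret Z: quotient_module R "cycle_mod m (page T m) p q" "boundaries m (page T m) p q"
    by (rule homology_quotient[OF spectral_sequence_page[OF T]])
  show "\<zero>\<^bsub>pmod T m p q\<^esub> \<in> cycles m (page T m) p q" using Z.M.zero_closed by simp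
  then show "pdiff T m p q \<zero>\<^bsub>pmod T m p q\<^esub> = \<zero>\<^bsub>pmod T m (p - int m) (q + 1 - int m)\<^esub>"
    by (simp add: cycles_def)
  show "cls T m p q \<zero>\<^bsub>pmod T m p q\<^esub> = \<zero>\<^bsub>pmod T (Suc m) p q\<^esub>"
    using mod_hom_zero[OF Z.module_axioms spectral_sequence_module[OF T] spectral_sequence_cls(1)[OF T]] by simp
qed

lemma zero_mod_hom: "module R N \<Longrightarrow> (\<lambda>x. \<zero>\<^bsub>N\<^esub>) \<in> mod_hom R M N"
  by (rule mod_homI) (simp_all add: abelian_monoid.zero_closed abelian_monoid.l_zero module.smult_r_null
      module.axioms(2) abelian_group.axioms(1))

lemma zero_morphism:
  assumes S: "spectral_sequence R S" and T: "spectral_sequence R T"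
  shows "spse_morphism R (mor_of S T (\<lambda>m p q x. \<zero>\<^bsub>pmod T m p q\<^esub>))"
  by (rule mor_of_morphism[OF S T])
    (simp_all add: zero_mod_hom spectral_sequence_module[OF T] spectral_sequence_zero_maps[OF T])

lemma morphism_to_zero_spse:
  assumes "spse_morphism R f" "tgt f = zero_spse" "x \<in> carrier (pmod (src f) m p q)"
  shows "fmap f m p q x = undefined"
  using morphism_closed[OF assms(1,3)] assms(2) by simp

abbreviation to_zero :: "('a, 'm) spse \<Rightarrow> ('a, 'm) spse_mor" where
  "to_zero S \<equiv> mor_of S zero_spse (\<lambda>m p q x. undefined)"

lemma final_zero_spse:
  assumes "cring R"
  shows "final_object (SpSe R) zero_spse"
  unfolding final_object_def
proof (intro conjI ballI)
  show "zero_spse \<in> Ob (SpSe R)" using zero_spse[OF assms] by (simp add: SpSe_simps)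
  fix S assume "S \<in> Ob (SpSe R)"
  then have S: "spectral_sequence R S" by (simp add: SpSe_simps)
  show "\<exists>!t. t \<in> Hom (SpSe R) S zero_spse"
  proof (rule ex1I)
    show "to_zero S \<in> Hom (SpSe R) S zero_spse"
      using zero_morphism[OF S zero_spse[OF assms]] by (simp add: Hom_SpSe)
    show "t = to_zero S" if t: "t \<in> Hom (SpSe R) S zero_spse" for t
      using t by (intro spse_mor_of_eqI[of R, symmetric]) (auto simp: Hom_SpSe morphism_to_zero_spse[of R])
  qed
qed

text \<open>\<open>e\<close> may be any final object. Its identity and its zero endomorphism
  coincide, so all its modules vanish, and a map to \<open>e\<close> is onto because it sends zero
  to zero.\<close>

lemma SpSe_fibrant:
  assumes e: "final_object (SpSe R) e" and t: "t \<in> Hom (SpSe R) X e"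
  shows "t \<in> r_fibrations R r"
proof -
  have eS: "spectral_sequence R e" using e by (simp add: final_object_def SpSe_simps)
  have tm: "spse_morphism R t" "tgt t = e" using t by (auto simp: Hom_SpSe)
  have "mor_of e e (\<lambda>m p q x. x) \<in> Hom (SpSe R) e e" "mor_of e e (\<lambda>m p q x. \<zero>\<^bsub>pmod e m p q\<^esub>) \<in> Hom (SpSe R) e e"
    using morphism_Id[OF eS] zero_morphism[OF eS eS] by (simp_all add: Hom_SpSe)
  then have eq: "mor_of e e (\<lambda>m p q x. x) = mor_of e e (\<lambda>m p q x. \<zero>\<^bsub>pmod e m p q\<^esub>)"
    using e eS unfolding final_object_def SpSe_simps by blast
  have z: "x = \<zero>\<^bsub>pmod e m p q\<^esub>" if "x \<in> carrier (pmod e m p q)" for x m p q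
    using arg_cong[OF eq, of "\<lambda>h. fmap h m p q x"] that by simp
  have "onto_at t k p q" for k p q
  proof -
    interpret M: module R "pmod (src t) k p q"
      by (rule spectral_sequence_module[OF spse_morphismD(1)[OF tm(1)]])
    have "x \<in> fmap t k p q ` carrier (pmod (src t) k p q)" if "x \<in> carrier (pmod e k p q)" for x
      using z[OF that] morphism_zero[OF tm(1), of k p q] tm(2) M.M.zero_closed
      by (intro image_eqI[of _ _ "\<zero>\<^bsub>pmod (src t) k p q\<^esub>"]) auto
    then show ?thesis
      using morphism_closed[OF tm(1), of _ k p q] tm(2) by blast
  qed
  then show ?thesis using tm by (simp add: r_fibrations_iff)
qed

section \<open>Fibre products\<close>

lemma spectral_sequence_diff_hom:
  assumes "spectral_sequence R S"
  shows "pdiff S m p q \<in> mod_hom R (pmod S m p q) (pmod S m (p - int m) (q + 1 - int m))"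
  by (rule bigraded_complexD(2)[OF spectral_sequence_page[OF assms]])

lemma spectral_sequence_diff_hom':
  assumes "spectral_sequence R S"
  shows "pdiff S m (p + int m) (q - 1 + int m) \<in>
    mod_hom R (pmod S m (p + int m) (q - 1 + int m)) (pmod S m p q)"
  by (rule bigraded_complexD(3)[OF spectral_sequence_page[OF assms]])

text \<open>Negation is defined as an inverse inside the carrier, so shrinking the carrier changes
  its definition. Both negations equal scaling by -1, which does not mention the carrier.\<close>

lemma cycle_mod_minus:
  assumes A: "bigraded_complex R m A" and x: "x \<in> cycles m A p q" and y: "y \<in> cycles m A p q"
  shows "x \<ominus>\<^bsub>cycle_mod m A p q\<^esub> y = x \<ominus>\<^bsub>cmod A p q\<^esub> y"
proof -
  interpret M: module R "cmod A p q" by (rule bigraded_complexD(1)[OF A])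
  interpret Q: quotient_module R "cycle_mod m A p q" "boundaries m A p q"
    by (rule homology_quotient[OF A])
  have "\<ominus>\<^bsub>cycle_mod m A p q\<^esub> y = (\<ominus>\<^bsub>R\<^esub> \<one>\<^bsub>R\<^esub>) \<odot>\<^bsub>cmod A p q\<^esub> y"
    using Q.smult_l_minus[of "\<one>\<^bsub>R\<^esub>" y] Q.smult_one[of y] y by simp
  moreover have "\<ominus>\<^bsub>cmod A p q\<^esub> y = (\<ominus>\<^bsub>R\<^esub> \<one>\<^bsub>R\<^esub>) \<odot>\<^bsub>cmod A p q\<^esub> y"
    using M.smult_l_minus[of "\<one>\<^bsub>R\<^esub>" y] M.smult_one[of y] y by (simp add: cycles_def)
  ultimately show ?thesis by (simp add: a_minus_def)
qed

text \<open>The third part is what the fibre product needs: it turns an equality of classes into an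
  explicit bounding element.\<close>

lemma cls_minus:
  assumes S: "spectral_sequence R S" and x: "x \<in> cycles m (page S m) p q" and y: "y \<in> cycles m (page S m) p q"
  shows "x \<ominus>\<^bsub>pmod S m p q\<^esub> y \<in> cycles m (page S m) p q"
    and "cls S m p q (x \<ominus>\<^bsub>pmod S m p q\<^esub> y) = cls S m p q x \<ominus>\<^bsub>pmod S (Suc m) p q\<^esub> cls S m p q y"
    and "cls S m p q x = cls S m p q y \<longleftrightarrow> x \<ominus>\<^bsub>pmod S m p q\<^esub> y \<in> boundaries m (page S m) p q"
proof -
  note P = spectral_sequence_page[OF S]
  interpret Q: quotient_module R "cycle_mod m (page S m) p q" "boundaries m (page S m) p q"
    by (rule homology_quotient[OF P])
  interpret N: module R "pmod S (Suc m) p q" by (rule spectral_sequence_module[OF S])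
  have e: "x \<ominus>\<^bsub>cycle_mod m (page S m) p q\<^esub> y = x \<ominus>\<^bsub>pmod S m p q\<^esub> y"
    by (rule cycle_mod_minus[OF P x y])
  show 1: "x \<ominus>\<^bsub>pmod S m p q\<^esub> y \<in> cycles m (page S m) p q"
    using Q.M.minus_closed[of x y] x y by (simp add: e)
  show 2: "cls S m p q (x \<ominus>\<^bsub>pmod S m p q\<^esub> y) = cls S m p q x \<ominus>\<^bsub>pmod S (Suc m) p q\<^esub> cls S m p q y"
    using mod_hom_minus[OF Q.module_axioms N.module_axioms spectral_sequence_cls(1)[OF S], of x y] x y
    by (simp add: e)
  show "cls S m p q x = cls S m p q y \<longleftrightarrow> x \<ominus>\<^bsub>pmod S m p q\<^esub> y \<in> boundaries m (page S m) p q"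
    using N.M.diff_eq_zero_iff[OF spectral_sequence_cls_closed[OF S x] spectral_sequence_cls_closed[OF S y]]
      spectral_sequence_cls(3)[OF S 1] 2 by simp
qed

lemma boundaries_cycles:
  assumes "bigraded_complex R m A" "x \<in> boundaries m A p q"
  shows "x \<in> cycles m A p q"
  using quotient_module.B_sub[OF homology_quotient[OF assms(1)]] assms(2) by auto

lemma morphism_minus:
  assumes f: "spse_morphism R f" and "x \<in> carrier (pmod (src f) m p q)" "y \<in> carrier (pmod (src f) m p q)"
  shows "fmap f m p q (x \<ominus>\<^bsub>pmod (src f) m p q\<^esub> y) = fmap f m p q x \<ominus>\<^bsub>pmod (tgt f) m p q\<^esub> fmap f m p q y"
  by (rule mod_hom_minus[OF spectral_sequence_module[OF spse_morphismD(1)[OF f]]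
        spectral_sequence_module[OF spse_morphismD(2)[OF f]] spse_morphismD(4)[OF f] assms(2,3)])

lemma spectral_sequence_cls_add:
  assumes "spectral_sequence R S" "x \<in> cycles m (page S m) p q" "y \<in> cycles m (page S m) p q"
  shows "cls S m p q (x \<oplus>\<^bsub>pmod S m p q\<^esub> y) = cls S m p q x \<oplus>\<^bsub>pmod S (Suc m) p q\<^esub> cls S m p q y"
  using mod_homD(2)[OF spectral_sequence_cls(1)[OF assms(1)], of x m p q y] assms(2,3) by simp

lemma spectral_sequence_cls_smult:
  assumes "spectral_sequence R S" "a \<in> carrier R" "x \<in> cycles m (page S m) p q"
  shows "cls S m p q (a \<odot>\<^bsub>pmod S m p q\<^esub> x) = a \<odot>\<^bsub>pmod S (Suc m) p q\<^esub> cls S m p q x"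
  using mod_homD(3)[OF spectral_sequence_cls(1)[OF assms(1)], of a x m p q] assms(2,3) by simp

section \<open>Coded pairs and fibre products of modules and complexes\<close>

text \<open>All modules on the pages have their elements in the one type \<open>'m\<close>, so pairs
  are coded inside it; the two decoders make \<open>enc\<close> injective.\<close>

locale pairing =
  fixes enc :: "'m \<Rightarrow> 'm \<Rightarrow> 'm" and dec1 dec2 :: "'m \<Rightarrow> 'm"
  assumes dec_enc [simp]: "dec1 (enc x y) = x" "dec2 (enc x y) = y"
begin

lemma enc_eq_iff [simp]: "enc x y = enc x' y' \<longleftrightarrow> x = x' \<and> y = y'"
  by (metis dec_enc)

text \<open>For maps into \<open>zero_mod\<close> the condition on pairs always holds and this is
  the direct sum; products of spectral sequences are obtained in this way.\<close>

definition fp_mod :: "('a, 'm) module \<Rightarrow> ('a, 'm) module \<Rightarrow> ('m \<Rightarrow> 'm) \<Rightarrow> ('m \<Rightarrow> 'm) \<Rightarrow> ('a, 'm) module" where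
  "fp_mod M N f g = \<lparr>
     carrier = {enc x y | x y. x \<in> carrier M \<and> y \<in> carrier N \<and> f x = g y},
     mult = undefined, one = undefined, zero = enc \<zero>\<^bsub>M\<^esub> \<zero>\<^bsub>N\<^esub>,
     add = (\<lambda>u v. enc (dec1 u \<oplus>\<^bsub>M\<^esub> dec1 v) (dec2 u \<oplus>\<^bsub>N\<^esub> dec2 v)),
     smult = (\<lambda>a u. enc (a \<odot>\<^bsub>M\<^esub> dec1 u) (a \<odot>\<^bsub>N\<^esub> dec2 u))\<rparr>"

lemma fp_mod_simps:
  "enc x y \<in> carrier (fp_mod M N f g) \<longleftrightarrow> x \<in> carrier M \<and> y \<in> carrier N \<and> f x = g y"
  "\<zero>\<^bsub>fp_mod M N f g\<^esub> = enc \<zero>\<^bsub>M\<^esub> \<zero>\<^bsub>N\<^esub>"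
  "enc x y \<oplus>\<^bsub>fp_mod M N f g\<^esub> enc x' y' = enc (x \<oplus>\<^bsub>M\<^esub> x') (y \<oplus>\<^bsub>N\<^esub> y')"
  "a \<odot>\<^bsub>fp_mod M N f g\<^esub> enc x y = enc (a \<odot>\<^bsub>M\<^esub> x) (a \<odot>\<^bsub>N\<^esub> y)"
  by (auto simp: fp_mod_def)

lemma fp_modE:
  assumes "u \<in> carrier (fp_mod M N f g)"
  obtains x y where "u = enc x y" "x \<in> carrier M" "y \<in> carrier N" "f x = g y"
  using assms by (auto simp: fp_mod_def)

lemma module_fp_mod:
  assumes M: "module R M" and N: "module R N" and L: "module R L"
    and f: "f \<in> mod_hom R M L" and g: "g \<in> mod_hom R N L"
  shows "module R (fp_mod M N f g)"
proof -
  interpret M: module R M by fact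
  interpret N: module R N by fact
  interpret L: module R L by fact
  note fD = mod_homD[OF f] mod_hom_zero[OF M L f] and gD = mod_homD[OF g] mod_hom_zero[OF N L g]
  show ?thesis
  proof (rule moduleI')
    fix u assume "u \<in> carrier (fp_mod M N f g)"
    then obtain x y where u: "u = enc x y" "x \<in> carrier M" "y \<in> carrier N" "f x = g y" by (rule fp_modE)
    have n: "\<ominus>\<^bsub>R\<^esub> \<one>\<^bsub>R\<^esub> \<in> carrier R" by simp
    show "\<exists>v \<in> carrier (fp_mod M N f g). v \<oplus>\<^bsub>fp_mod M N f g\<^esub> u = \<zero>\<^bsub>fp_mod M N f g\<^esub>"
      using u n
      by (intro bexI[of _ "enc ((\<ominus>\<^bsub>R\<^esub> \<one>\<^bsub>R\<^esub>) \<odot>\<^bsub>M\<^esub> x) ((\<ominus>\<^bsub>R\<^esub> \<one>\<^bsub>R\<^esub>) \<odot>\<^bsub>N\<^esub> y)"])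
        (simp_all only: fp_mod_simps fD gD enc_eq_iff M.smult_closed N.smult_closed,
          simp add: M.smult_l_minus N.smult_l_minus M.M.l_neg N.M.l_neg)
  qed (auto elim!: fp_modE simp: fp_mod_simps fD gD M.M.a_ac N.M.a_ac M.smult_l_distr N.smult_l_distr
      M.smult_r_distr N.smult_r_distr M.smult_assoc1 N.smult_assoc1 intro: M.is_cring)
qed

definition fp_complex ::
  "('a, 'm) bicomplex \<Rightarrow> ('a, 'm) bicomplex \<Rightarrow> (int \<Rightarrow> int \<Rightarrow> 'm \<Rightarrow> 'm) \<Rightarrow> (int \<Rightarrow> int \<Rightarrow> 'm \<Rightarrow> 'm)
    \<Rightarrow> ('a, 'm) bicomplex" where
  "fp_complex A B f g = \<lparr>cmod = (\<lambda>p q. fp_mod (cmod A p q) (cmod B p q) (f p q) (g p q)),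
     cdiff = (\<lambda>p q u. enc (cdiff A p q (dec1 u)) (cdiff B p q (dec2 u)))\<rparr>"

lemma fp_complex_simps [simp]:
  "cmod (fp_complex A B f g) p q = fp_mod (cmod A p q) (cmod B p q) (f p q) (g p q)"
  "cdiff (fp_complex A B f g) p q (enc x y) = enc (cdiff A p q x) (cdiff B p q y)"
  by (simp_all add: fp_complex_def)

text \<open>The componentwise differential respects the condition on pairs because \<open>f\<close>
  and \<open>g\<close> are chain maps. Surjectivity enters only when homology is computed.\<close>

lemma bigraded_complex_fp:
  assumes A: "bigraded_complex R m A" and B: "bigraded_complex R m B" and L: "bigraded_complex R m L"
    and f: "complex_mor R m A L f" and g: "complex_mor R m B L g"
  shows "bigraded_complex R m (fp_complex A B f g)"
  unfolding bigraded_complex_def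
proof (intro allI conjI ballI)
  fix p q
  note aD = mod_homD[OF bigraded_complexD(2)[OF A]] and bD = mod_homD[OF bigraded_complexD(2)[OF B]]
  show "module R (cmod (fp_complex A B f g) p q)"
    using module_fp_mod[OF bigraded_complexD(1)[OF A] bigraded_complexD(1)[OF B] bigraded_complexD(1)[OF L]
        complex_morD(1)[OF f] complex_morD(1)[OF g]] by simp
  show "cdiff (fp_complex A B f g) p q \<in> mod_hom R (cmod (fp_complex A B f g) p q)
      (cmod (fp_complex A B f g) (p - int m) (q + 1 - int m))"
    by (rule mod_homI)
      (auto elim!: fp_modE simp: fp_mod_simps aD bD complex_morD(2)[OF f] complex_morD(2)[OF g])
  show "cdiff (fp_complex A B f g) (p - int m) (q + 1 - int m) (cdiff (fp_complex A B f g) p q x) =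
      \<zero>\<^bsub>cmod (fp_complex A B f g) (p - 2 * int m) (q + 2 - 2 * int m)\<^esub>"
    if "x \<in> carrier (cmod (fp_complex A B f g) p q)" for x
    using that A B unfolding bigraded_complex_def
    by (auto elim!: fp_modE simp: fp_mod_simps)
qed

end

text \<open>To identify the homology of page \<open>m\<close> with page \<open>m + 1\<close>,
  classes are lifted using surjectivity of \<open>f\<close> on page \<open>m\<close>, and boundaries
  are treated using it on both pages. Hence \<open>onto\<close> ranges over all pages.\<close>

locale fibre_product = pairing enc dec1 dec2
  for enc :: "'m \<Rightarrow> 'm \<Rightarrow> 'm" and dec1 dec2 +
  fixes R :: "('a, 'b) ring_scheme" and f g :: "('a, 'm) spse_mor"
  assumes f: "spse_morphism R f" and g: "spse_morphism R g" and tgt_eq: "tgt g = tgt f"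
    and onto: "\<And>m p q. onto_at f m p q"
begin

abbreviation "X \<equiv> src f"
abbreviation "Z \<equiv> src g"
abbreviation "Y \<equiv> tgt f"

definition fp :: "('a, 'm) spse" where
  "fp = spse_of (\<lambda>m. fp_complex (page X m) (page Z m) (fmap f m) (fmap g m))
    (\<lambda>m p q u. enc (cls X m p q (dec1 u)) (cls Z m p q (dec2 u)))"

lemma page_fp [simp]: "page fp m = fp_complex (page X m) (page Z m) (fmap f m) (fmap g m)"
  by (simp add: fp_def)

lemmas ss = spse_morphismD(1)[OF f] spse_morphismD(1)[OF g] spse_morphismD(2)[OF f]

lemma onto_E:
  assumes "y \<in> carrier (pmod Y m p q)"
  obtains x where "x \<in> carrier (pmod X m p q)" "y = fmap f m p q x"
  using onto[of m p q] assms by blast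

lemma cycles_fp:
  "u \<in> cycles m (page fp m) p q \<longleftrightarrow> (\<exists>x z. u = enc x z \<and> x \<in> cycles m (page X m) p q \<and>
    z \<in> cycles m (page Z m) p q \<and> fmap f m p q x = fmap g m p q z)"
  by (auto simp: cycles_def fp_mod_simps elim!: fp_modE)

text \<open>Equal classes in \<open>Y\<close> mean that the defect \<open>f x - g z\<close> is a
  boundary \<open>dy\<close>. Lifting \<open>y\<close> to some \<open>v\<close> and replacing
  \<open>x\<close> by \<open>x - dv\<close> removes the defect without changing the class of
  \<open>x\<close>. This makes the class map of the fibre product onto.\<close>

lemma lift_class:
  assumes x: "x \<in> cycles m (page X m) p q" and z: "z \<in> cycles m (page Z m) p q"
    and e: "fmap f (Suc m) p q (cls X m p q x) = fmap g (Suc m) p q (cls Z m p q z)"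
  shows "\<exists>x' \<in> cycles m (page X m) p q. cls X m p q x' = cls X m p q x \<and> fmap f m p q x' = fmap g m p q z"
proof -
  interpret X: module R "pmod X m p q" by (rule spectral_sequence_module[OF ss(1)])
  interpret Y: module R "pmod Y m p q" by (rule spectral_sequence_module[OF ss(3)])
  have fx: "fmap f m p q x \<in> cycles m (page Y m) p q" and gz: "fmap g m p q z \<in> cycles m (page Y m) p q"
    using morphism_cycles[OF f x] morphism_cycles[OF g z] tgt_eq by simp_all
  have "cls Y m p q (fmap f m p q x) = cls Y m p q (fmap g m p q z)"
    using e spse_morphismD(6)[OF f x] spse_morphismD(6)[OF g z] tgt_eq by simp
  then have "fmap f m p q x \<ominus>\<^bsub>pmod Y m p q\<^esub> fmap g m p q z \<in> boundaries m (page Y m) p q"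
    using cls_minus(3)[OF ss(3) fx gz] by simp
  then obtain y where y: "y \<in> carrier (pmod Y m (p + int m) (q - 1 + int m))"
    "fmap f m p q x \<ominus>\<^bsub>pmod Y m p q\<^esub> fmap g m p q z = pdiff Y m (p + int m) (q - 1 + int m) y"
    by (auto simp: boundaries_def)
  obtain v where v: "v \<in> carrier (pmod X m (p + int m) (q - 1 + int m))"
    "y = fmap f m (p + int m) (q - 1 + int m) v"
    using y(1) by (rule onto_E)
  let ?d = "pdiff X m (p + int m) (q - 1 + int m) v"
  have db: "?d \<in> boundaries m (page X m) p q" using v by (auto simp: boundaries_def)
  then have dc: "?d \<in> cycles m (page X m) p q"
    by (rule boundaries_cycles[OF spectral_sequence_page[OF ss(1)]])
  have fd: "fmap f m p q ?d = fmap f m p q x \<ominus>\<^bsub>pmod Y m p q\<^esub> fmap g m p q z"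
    using complex_morD(3)[OF spse_morphismD(3)[OF f] v(1)] v y by simp
  note car = cycles_carrier[OF x] cycles_carrier[OF dc] cycles_carrier[OF fx] cycles_carrier[OF gz]
  \<comment> \<open>\<open>?d\<close> is a boundary of \<open>X\<close> whose image is exactly the
    defect.\<close>
  let ?x = "x \<ominus>\<^bsub>pmod X m p q\<^esub> ?d"
  have xc: "?x \<in> cycles m (page X m) p q" by (rule cls_minus(1)[OF ss(1) x dc])
  moreover have "cls X m p q ?x = cls X m p q x"
  proof -
    interpret N: module R "pmod X (Suc m) p q" by (rule spectral_sequence_module[OF ss(1)])
    have "cls X m p q ?d = \<zero>\<^bsub>pmod X (Suc m) p q\<^esub>"
      using spectral_sequence_cls(3)[OF ss(1) dc] db by simp
    then show ?thesis
      using cls_minus(2)[OF ss(1) x dc] spectral_sequence_cls_closed[OF ss(1) x]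
      by (simp add: N.M.diff_zero)
  qed
  moreover have "fmap f m p q ?x = fmap g m p q z"
    using morphism_minus[OF f car(1,2)] fd car(3,4)
    by (simp add: Y.M.diff_diff_cancel)
  ultimately show ?thesis by blast
qed

text \<open>A pair of boundaries in the fibre product is the boundary of a pair: the two preimages are made
  compatible with a cycle of \<open>X\<close> (surjectivity on the next page) and a boundary (surjectivity on
  this page).\<close>

lemma boundaries_fp:
  assumes x: "x \<in> boundaries m (page X m) p q" and z: "z \<in> boundaries m (page Z m) p q"
    and e: "fmap f m p q x = fmap g m p q z"
  shows "enc x z \<in> boundaries m (page fp m) p q"
proof -
  let ?p = "p + int m" and ?q = "q - 1 + int m"
  have idx: "?p - int m = p" "?q + 1 - int m = q" by simp_all
  interpret X: module R "pmod X m ?p ?q" by (rule spectral_sequence_module[OF ss(1)])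
  interpret X0: module R "pmod X m p q" by (rule spectral_sequence_module[OF ss(1)])
  interpret Y: module R "pmod Y m ?p ?q" by (rule spectral_sequence_module[OF ss(3)])
  interpret Y0: module R "pmod Y m p q" by (rule spectral_sequence_module[OF ss(3)])
  obtain v where v: "v \<in> carrier (pmod X m ?p ?q)" "x = pdiff X m ?p ?q v" using x by (auto simp: boundaries_def)
  obtain w where w: "w \<in> carrier (pmod Z m ?p ?q)" "z = pdiff Z m ?p ?q w" using z by (auto simp: boundaries_def)
  have fv: "fmap f m ?p ?q v \<in> carrier (pmod Y m ?p ?q)" and gw: "fmap g m ?p ?q w \<in> carrier (pmod Y m ?p ?q)"
    using morphism_closed[OF f v(1)] morphism_closed[OF g w(1)] tgt_eq by simp_all
  \<comment> \<open>The incompatibility of the two preimages; it is a cycle because its boundary is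
    \<open>f x - g z\<close>, which is zero.\<close>
  let ?u = "fmap f m ?p ?q v \<ominus>\<^bsub>pmod Y m ?p ?q\<^esub> fmap g m ?p ?q w"
  have dfv: "pdiff Y m ?p ?q (fmap f m ?p ?q v) = fmap f m p q x"
    using complex_morD(3)[OF spse_morphismD(3)[OF f] v(1)] v(2) by simp
  have dgw: "pdiff Y m ?p ?q (fmap g m ?p ?q w) = fmap g m p q z"
    using complex_morD(3)[OF spse_morphismD(3)[OF g] w(1)] w(2) tgt_eq by simp
  have xX: "x \<in> carrier (pmod X m p q)"
    by (rule cycles_carrier[OF boundaries_cycles[OF spectral_sequence_page[OF ss(1)] x]])
  have "pdiff Y m ?p ?q ?u = fmap f m p q x \<ominus>\<^bsub>pmod Y m p q\<^esub> fmap g m p q z"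
    using mod_hom_minus[OF Y.module_axioms Y0.module_axioms spectral_sequence_diff_hom'[OF ss(3)] fv gw]
      dfv dgw by simp
  then have "?u \<in> cycles m (page Y m) ?p ?q"
    using Y.M.minus_closed[OF fv gw] Y0.M.r_neg[OF morphism_closed[OF f xX]] unfolding cycles_def idx e[symmetric]
    by (simp add: Y0.M.minus_eq)
  note uc = this
  obtain a where a: "a \<in> carrier (pmod X (Suc m) ?p ?q)" "cls Y m ?p ?q ?u = fmap f (Suc m) ?p ?q a"
    using onto_E[OF spectral_sequence_cls_closed[OF ss(3) uc]] by metis
  obtain c where c: "c \<in> cycles m (page X m) ?p ?q" "a = cls X m ?p ?q c"
    using a(1) spectral_sequence_cls(2)[OF ss(1), of m ?p ?q] by blast
  have fc: "fmap f m ?p ?q c \<in> cycles m (page Y m) ?p ?q" by (rule morphism_cycles[OF f c(1)])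
  have "cls Y m ?p ?q ?u = cls Y m ?p ?q (fmap f m ?p ?q c)"
    using spse_morphismD(6)[OF f c(1)] a c by simp
  then have "?u \<ominus>\<^bsub>pmod Y m ?p ?q\<^esub> fmap f m ?p ?q c \<in> boundaries m (page Y m) ?p ?q"
    using cls_minus(3)[OF ss(3) uc fc] by simp
  then obtain y where y: "y \<in> carrier (pmod Y m (?p + int m) (?q - 1 + int m))"
    "?u \<ominus>\<^bsub>pmod Y m ?p ?q\<^esub> fmap f m ?p ?q c = pdiff Y m (?p + int m) (?q - 1 + int m) y"
    unfolding boundaries_def by blast
  obtain t where t: "t \<in> carrier (pmod X m (?p + int m) (?q - 1 + int m))"
    "y = fmap f m (?p + int m) (?q - 1 + int m) t"
    using y(1) by (rule onto_E)
  let ?d = "pdiff X m (?p + int m) (?q - 1 + int m) t"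
  have db: "?d \<in> boundaries m (page X m) ?p ?q" unfolding boundaries_def using t(1) by blast
  have dc: "?d \<in> cycles m (page X m) ?p ?q"
    by (rule boundaries_cycles[OF spectral_sequence_page[OF ss(1)] db])
  have fd: "fmap f m ?p ?q ?d = ?u \<ominus>\<^bsub>pmod Y m ?p ?q\<^esub> fmap f m ?p ?q c"
    using complex_morD(3)[OF spse_morphismD(3)[OF f] t(1)] t(2) y(2) by simp
  \<comment> \<open>\<open>c\<close> lifts the class of \<open>?u\<close> only up to a boundary;
    \<open>?d\<close> lifts that boundary, so \<open>?c\<close> is a cycle mapped exactly to
    \<open>?u\<close>.\<close>
  let ?c = "c \<oplus>\<^bsub>pmod X m ?p ?q\<^esub> ?d"
  note car = cycles_carrier[OF c(1)] cycles_carrier[OF dc] cycles_carrier[OF fc] cycles_carrier[OF uc]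
  have cc: "?c \<in> carrier (pmod X m ?p ?q)" using car by simp
  have fcc: "fmap f m ?p ?q ?c = ?u"
    using morphism_add[OF f car(1,2)] fd car(3,4)
    by (simp add: Y.M.add_diff_cancel)
  have dcc: "pdiff X m ?p ?q ?c = \<zero>\<^bsub>pmod X m p q\<^esub>"
    using mod_homD(2)[OF spectral_sequence_diff_hom'[OF ss(1)] car(1,2)] c(1) dc
    unfolding cycles_def idx by simp
  \<comment> \<open>Subtracting a cycle keeps the boundary equal to \<open>x\<close>, and the image
    of \<open>?v\<close> becomes that of \<open>w\<close>.\<close>
  let ?v = "v \<ominus>\<^bsub>pmod X m ?p ?q\<^esub> ?c"
  have vc: "?v \<in> carrier (pmod X m ?p ?q)" using v(1) cc by simp
  have dv: "pdiff X m ?p ?q ?v = x"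
    using mod_hom_minus[OF X.module_axioms X0.module_axioms spectral_sequence_diff_hom'[OF ss(1)] v(1) cc]
      dcc v(2) xX by (simp add: X0.M.diff_zero)
  have "fmap f m ?p ?q ?v = fmap g m ?p ?q w"
    using morphism_minus[OF f v(1) cc] fcc fv gw
    by (simp add: Y.M.diff_diff_cancel)
  then have "enc ?v w \<in> carrier (pmod fp m ?p ?q)"
    using vc w(1) by (simp add: fp_mod_simps)
  moreover have "enc x z = pdiff fp m ?p ?q (enc ?v w)"
    using dv w(2) by simp
  ultimately show ?thesis unfolding boundaries_def by blast
qed

text \<open>Of the conditions in \<open>spse_of\<close>, surjectivity comes from
  \<open>lift_class\<close> and the kernel from \<open>boundaries_fp\<close>; the others hold
  componentwise.\<close>

lemma fp: shows spectral_sequence_fp: "spectral_sequence R fp"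
    and cls_fp: "enc x z \<in> cycles m (page fp m) p q \<Longrightarrow>
      cls fp m p q (enc x z) = enc (cls X m p q x) (cls Z m p q z)"
proof -
  let ?C = "\<lambda>m. fp_complex (page X m) (page Z m) (fmap f m) (fmap g m)"
  let ?c = "\<lambda>m p q u. enc (cls X m p q (dec1 u)) (cls Z m p q (dec2 u))"
  have 1: "bigraded_complex R m (?C m)" for m
    by (rule bigraded_complex_fp[OF spectral_sequence_page[OF ss(1)] spectral_sequence_page[OF ss(2)]
          spectral_sequence_page[OF ss(3)] spse_morphismD(3)[OF f]
          spse_morphismD(3)[OF g, unfolded tgt_eq]])
  have cyc: "x \<in> cycles m (page X m) p q" "z \<in> cycles m (page Z m) p q" "fmap f m p q x = fmap g m p q z"
    if "enc x z \<in> cycles m (?C m) p q" for x z m p q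
    using that cycles_fp[of "enc x z" m p q] by auto
  have dest: "\<exists>x z. u = enc x z" if "u \<in> cycles m (?C m) p q" for u m p q
    using that cycles_fp[of u m p q] by auto
  have 2: "?c m p q \<in> mod_hom R (cycle_mod m (?C m) p q) (cmod (?C (Suc m)) p q)" for m p q
  proof (rule mod_homI)
    fix u assume "u \<in> carrier (cycle_mod m (?C m) p q)"
    then obtain x z where u: "u = enc x z" "enc x z \<in> cycles m (?C m) p q" using dest by fastforce
    note xz = cyc[OF u(2)]
    have "fmap f (Suc m) p q (cls X m p q x) = fmap g (Suc m) p q (cls Z m p q z)"
      using spse_morphismD(6)[OF f xz(1)] spse_morphismD(6)[OF g xz(2)] xz(3) tgt_eq by simp
    then show "?c m p q u \<in> carrier (cmod (?C (Suc m)) p q)"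
      using u spectral_sequence_cls_closed[OF ss(1) xz(1)] spectral_sequence_cls_closed[OF ss(2) xz(2)]
      by (simp add: fp_mod_simps)
    show "?c m p q (a \<odot>\<^bsub>cycle_mod m (?C m) p q\<^esub> u) = a \<odot>\<^bsub>cmod (?C (Suc m)) p q\<^esub> ?c m p q u"
      if "a \<in> carrier R" for a
      using that u xz by (simp add: fp_mod_simps spectral_sequence_cls_smult[OF ss(1)] spectral_sequence_cls_smult[OF ss(2)])
    fix u' assume "u' \<in> carrier (cycle_mod m (?C m) p q)"
    then obtain x' z' where u': "u' = enc x' z'" "enc x' z' \<in> cycles m (?C m) p q" using dest by fastforce
    note xz' = cyc[OF u'(2)]
    show "?c m p q (u \<oplus>\<^bsub>cycle_mod m (?C m) p q\<^esub> u') = ?c m p q u \<oplus>\<^bsub>cmod (?C (Suc m)) p q\<^esub> ?c m p q u'"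
      using u u' xz xz' by (simp add: fp_mod_simps spectral_sequence_cls_add[OF ss(1)] spectral_sequence_cls_add[OF ss(2)])
  qed
  have 3: "\<exists>u \<in> cycles m (?C m) p q. w = ?c m p q u" if "w \<in> carrier (cmod (?C (Suc m)) p q)" for w m p q
  proof -
    from that obtain a b where ab: "w = enc a b" "a \<in> carrier (pmod X (Suc m) p q)"
      "b \<in> carrier (pmod Z (Suc m) p q)" "fmap f (Suc m) p q a = fmap g (Suc m) p q b"
      by (auto elim!: fp_modE)
    obtain x where x: "x \<in> cycles m (page X m) p q" "a = cls X m p q x"
      using ab(2) spectral_sequence_cls(2)[OF ss(1), of m p q] by blast
    obtain z where z: "z \<in> cycles m (page Z m) p q" "b = cls Z m p q z"
      using ab(3) spectral_sequence_cls(2)[OF ss(2), of m p q] by blast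
    obtain x' where x': "x' \<in> cycles m (page X m) p q" "cls X m p q x' = a" "fmap f m p q x' = fmap g m p q z"
      using lift_class[OF x(1) z(1)] ab(4) x z by auto
    then have "enc x' z \<in> cycles m (page fp m) p q" using cycles_fp z by blast
    then show ?thesis using ab(1) x' z by (intro bexI[of _ "enc x' z"]) simp_all
  qed
  have 4: "u \<in> boundaries m (?C m) p q"
    if u: "u \<in> cycles m (?C m) p q" "?c m p q u = \<zero>\<^bsub>cmod (?C (Suc m)) p q\<^esub>" for m p q u
  proof -
    obtain x z where e: "u = enc x z" using dest[OF u(1)] by blast
    note xz = cyc[OF u(1)[unfolded e]]
    have "x \<in> boundaries m (page X m) p q" "z \<in> boundaries m (page Z m) p q"
      using u(2) e spectral_sequence_cls(3)[OF ss(1) xz(1)] spectral_sequence_cls(3)[OF ss(2) xz(2)]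
      by (simp_all add: fp_mod_simps)
    then show ?thesis using boundaries_fp[OF _ _ xz(3)] e by simp
  qed
  have 5: "?c m p q u = \<zero>\<^bsub>cmod (?C (Suc m)) p q\<^esub>" if "u \<in> boundaries m (?C m) p q" for m p q u
  proof -
    from that obtain x z where w: "x \<in> carrier (pmod X m (p + int m) (q - 1 + int m))"
      "z \<in> carrier (pmod Z m (p + int m) (q - 1 + int m))"
      "u = enc (pdiff X m (p + int m) (q - 1 + int m) x) (pdiff Z m (p + int m) (q - 1 + int m) z)"
      by (auto simp: boundaries_def elim!: fp_modE)
    then have b: "dec1 u \<in> boundaries m (page X m) p q" "dec2 u \<in> boundaries m (page Z m) p q"
      by (auto simp: boundaries_def)
    note c = boundaries_cycles[OF spectral_sequence_page[OF ss(1)] b(1)]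
      boundaries_cycles[OF spectral_sequence_page[OF ss(2)] b(2)]
    show ?thesis
      using spectral_sequence_cls(3)[OF ss(1) c(1)] spectral_sequence_cls(3)[OF ss(2) c(2)] b
      by (simp add: fp_mod_simps)
  qed
  show "spectral_sequence R fp"
    unfolding fp_def by (rule spse_of(1)[OF 1 2 3 4 5])
  show "cls fp m p q (enc x z) = enc (cls X m p q x) (cls Z m p q z)"
    if "enc x z \<in> cycles m (page fp m) p q"
    using spse_of(2)[OF 1 2 3 4 5, of "enc x z" m p q] that
    by (simp add: fp_def)
qed

end

section \<open>Projections and universal property of the fibre product\<close>

context fibre_product
begin

lemma fp_E:
  assumes "u \<in> carrier (pmod fp m p q)"
  obtains x z where "u = enc x z" "x \<in> carrier (pmod X m p q)" "z \<in> carrier (pmod Z m p q)"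
    "fmap f m p q x = fmap g m p q z"
  using assms by (auto elim: fp_modE)

definition pr1 :: "('a, 'm) spse_mor" where
  "pr1 = mor_of fp X (\<lambda>m p q. dec1)"

definition pr2 :: "('a, 'm) spse_mor" where
  "pr2 = mor_of fp Z (\<lambda>m p q. dec2)"

lemma pr_simps [simp]: "src pr1 = fp" "tgt pr1 = X" "src pr2 = fp" "tgt pr2 = Z"
    "u \<in> carrier (pmod fp m p q) \<Longrightarrow> fmap pr1 m p q u = dec1 u"
    "u \<in> carrier (pmod fp m p q) \<Longrightarrow> fmap pr2 m p q u = dec2 u"
  unfolding pr1_def pr2_def by (rule mor_of_simps; assumption)+

lemma morphism_pr1: "spse_morphism R pr1"
  unfolding pr1_def
proof (rule mor_of_morphism[OF spectral_sequence_fp ss(1)])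
  show "dec1 \<in> mod_hom R (pmod fp m p q) (pmod X m p q)" for m p q
    by (rule mod_homI) (auto elim!: fp_modE simp: fp_mod_simps)
  show "dec1 (pdiff fp m p q u) = pdiff X m p q (dec1 u)" if "u \<in> carrier (pmod fp m p q)" for m p q u
    using that by (auto elim!: fp_modE simp: fp_mod_simps)
  show "dec1 (cls fp m p q u) = cls X m p q (dec1 u)" if "u \<in> cycles m (page fp m) p q" for m p q u
  proof -
    from that obtain x z where "u = enc x z" using cycles_fp by blast
    then show ?thesis using cls_fp that by simp
  qed
qed

lemma morphism_pr2: "spse_morphism R pr2"
  unfolding pr2_def
proof (rule mor_of_morphism[OF spectral_sequence_fp ss(2)])
  show "dec2 \<in> mod_hom R (pmod fp m p q) (pmod Z m p q)" for m p q
    by (rule mod_homI) (auto elim!: fp_modE simp: fp_mod_simps)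
  show "dec2 (pdiff fp m p q u) = pdiff Z m p q (dec2 u)" if "u \<in> carrier (pmod fp m p q)" for m p q u
    using that by (auto elim!: fp_modE simp: fp_mod_simps)
  show "dec2 (cls fp m p q u) = cls Z m p q (dec2 u)" if "u \<in> cycles m (page fp m) p q" for m p q u
  proof -
    from that obtain x z where "u = enc x z" using cycles_fp by blast
    then show ?thesis using cls_fp that by simp
  qed
qed

definition pair :: "('a, 'm) spse_mor \<Rightarrow> ('a, 'm) spse_mor \<Rightarrow> ('a, 'm) spse_mor" where
  "pair a b = mor_of (src a) fp (\<lambda>m p q t. enc (fmap a m p q t) (fmap b m p q t))"

lemma pair_simps [simp]: "src (pair a b) = src a" "tgt (pair a b) = fp"
    "t \<in> carrier (pmod (src a) m p q) \<Longrightarrow> fmap (pair a b) m p q t = enc (fmap a m p q t) (fmap b m p q t)"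
  unfolding pair_def by (rule mor_of_simps; assumption)+

lemma morphism_pair:
  assumes a: "spse_morphism R a" "tgt a = X" and b: "spse_morphism R b" "tgt b = Z" and e: "src b = src a"
    and ab: "\<And>m p q t. t \<in> carrier (pmod (src a) m p q) \<Longrightarrow>
      fmap f m p q (fmap a m p q t) = fmap g m p q (fmap b m p q t)"
  shows "spse_morphism R (pair a b)"
  unfolding pair_def
proof (rule mor_of_morphism[OF spse_morphismD(1)[OF a(1)] spectral_sequence_fp])
  note A = morphism_closed[OF a(1)] morphism_add[OF a(1)] morphism_smult[OF a(1)] morphism_diff[OF a(1)]
    spse_morphismD(6)[OF a(1)] morphism_cycles[OF a(1)]
  note A = A[unfolded a(2)]
  note B = morphism_closed[OF b(1)] morphism_add[OF b(1)] morphism_smult[OF b(1)] morphism_diff[OF b(1)]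
    spse_morphismD(6)[OF b(1)] morphism_cycles[OF b(1)]
  note B = B[unfolded b(2) e]
  show "(\<lambda>t. enc (fmap a m p q t) (fmap b m p q t)) \<in> mod_hom R (pmod (src a) m p q) (pmod fp m p q)" for m p q
    by (rule mod_homI) (simp_all add: fp_mod_simps A(1-3) B(1-3) ab)
  show "enc (fmap a m (p - int m) (q + 1 - int m) (pdiff (src a) m p q t))
      (fmap b m (p - int m) (q + 1 - int m) (pdiff (src a) m p q t)) =
      pdiff fp m p q (enc (fmap a m p q t) (fmap b m p q t))" if "t \<in> carrier (pmod (src a) m p q)" for m p q t
    using that by (simp add: A(4) B(4))
  show "enc (fmap a (Suc m) p q (cls (src a) m p q t)) (fmap b (Suc m) p q (cls (src a) m p q t)) =
      cls fp m p q (enc (fmap a m p q t) (fmap b m p q t))"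
    if t: "t \<in> cycles m (page (src a) m) p q" for m p q t
  proof -
    have "enc (fmap a m p q t) (fmap b m p q t) \<in> cycles m (page fp m) p q"
      using A(6)[OF t] B(6)[OF t] ab[OF cycles_carrier[OF t]] cycles_fp by blast
    then show ?thesis using t by (simp add: cls_fp A(5) B(5))
  qed
qed

text \<open>A code is determined by its two entries, which gives uniqueness. The square is assumed
  to commute elementwise, a form that serves both pullbacks and, over the zero object,
  products.\<close>

lemma pair_universal:
  assumes a: "spse_morphism R a" "tgt a = X" and b: "spse_morphism R b" "tgt b = Z" and e: "src b = src a"
    and ab: "\<And>m p q t. t \<in> carrier (pmod (src a) m p q) \<Longrightarrow>
      fmap f m p q (fmap a m p q t) = fmap g m p q (fmap b m p q t)"
  shows "\<exists>!h. h \<in> Hom (SpSe R) (src a) fp \<and> Comp (SpSe R) pr1 h = a \<and> Comp (SpSe R) pr2 h = b"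
proof (rule ex1I)
  have c: "enc (fmap a m p q t) (fmap b m p q t) \<in> carrier (pmod fp m p q)"
    if "t \<in> carrier (pmod (src a) m p q)" for t m p q
    using morphism_closed[OF morphism_pair[OF assms], of t m p q] that by simp
  show "pair a b \<in> Hom (SpSe R) (src a) fp \<and> Comp (SpSe R) pr1 (pair a b) = a \<and> Comp (SpSe R) pr2 (pair a b) = b"
  proof (intro conjI)
    show "pair a b \<in> Hom (SpSe R) (src a) fp"
      using morphism_pair[OF assms] by (simp add: Hom_SpSe)
    show "Comp (SpSe R) pr1 (pair a b) = a"
      unfolding SpSe_simps by (rule spse_mor_of_eqI[OF a(1)]) (use a c in \<open>simp_all del: page_fp\<close>)
    show "Comp (SpSe R) pr2 (pair a b) = b"
      unfolding SpSe_simps by (rule spse_mor_of_eqI[OF b(1)]) (use b c e in \<open>simp_all del: page_fp\<close>)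
  qed
  fix h assume h: "h \<in> Hom (SpSe R) (src a) fp \<and> Comp (SpSe R) pr1 h = a \<and> Comp (SpSe R) pr2 h = b"
  then have hm: "spse_morphism R h" "src h = src a" "tgt h = fp" by (auto simp: Hom_SpSe)
  have "enc (fmap a m p q t) (fmap b m p q t) = fmap h m p q t" if t: "t \<in> carrier (pmod (src a) m p q)" for m p q t
  proof -
    have ht: "fmap h m p q t \<in> carrier (pmod fp m p q)"
      using morphism_closed[OF hm(1), of t m p q] t hm by (simp del: page_fp)
    have "fmap a m p q t = dec1 (fmap h m p q t)" "fmap b m p q t = dec2 (fmap h m p q t)"
      using arg_cong[OF conjunct1[OF conjunct2[OF h]], of "\<lambda>k. fmap k m p q t"]
        arg_cong[OF conjunct2[OF conjunct2[OF h]], of "\<lambda>k. fmap k m p q t"] t ht hm(2)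
      by (simp_all add: SpSe_simps del: page_fp)
    then show ?thesis using ht by (auto elim!: fp_E simp del: page_fp)
  qed
  then show "h = pair a b"
    unfolding pair_def by (intro spse_mor_of_eqI[OF hm(1), symmetric]) (use hm in auto)
qed

lemma is_pullback_fp: "is_pullback (SpSe R) f g pr2 pr1"
  unfolding is_pullback_def
proof (intro conjI allI impI)
  show "f \<in> Arr (SpSe R)" "g \<in> Arr (SpSe R)" "Cod (SpSe R) f = Cod (SpSe R) g"
    using f g tgt_eq by (simp_all add: SpSe_simps)
  show "pr2 \<in> Hom (SpSe R) (Dom (SpSe R) pr2) (Dom (SpSe R) g)" "pr1 \<in> Hom (SpSe R) (Dom (SpSe R) pr2) (Dom (SpSe R) f)"
    using morphism_pr1 morphism_pr2 by (simp_all add: Hom_SpSe SpSe_simps(2-4))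
  show "Comp (SpSe R) f pr1 = Comp (SpSe R) g pr2"
    unfolding SpSe_simps pr_simps tgt_eq by (rule mor_of_cong) (auto elim!: fp_E simp del: page_fp)
  fix T a b
  assume "a \<in> Hom (SpSe R) T (Dom (SpSe R) g) \<and> b \<in> Hom (SpSe R) T (Dom (SpSe R) f) \<and>
    Comp (SpSe R) f b = Comp (SpSe R) g a"
  then have a: "spse_morphism R a" "src a = T" "tgt a = Z" and b: "spse_morphism R b" "src b = T" "tgt b = X"
    and ab: "Comp (SpSe R) f b = Comp (SpSe R) g a"
    by (auto simp: Hom_SpSe SpSe_simps(2-4))
  have "fmap f m p q (fmap b m p q t) = fmap g m p q (fmap a m p q t)"
    if "t \<in> carrier (pmod (src b) m p q)" for m p q t
    using arg_cong[OF ab, of "\<lambda>k. fmap k m p q t"] that a b by (simp add: SpSe_simps)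
  from pair_universal[OF b(1,3) a(1,3) _ this] a b
  show "\<exists>!h. h \<in> Hom (SpSe R) T (Dom (SpSe R) pr2) \<and> Comp (SpSe R) pr2 h = a \<and> Comp (SpSe R) pr1 h = b"
    by (simp add: SpSe_simps(2-4) conj_commute)
qed

text \<open>An element \<open>z\<close> is completed to a compatible pair by lifting
  \<open>g z\<close> through \<open>f\<close>.\<close>

lemma onto_pr2: "onto_at pr2 m p q"
proof -
  have "z \<in> fmap pr2 m p q ` carrier (pmod fp m p q)" if z: "z \<in> carrier (pmod Z m p q)" for z
  proof -
    have "fmap g m p q z \<in> carrier (pmod Y m p q)" using morphism_closed[OF g z] tgt_eq by simp
    then obtain x where x: "x \<in> carrier (pmod X m p q)" "fmap g m p q z = fmap f m p q x" by (rule onto_E)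
    then have "enc x z \<in> carrier (pmod fp m p q)" using z by (simp add: fp_mod_simps)
    then show ?thesis by (intro image_eqI[of _ _ "enc x z"]) (simp_all del: page_fp)
  qed
  then show ?thesis
    using morphism_closed[OF morphism_pr2, of _ m p q] by (auto simp del: page_fp)
qed

text \<open>On page \<open>Suc r\<close> the map \<open>f\<close> is injective, so the second entry
  of a compatible pair determines the first; with \<open>onto_pr2\<close> this makes the projection
  bijective there.\<close>

lemma acyclic_fibration_pr2:
  assumes "f \<in> E_quasi_isos R r"
  shows "pr2 \<in> E_quasi_isos R r \<inter> r_fibrations R r"
proof -
  have "inj_on (fmap pr2 (Suc r) p q) (carrier (pmod fp (Suc r) p q))" for p q
  proof (rule inj_onI)
    fix u v assume u: "u \<in> carrier (pmod fp (Suc r) p q)" and v: "v \<in> carrier (pmod fp (Suc r) p q)"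
      and e: "fmap pr2 (Suc r) p q u = fmap pr2 (Suc r) p q v"
    have "inj_on (fmap f (Suc r) p q) (carrier (pmod X (Suc r) p q))"
      using assms by (simp add: E_quasi_isos_iff bij_betw_def)
    moreover obtain x z where "u = enc x z" "x \<in> carrier (pmod X (Suc r) p q)"
      "fmap f (Suc r) p q x = fmap g (Suc r) p q z" using u by (rule fp_E)
    moreover obtain x' z' where "v = enc x' z'" "x' \<in> carrier (pmod X (Suc r) p q)"
      "fmap f (Suc r) p q x' = fmap g (Suc r) p q z'" using v by (rule fp_E)
    ultimately show "u = v" using e u v by (auto simp: inj_on_def simp del: page_fp)
  qed
  then show ?thesis
    using morphism_pr2 onto_pr2 by (simp add: E_quasi_isos_iff r_fibrations_iff bij_betw_def del: page_fp)
qed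

end

section \<open>Pullbacks of acyclic fibrations and finite products\<close>

locale spse_pairing = pairing enc dec1 dec2
  for enc :: "'m \<Rightarrow> 'm \<Rightarrow> 'm" and dec1 dec2 +
  fixes R :: "('a, 'b) ring_scheme"
  assumes R: "cring R"
begin

lemma acyclic_fibrations_pullback_closed:
  "pullback_closed (SpSe R :: (('a, 'm) spse, ('a, 'm) spse_mor) cat) (E_quasi_isos R r \<inter> r_fibrations R r)"
proof (rule category.pullback_closedI[OF category_SpSe])
  show "isos (SpSe R) \<subseteq> E_quasi_isos R r \<inter> r_fibrations R r"
    by (rule isos_SpSe_acyclic_fibration)
  fix f g :: "('a, 'm) spse_mor"
  assume fA: "f \<in> E_quasi_isos R r \<inter> r_fibrations R r"
  then have fm: "spse_morphism R f" by (simp add: r_fibrations_iff)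
  show "Comp (SpSe R) g f \<in> E_quasi_isos R r \<inter> r_fibrations R r"
    if "g \<in> E_quasi_isos R r \<inter> r_fibrations R r" "Cod (SpSe R) f = Dom (SpSe R) g"
    using that fA fm r_fibrations_Comp[of f R r g] E_quasi_isos_two_out_of_three[of R r]
    unfolding two_out_of_three_def by (auto simp: r_fibrations_iff[of g] SpSe_simps(2))
  assume "g \<in> Arr (SpSe R)" "Cod (SpSe R) f = Cod (SpSe R) g"
  then interpret fibre_product enc dec1 dec2 R f g
    by unfold_locales (use fm acyclic_fibration_onto[OF fA] in \<open>auto simp: SpSe_simps\<close>)
  show "\<exists>p' g'. is_pullback (SpSe R) f g p' g' \<and> p' \<in> E_quasi_isos R r \<inter> r_fibrations R r"
    using is_pullback_fp acyclic_fibration_pr2[of r] fA by blast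
qed

text \<open>Products are fibre products over the final object; the map to it is onto because the
  carrier of a module contains zero.\<close>

lemma fibre_product_to_zero:
  fixes S T :: "('a, 'm) spse"
  assumes "spectral_sequence R S" "spectral_sequence R T"
  shows "fibre_product enc dec1 dec2 R (to_zero S) (to_zero T)"
proof
  show "onto_at (to_zero S) m p q" for m p q
  proof -
    interpret M: module R "pmod S m p q" by (rule spectral_sequence_module[OF assms(1)])
    show ?thesis using M.M.zero_closed by (auto simp: image_iff)
  qed
qed (use zero_morphism[OF assms(1) zero_spse[OF R]] zero_morphism[OF assms(2) zero_spse[OF R]] in simp_all)

definition prod_spse :: "('a, 'm) spse \<Rightarrow> ('a, 'm) spse \<Rightarrow> ('a, 'm) spse" where
  "prod_spse S T = fibre_product.fp enc dec1 dec2 (to_zero S) (to_zero T)"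

lemma prod_spse_product:
  fixes S T :: "('a, 'm) spse"
  assumes S: "spectral_sequence R S" and T: "spectral_sequence R T"
  shows "\<exists>P a b. a \<in> Hom (SpSe R) P S \<and> b \<in> Hom (SpSe R) P T \<and>
      (\<forall>Z f g. f \<in> Hom (SpSe R) Z S \<longrightarrow> g \<in> Hom (SpSe R) Z T \<longrightarrow>
        (\<exists>!h. h \<in> Hom (SpSe R) Z P \<and> Comp (SpSe R) a h = f \<and> Comp (SpSe R) b h = g))"
proof -
  interpret P: fibre_product enc dec1 dec2 R "to_zero S" "to_zero T"
    by (rule fibre_product_to_zero[OF S T])
  show ?thesis
  proof (intro exI conjI allI impI)
    show "P.pr1 \<in> Hom (SpSe R) P.fp S" "P.pr2 \<in> Hom (SpSe R) P.fp T"
      using P.morphism_pr1 P.morphism_pr2 by (simp_all add: Hom_SpSe)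
    fix Z f g assume "f \<in> Hom (SpSe R) Z S" "g \<in> Hom (SpSe R) Z T"
    then have fg: "spse_morphism R f" "tgt f = src (to_zero S)" "spse_morphism R g" "tgt g = src (to_zero T)"
      "src g = src f" "src f = Z"
      by (auto simp: Hom_SpSe)
    show "\<exists>!h. h \<in> Hom (SpSe R) Z P.fp \<and> Comp (SpSe R) P.pr1 h = f \<and> Comp (SpSe R) P.pr2 h = g"
      using P.pair_universal[OF fg(1-5)] morphism_closed[OF fg(1)] morphism_closed[OF fg(3)] fg(2,4-6) by auto
  qed
qed

lemma SpSe_finite_products: "has_finite_products (SpSe R :: (('a, 'm) spse, ('a, 'm) spse_mor) cat)"
  by (rule category.has_finite_productsI[OF category_SpSe final_zero_spse[OF R]])
    (use prod_spse_product in \<open>simp add: SpSe_simps(1)\<close>)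

end

section \<open>Shifts and truncations\<close>

text \<open>This is \<open>B[r]\<close>. In bidegree \<open>(p, q)\<close> it holds the source of
  the page \<open>r\<close> differential into \<open>(p, q)\<close>; equivalently, in bidegree
  \<open>(p - r, q + 1 - r)\<close> it holds the module of bidegree \<open>(p, q)\<close>. The
  differential keeps its sign, the sign of the cone being put into \<open>cone_diff\<close>.\<close>

definition shift_complex :: "nat \<Rightarrow> ('a, 'm) bicomplex \<Rightarrow> ('a, 'm) bicomplex" where
  "shift_complex r A = \<lparr>cmod = (\<lambda>p q. cmod A (p + int r) (q - 1 + int r)),
     cdiff = (\<lambda>p q. cdiff A (p + int r) (q - 1 + int r))\<rparr>"

lemma shift_complex_simps [simp]:
  "cmod (shift_complex r A) p q = cmod A (p + int r) (q - 1 + int r)"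
  "cdiff (shift_complex r A) p q = cdiff A (p + int r) (q - 1 + int r)"
  by (simp_all add: shift_complex_def)

text \<open>Oriented so that the shift is moved innermost; the unfolded definitions for the shifted
  complex then match those for \<open>A\<close> literally.\<close>

lemma shift_index:
  fixes p q :: int
  shows "p - int m + int r = p + int r - int m" "q + 1 - int m - 1 + int r = q - 1 + int r + 1 - int m"
    "p + int m + int r = p + int r + int m" "q - 1 + int m - 1 + int r = q - 1 + int r - 1 + int m"
    "p - 2 * int m + int r = p + int r - 2 * int m" "q + 2 - 2 * int m - 1 + int r = q - 1 + int r + 2 - 2 * int m"
  by simp_all

lemma bigraded_complex_shift: "bigraded_complex R m A \<Longrightarrow> bigraded_complex R m (shift_complex r A)"
  unfolding bigraded_complex_def shift_complex_simps shift_index by blast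

lemma cycles_shift: "cycles m (shift_complex r A) p q = cycles m A (p + int r) (q - 1 + int r)"
  unfolding cycles_def shift_complex_simps shift_index ..

lemma boundaries_shift: "boundaries m (shift_complex r A) p q = boundaries m A (p + int r) (q - 1 + int r)"
  unfolding boundaries_def shift_complex_simps shift_index ..

definition shift_spse :: "nat \<Rightarrow> ('a, 'm) spse \<Rightarrow> ('a, 'm) spse" where
  "shift_spse r S = \<lparr>page = (\<lambda>m. shift_complex r (page S m)),
     chi = (\<lambda>m p q. chi S m (p + int r) (q - 1 + int r))\<rparr>"

lemma page_shift_spse [simp]: "page (shift_spse r S) m = shift_complex r (page S m)"
  by (simp add: shift_spse_def)

lemma spectral_sequence_shift:
  assumes "spectral_sequence R S"
  shows "spectral_sequence R (shift_spse r S)"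
  using assms unfolding spectral_sequence_def
  by (simp add: bigraded_complex_shift homology_def cycles_shift boundaries_shift) (simp add: shift_spse_def)

lemma cls_shift: "cls (shift_spse r S) m p q = cls S m (p + int r) (q - 1 + int r)"
  by (simp add: cls_def fun_eq_iff boundaries_shift) (simp add: shift_spse_def)

lemma morphism_shift:
  assumes f: "spse_morphism R f"
  shows "spse_morphism R (mor_of (shift_spse r (src f)) (shift_spse r (tgt f))
    (\<lambda>m p q. fmap f m (p + int r) (q - 1 + int r)))"
proof (rule mor_of_morphism)
  show "fmap f m (p - int m + int r) (q + 1 - int m - 1 + int r) (pdiff (shift_spse r (src f)) m p q x) =
      pdiff (shift_spse r (tgt f)) m p q (fmap f m (p + int r) (q - 1 + int r) x)"
    if "x \<in> carrier (pmod (shift_spse r (src f)) m p q)" for m p q x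
    using that morphism_diff[OF f, of x m "p + int r" "q - 1 + int r"] unfolding shift_index by simp
qed (use f in \<open>simp_all add: spectral_sequence_shift spse_morphismD cls_shift cycles_shift\<close>)

section \<open>Truncation with a new differential on page r\<close>

text \<open>A new differential on page \<open>r\<close> leaves the characteristic maps into that
  page intact, since they depend on the preceding page and on the modules of page \<open>r\<close>
  alone. What changes is the homology of page \<open>r\<close>, and with it all later pages.\<close>

definition trunc_page :: "nat \<Rightarrow> ('a, 'm) spse \<Rightarrow> (int \<Rightarrow> int \<Rightarrow> 'm \<Rightarrow> 'm) \<Rightarrow> nat \<Rightarrow> ('a, 'm) bicomplex" where
  "trunc_page r S d m = (if m < r then page S m else if m = r then (page S r)\<lparr>cdiff := d\<rparr> else page zero_spse m)"

definition trunc :: "nat \<Rightarrow> ('a, 'm) spse \<Rightarrow> (int \<Rightarrow> int \<Rightarrow> 'm \<Rightarrow> 'm) \<Rightarrow> ('a, 'm) spse" where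
  "trunc r S d = spse_of (trunc_page r S d) (\<lambda>m p q x. if m < r then cls S m p q x else undefined)"

lemma page_trunc: "page (trunc r S d) = trunc_page r S d"
  by (simp add: trunc_def)

lemma trunc_page_simps:
  "m < r \<Longrightarrow> trunc_page r S d m = page S m"
  "trunc_page r S d r = (page S r)\<lparr>cdiff := d\<rparr>"
  "r < m \<Longrightarrow> trunc_page r S d m = page zero_spse m"
  "m \<le> r \<Longrightarrow> cmod (trunc_page r S d m) p q = pmod S m p q"
  by (auto simp: trunc_page_def)

text \<open>Replacing the differential of page \<open>r\<close> by an acyclic one leaves a spectral sequence whose pages
  beyond \<open>r\<close> vanish.\<close>

locale truncation =
  fixes R :: "('a, 'b) ring_scheme" and S :: "('a, 'm) spse" and r :: nat
    and d :: "int \<Rightarrow> int \<Rightarrow> 'm \<Rightarrow> 'm"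
  assumes R: "cring R" and S: "spectral_sequence R S"
    and complex: "bigraded_complex R r ((page S r)\<lparr>cdiff := d\<rparr>)"
    and acyclic: "cycles r ((page S r)\<lparr>cdiff := d\<rparr>) p q \<subseteq> boundaries r ((page S r)\<lparr>cdiff := d\<rparr>) p q"
begin

text \<open>From page \<open>r\<close> on, the class maps go to zero modules, so the kernel
  condition says that every cycle is a boundary. On page \<open>r\<close> this is
  \<open>acyclic\<close>; beyond it, the unique element is a boundary.\<close>

lemma trunc: shows spectral_sequence_trunc: "spectral_sequence R (trunc r S d)"
    and cls_trunc: "x \<in> cycles m (page (trunc r S d) m) p q \<Longrightarrow>
      cls (trunc r S d) m p q x = (if m < r then cls S m p q x else undefined)"
proof -
  let ?C = "trunc_page r S d" and ?c = "\<lambda>m p q x. if m < r then cls S m p q x else undefined"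
  have 1: "bigraded_complex R m (?C m)" for m
    using S complex zero_spse[OF R] unfolding trunc_page_def
    by (auto simp: spectral_sequence_def simp del: page_zero_spse)
  have 2: "?c m p q \<in> mod_hom R (cycle_mod m (?C m) p q) (cmod (?C (Suc m)) p q)" for m p q
  proof (cases "m < r")
    case True
    then show ?thesis using spectral_sequence_cls(1)[OF S, of m p q] by (simp add: trunc_page_simps)
  next
    case False
    then show ?thesis by (intro mod_homI) (simp_all add: trunc_page_simps)
  qed
  have 3: "\<exists>x \<in> cycles m (?C m) p q. y = ?c m p q x" if "y \<in> carrier (cmod (?C (Suc m)) p q)" for m p q y
  proof (cases "m < r")
    case True
    then show ?thesis using spectral_sequence_cls(2)[OF S, of m p q] that by (auto simp: trunc_page_simps)
  next
    case False
    interpret Q: quotient_module R "cycle_mod m (?C m) p q" "boundaries m (?C m) p q"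
      by (rule homology_quotient[OF 1])
    show ?thesis using False that Q.M.zero_closed by (auto simp: trunc_page_simps)
  qed
  have 4: "x \<in> boundaries m (?C m) p q"
    if "x \<in> cycles m (?C m) p q" "?c m p q x = \<zero>\<^bsub>cmod (?C (Suc m)) p q\<^esub>" for m p q x
  proof (cases m r rule: linorder_cases)
    case less
    then show ?thesis using spectral_sequence_cls(3)[OF S, of x m p q] that by (simp add: trunc_page_simps)
  next
    case equal
    have "x \<in> cycles r ((page S r)\<lparr>cdiff := d\<rparr>) p q"
      using that(1) unfolding equal trunc_page_simps(2) .
    with acyclic show ?thesis unfolding equal trunc_page_simps(2) by blast
  next
    case greater
    then show ?thesis using that by (simp add: trunc_page_simps cycles_def boundaries_def)
  qed
  have 5: "?c m p q x = \<zero>\<^bsub>cmod (?C (Suc m)) p q\<^esub>" if "x \<in> boundaries m (?C m) p q" for m p q x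
  proof (cases "m < r")
    case True
    then have "x \<in> boundaries m (page S m) p q" using that by (simp add: trunc_page_simps)
    with spectral_sequence_cls(3)[OF S boundaries_cycles[OF spectral_sequence_page[OF S] this]] True
    show ?thesis by (simp add: trunc_page_simps)
  next
    case False
    then show ?thesis by (simp add: trunc_page_simps)
  qed
  show "spectral_sequence R (trunc r S d)"
    unfolding trunc_def by (rule spse_of(1)[OF 1 2 3 4 5])
  show "cls (trunc r S d) m p q x = ?c m p q x" if "x \<in> cycles m (page (trunc r S d) m) p q"
    unfolding trunc_def by (rule spse_of(2)[OF 1 2 3 4 5 that[unfolded page_trunc]])
qed

text \<open>The map \<open>k\<close> is extended by zero beyond page \<open>r\<close>.
  \<open>T\<close> is tied to \<open>tgt k\<close> through the pages below \<open>r\<close>, the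
  class maps there and the modules of page \<open>r\<close>, so it can be \<open>tgt k\<close>
  itself or another truncation with its own differential on page \<open>r\<close>.\<close>

lemma morphism_from_trunc:
  assumes T: "spectral_sequence R T" and k: "spse_morphism R k" "src k = S"
    and page: "\<And>m. m < r \<Longrightarrow> page T m = page (tgt k) m" "\<And>p q. pmod T r p q = pmod (tgt k) r p q"
    and cls: "\<And>m p q x. m < r \<Longrightarrow> x \<in> cycles m (page (tgt k) m) p q \<Longrightarrow> cls T m p q x = cls (tgt k) m p q x"
    and diff: "\<And>p q x. x \<in> carrier (pmod S r p q) \<Longrightarrow>
      fmap k r (p - int r) (q + 1 - int r) (d p q x) = pdiff T r p q (fmap k r p q x)"
  shows "spse_morphism R (mor_of (trunc r S d) T
    (\<lambda>m p q x. if m \<le> r then fmap k m p q x else \<zero>\<^bsub>pmod T m p q\<^esub>))"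
proof (rule mor_of_morphism[OF spectral_sequence_trunc T])
  have pmod_T: "pmod T m p q = pmod (tgt k) m p q" if "m \<le> r" for m p q
    using page that by (cases "m = r") auto
  note kD = spse_morphismD[OF k(1), unfolded k(2)]
  fix m p q
  interpret N: module R "pmod T m p q" by (rule spectral_sequence_module[OF T])
  show "(\<lambda>x. if m \<le> r then fmap k m p q x else \<zero>\<^bsub>pmod T m p q\<^esub>) \<in> mod_hom R (pmod (trunc r S d) m p q) (pmod T m p q)"
  proof (cases "m \<le> r")
    case True
    then show ?thesis using kD(4)[of m p q] by (simp add: page_trunc trunc_page_simps pmod_T)
  next
    case False
    then show ?thesis using zero_mod_hom[OF N.module_axioms] by simp
  qed
  fix x
  show "(if m \<le> r then fmap k m (p - int m) (q + 1 - int m) (pdiff (trunc r S d) m p q x)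
        else \<zero>\<^bsub>pmod T m (p - int m) (q + 1 - int m)\<^esub>) =
      pdiff T m p q (if m \<le> r then fmap k m p q x else \<zero>\<^bsub>pmod T m p q\<^esub>)"
    if x: "x \<in> carrier (pmod (trunc r S d) m p q)"
  proof (cases m r rule: linorder_cases)
    case less
    then show ?thesis using morphism_diff[OF k(1), of x m p q] x
      by (simp add: page_trunc trunc_page_simps k(2) page)
  next
    case equal
    then show ?thesis using diff x by (simp add: page_trunc trunc_page_simps)
  next
    case greater
    then show ?thesis by (simp add: spectral_sequence_zero_maps[OF T])
  qed
  show "(if Suc m \<le> r then fmap k (Suc m) p q (cls (trunc r S d) m p q x) else \<zero>\<^bsub>pmod T (Suc m) p q\<^esub>) =
      cls T m p q (if m \<le> r then fmap k m p q x else \<zero>\<^bsub>pmod T m p q\<^esub>)"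
    if x: "x \<in> cycles m (page (trunc r S d) m) p q"
  proof (cases m r rule: linorder_cases)
    case less
    then have "x \<in> cycles m (page (src k) m) p q" using x by (simp add: page_trunc trunc_page_simps k(2))
    note * = spse_morphismD(6)[OF k(1) this] morphism_cycles[OF k(1) this]
    show ?thesis using less * x cls by (simp add: cls_trunc k(2))
  next
    case equal
    \<comment> \<open>This is the passage to the zero pages: by acyclicity \<open>x\<close> is a
      boundary for \<open>d\<close>, so its image is a boundary in \<open>T\<close> and has class
      zero, in accordance with the extension by zero.\<close>
    have "x \<in> boundaries r ((page S r)\<lparr>cdiff := d\<rparr>) p q"
      using x acyclic unfolding equal page_trunc trunc_page_simps(2) by blast
    then obtain w where w: "w \<in> carrier (pmod S r (p + int r) (q - 1 + int r))"
      "x = d (p + int r) (q - 1 + int r) w" by (auto simp: boundaries_def)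
    have i: "p + int r - int r = p" "q - 1 + int r + 1 - int r = q" by simp_all
    have "fmap k r p q x = pdiff T r (p + int r) (q - 1 + int r) (fmap k r (p + int r) (q - 1 + int r) w)"
      using diff[OF w(1)] w(2) unfolding i by simp
    moreover have "fmap k r (p + int r) (q - 1 + int r) w \<in> carrier (pmod T r (p + int r) (q - 1 + int r))"
      using mod_homD(1)[OF kD(4) w(1)] pmod_T by simp
    ultimately have b: "fmap k r p q x \<in> boundaries r (page T r) p q"
      by (auto simp: boundaries_def)
    then have "cls T r p q (fmap k r p q x) = \<zero>\<^bsub>pmod T (Suc r) p q\<^esub>"
      using spectral_sequence_cls(3)[OF T boundaries_cycles[OF spectral_sequence_page[OF T] b]] by simp
    then show ?thesis using equal by simp
  next
    case greater
    then show ?thesis by (simp add: spectral_sequence_zero_maps[OF T])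
  qed
qed

end

text \<open>The conditions on a morphism are additive. This provides the map \<open>u + proj\<close>
  of the factorization.\<close>

lemma morphism_sum:
  assumes f: "spse_morphism R f" and g: "spse_morphism R g" and e: "src g = src f" "tgt g = tgt f"
  shows "spse_morphism R (mor_of (src f) (tgt f) (\<lambda>m p q x. fmap f m p q x \<oplus>\<^bsub>pmod (tgt f) m p q\<^esub> fmap g m p q x))"
proof (rule mor_of_morphism)
  show S: "spectral_sequence R (src f)" and T: "spectral_sequence R (tgt f)" using spse_morphismD(1,2)[OF f] .
  note fD = morphism_closed[OF f] morphism_add[OF f] morphism_smult[OF f] morphism_diff[OF f]
    spse_morphismD(6)[OF f] morphism_cycles[OF f]
  note gD = morphism_closed[OF g] morphism_add[OF g] morphism_smult[OF g] morphism_diff[OF g]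
    spse_morphismD(6)[OF g] morphism_cycles[OF g]
  note gD = gD[unfolded e]
  fix m p q
  interpret N: module R "pmod (tgt f) m p q" by (rule spectral_sequence_module[OF T])
  show "(\<lambda>x. fmap f m p q x \<oplus>\<^bsub>pmod (tgt f) m p q\<^esub> fmap g m p q x) \<in> mod_hom R (pmod (src f) m p q) (pmod (tgt f) m p q)"
    by (rule mod_homI) (simp_all add: fD(1-3) gD(1-3) N.smult_r_distr N.M.a_ac)
  show "fmap f m (p - int m) (q + 1 - int m) (pdiff (src f) m p q x) \<oplus>\<^bsub>pmod (tgt f) m (p - int m) (q + 1 - int m)\<^esub>
      fmap g m (p - int m) (q + 1 - int m) (pdiff (src f) m p q x) =
      pdiff (tgt f) m p q (fmap f m p q x \<oplus>\<^bsub>pmod (tgt f) m p q\<^esub> fmap g m p q x)"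
    if "x \<in> carrier (pmod (src f) m p q)" for x
    using that by (simp add: fD(1,4) gD(1,4) mod_homD(2)[OF bigraded_complexD(2)[OF spectral_sequence_page[OF T]]])
  show "fmap f (Suc m) p q (cls (src f) m p q x) \<oplus>\<^bsub>pmod (tgt f) (Suc m) p q\<^esub>
      fmap g (Suc m) p q (cls (src f) m p q x) =
      cls (tgt f) m p q (fmap f m p q x \<oplus>\<^bsub>pmod (tgt f) m p q\<^esub> fmap g m p q x)"
    if "x \<in> cycles m (page (src f) m) p q" for x
    using that by (simp add: fD(5,6) gD(5,6) spectral_sequence_cls_add[OF T])
qed

section \<open>The acyclic cone\<close>

context spse_pairing
begin

lemma page_prod_spse:
  assumes "spectral_sequence R S" "spectral_sequence R T"
  shows "page (prod_spse S T) m = fp_complex (page S m) (page T m) (fmap (to_zero S) m) (fmap (to_zero T) m)"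
  using fibre_product.page_fp[OF fibre_product_to_zero[OF assms]] by (simp add: prod_spse_def)

lemma spectral_sequence_prod:
  assumes "spectral_sequence R S" "spectral_sequence R T"
  shows "spectral_sequence R (prod_spse S T)"
  using fibre_product.spectral_sequence_fp[OF fibre_product_to_zero[OF assms]] by (simp add: prod_spse_def)

lemma carrier_prod:
  assumes "spectral_sequence R S" "spectral_sequence R T"
  shows "enc x y \<in> carrier (pmod (prod_spse S T) m p q) \<longleftrightarrow> x \<in> carrier (pmod S m p q) \<and> y \<in> carrier (pmod T m p q)"
  by (auto simp: page_prod_spse[OF assms] fp_mod_simps)

lemma prod_E:
  assumes "spectral_sequence R S" "spectral_sequence R T" "u \<in> carrier (pmod (prod_spse S T) m p q)"
  obtains x y where "u = enc x y" "x \<in> carrier (pmod S m p q)" "y \<in> carrier (pmod T m p q)"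
  using assms(3) by (auto simp: page_prod_spse[OF assms(1,2)] elim: fp_modE)

lemma morphism_prod_pr:
  assumes "spectral_sequence R S" "spectral_sequence R T"
  shows "spse_morphism R (mor_of (prod_spse S T) S (\<lambda>m p q. dec1))"
    and "spse_morphism R (mor_of (prod_spse S T) T (\<lambda>m p q. dec2))"
  using fibre_product.morphism_pr1[OF fibre_product_to_zero[OF assms]]
    fibre_product.morphism_pr2[OF fibre_product_to_zero[OF assms]]
  by (simp_all add: fibre_product.pr1_def[OF fibre_product_to_zero[OF assms]]
      fibre_product.pr2_def[OF fibre_product_to_zero[OF assms]] prod_spse_def)

lemma morphism_prod_pair:
  assumes a: "spse_morphism R a" and b: "spse_morphism R b" and e: "src b = src a"
  shows "spse_morphism R (mor_of (src a) (prod_spse (tgt a) (tgt b)) (\<lambda>m p q t. enc (fmap a m p q t) (fmap b m p q t)))"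
proof -
  note F = fibre_product_to_zero[OF spse_morphismD(2)[OF a] spse_morphismD(2)[OF b]]
  have "spse_morphism R (fibre_product.pair enc dec1 dec2 (to_zero (tgt a)) (to_zero (tgt b)) a b)"
    by (rule fibre_product.morphism_pair[OF F a _ b _ e])
      (simp_all add: morphism_closed[OF a] morphism_closed[OF b, unfolded e])
  then show ?thesis by (simp add: fibre_product.pair_def[OF F] prod_spse_def)
qed

end

lemma cdiff_update: "cmod (A\<lparr>cdiff := d\<rparr>) = cmod A" "cdiff (A\<lparr>cdiff := d\<rparr>) = d"
  by simp_all

locale spse_cone = spse_pairing enc dec1 dec2 R
  for enc :: "'m \<Rightarrow> 'm \<Rightarrow> 'm" and dec1 dec2 and R :: "('a, 'b) ring_scheme" +
  fixes r :: nat
begin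

text \<open>The mapping cone of the identity of page \<open>r\<close>. Its square has second entry
  \<open>dx - d(x - dy)\<close>, which vanishes because \<open>ddy = 0\<close>.\<close>

definition cone_diff :: "('a, 'm) spse \<Rightarrow> int \<Rightarrow> int \<Rightarrow> 'm \<Rightarrow> 'm" where
  "cone_diff B p q u = enc (pdiff B r p q (dec1 u))
    (dec1 u \<ominus>\<^bsub>pmod B r p q\<^esub> pdiff B r (p + int r) (q - 1 + int r) (dec2 u))"

definition cone :: "('a, 'm) spse \<Rightarrow> ('a, 'm) spse" where
  "cone B = trunc r (prod_spse B (shift_spse r B)) (cone_diff B)"

context
  fixes B :: "('a, 'm) spse"
  assumes B: "spectral_sequence R B"
begin

text \<open>Acyclicity comes from the contracting homotopy that sends \<open>(x, y)\<close> to
  \<open>(y, 0)\<close>.\<close>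

lemma truncation_cone: "truncation R (prod_spse B (shift_spse r B)) r (cone_diff B)"
proof (rule truncation.intro)
  show "cring R" by (rule R)
  let ?D = "prod_spse B (shift_spse r B)"
  note sB = spectral_sequence_shift[OF B]
  note zc = abelian_monoid.zero_closed[OF abelian_group.axioms(1)[OF module.axioms(2)[OF spectral_sequence_module[OF B]]]]
  \<comment> \<open>The shifted indices are spelled out because \<open>cone_diff\<close> passes
    entries from the first summand to the second, where the indices must match literally.\<close>
  have D_simps: "enc x y \<in> carrier (pmod ?D m p q) \<longleftrightarrow> x \<in> carrier (pmod B m p q) \<and> y \<in> carrier (pmod B m (p + int r) (q - 1 + int r))"
    "enc x y \<oplus>\<^bsub>pmod ?D m p q\<^esub> enc x' y' = enc (x \<oplus>\<^bsub>pmod B m p q\<^esub> x') (y \<oplus>\<^bsub>pmod B m (p + int r) (q - 1 + int r)\<^esub> y')"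
    "a \<odot>\<^bsub>pmod ?D m p q\<^esub> enc x y = enc (a \<odot>\<^bsub>pmod B m p q\<^esub> x) (a \<odot>\<^bsub>pmod B m (p + int r) (q - 1 + int r)\<^esub> y)"
    "\<zero>\<^bsub>pmod ?D m p q\<^esub> = enc \<zero>\<^bsub>pmod B m p q\<^esub> \<zero>\<^bsub>pmod B m (p + int r) (q - 1 + int r)\<^esub>"
    for x y x' y' a m p q
    using carrier_prod[OF B sB] by (simp_all add: page_prod_spse[OF B sB] fp_mod_simps)
  have D_E: thesis if "u \<in> carrier (pmod ?D m p q)"
    "\<And>x y. u = enc x y \<Longrightarrow> x \<in> carrier (pmod B m p q) \<Longrightarrow> y \<in> carrier (pmod B m (p + int r) (q - 1 + int r)) \<Longrightarrow> thesis"
    for u m p q thesis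
    by (rule prod_E[OF B sB that(1)], rule that(2)) simp_all
  have idx: "p - int r + int r = p" "q + 1 - int r - 1 + int r = q"
    "p + int r - int r = p" "q - 1 + int r + 1 - int r = q" for p q :: int by simp_all
  note dD = mod_homD[OF spectral_sequence_diff_hom[OF B, of r]]
  have d': "y \<in> carrier (pmod B r (p + int r) (q - 1 + int r)) \<Longrightarrow>
      pdiff B r (p + int r) (q - 1 + int r) y \<in> carrier (pmod B r p q)" for p q y
    using mod_homD(1)[OF spectral_sequence_diff_hom'[OF B]] .
  note dD' = mod_homD(2,3)[OF spectral_sequence_diff_hom'[OF B, of r]]
  have enc_diff: "cone_diff B p q (enc x y) = enc (pdiff B r p q x)
      (x \<ominus>\<^bsub>pmod B r p q\<^esub> pdiff B r (p + int r) (q - 1 + int r) y)" for p q x y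
    by (simp add: cone_diff_def)
  show "spectral_sequence R ?D" by (rule spectral_sequence_prod[OF B sB])
  show "bigraded_complex R r ((page ?D r)\<lparr>cdiff := cone_diff B\<rparr>)"
    unfolding bigraded_complex_def cdiff_update
  proof (intro allI conjI ballI)
    fix p q
    interpret M: module R "pmod B r p q" by (rule spectral_sequence_module[OF B])
    interpret N: module R "pmod B r (p - int r) (q + 1 - int r)" by (rule spectral_sequence_module[OF B])
    show "module R (pmod ?D r p q)" by (rule spectral_sequence_module[OF spectral_sequence_prod[OF B sB]])
    show "cone_diff B p q \<in> mod_hom R (pmod ?D r p q) (pmod ?D r (p - int r) (q + 1 - int r))"
    proof (rule mod_homI)
      fix u assume "u \<in> carrier (pmod ?D r p q)"
      then obtain x y where u: "u = enc x y" "x \<in> carrier (pmod B r p q)"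
        "y \<in> carrier (pmod B r (p + int r) (q - 1 + int r))" by (rule D_E)
      show "cone_diff B p q u \<in> carrier (pmod ?D r (p - int r) (q + 1 - int r))"
        unfolding u(1) enc_diff D_simps idx using u(2,3) dD(1) d' by simp
      have dy: "pdiff B r (p + int r) (q - 1 + int r) y \<in> carrier (pmod B r p q)" using d' u by simp
      show "cone_diff B p q (a \<odot>\<^bsub>pmod ?D r p q\<^esub> u) = a \<odot>\<^bsub>pmod ?D r (p - int r) (q + 1 - int r)\<^esub> cone_diff B p q u"
        if a: "a \<in> carrier R" for a
      proof -
        have "a \<odot>\<^bsub>pmod B r p q\<^esub> \<ominus>\<^bsub>pmod B r p q\<^esub> z = \<ominus>\<^bsub>pmod B r p q\<^esub> (a \<odot>\<^bsub>pmod B r p q\<^esub> z)"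
          if "z \<in> carrier (pmod B r p q)" for z
          using M.smult_r_minus[OF a that] .
        then show ?thesis
          unfolding u(1) D_simps enc_diff idx using u(2,3) a dy
          by (simp add: dD(3) dD' M.M.minus_eq M.smult_r_distr)
      qed
      fix v assume "v \<in> carrier (pmod ?D r p q)"
      then obtain x' y' where v: "v = enc x' y'" "x' \<in> carrier (pmod B r p q)"
        "y' \<in> carrier (pmod B r (p + int r) (q - 1 + int r))" by (rule D_E)
      have dy': "pdiff B r (p + int r) (q - 1 + int r) y' \<in> carrier (pmod B r p q)" using d' v by simp
      show "cone_diff B p q (u \<oplus>\<^bsub>pmod ?D r p q\<^esub> v) =
          cone_diff B p q u \<oplus>\<^bsub>pmod ?D r (p - int r) (q + 1 - int r)\<^esub> cone_diff B p q v"
        unfolding u(1) v(1) D_simps enc_diff idx using u(2,3) v(2,3) dy dy'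
        by (simp add: dD(1,2) dD' M.M.minus_eq M.M.minus_add M.M.a_ac N.M.a_ac)
    qed
    fix u assume "u \<in> carrier (pmod ?D r p q)"
    then obtain x y where u: "u = enc x y" "x \<in> carrier (pmod B r p q)"
      "y \<in> carrier (pmod B r (p + int r) (q - 1 + int r))" by (rule D_E)
    have dy: "pdiff B r (p + int r) (q - 1 + int r) y \<in> carrier (pmod B r p q)" using d' u by simp
    have ddy: "pdiff B r p q (pdiff B r (p + int r) (q - 1 + int r) y) = \<zero>\<^bsub>pmod B r (p - int r) (q + 1 - int r)\<^esub>"
      by (rule bigraded_complexD(4)[OF spectral_sequence_page[OF B] u(3)])
    have ddx: "pdiff B r (p - int r) (q + 1 - int r) (pdiff B r p q x) =
        \<zero>\<^bsub>pmod B r (p - 2 * int r) (q + 2 - 2 * int r)\<^esub>"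
      using spectral_sequence_page[OF B, of r] u(2) unfolding bigraded_complex_def by blast
    have dx: "pdiff B r p q x \<in> carrier (pmod B r (p - int r) (q + 1 - int r))" using dD(1) u by simp
    have "pdiff B r p q (x \<ominus>\<^bsub>pmod B r p q\<^esub> pdiff B r (p + int r) (q - 1 + int r) y) = pdiff B r p q x"
      using mod_hom_minus[OF M.module_axioms N.module_axioms spectral_sequence_diff_hom[OF B] u(2) dy] ddy dx
      by (simp add: N.M.diff_zero)
    then have "pdiff B r p q x \<ominus>\<^bsub>pmod B r (p - int r) (q + 1 - int r)\<^esub>
        pdiff B r p q (x \<ominus>\<^bsub>pmod B r p q\<^esub> pdiff B r (p + int r) (q - 1 + int r) y) =
        \<zero>\<^bsub>pmod B r (p - int r) (q + 1 - int r)\<^esub>"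
      using dx by (simp add: N.M.diff_self)
    moreover have idx2: "p - 2 * int r + int r = p - int r" "q + 2 - 2 * int r - 1 + int r = q + 1 - int r" by simp_all
    ultimately show "cone_diff B (p - int r) (q + 1 - int r) (cone_diff B p q u) =
        \<zero>\<^bsub>pmod ?D r (p - 2 * int r) (q + 2 - 2 * int r)\<^esub>"
      unfolding u(1) enc_diff D_simps idx idx2 using ddx by simp
  qed
  show "cycles r ((page ?D r)\<lparr>cdiff := cone_diff B\<rparr>) p q \<subseteq> boundaries r ((page ?D r)\<lparr>cdiff := cone_diff B\<rparr>) p q" for p q
  proof
    fix u assume "u \<in> cycles r ((page ?D r)\<lparr>cdiff := cone_diff B\<rparr>) p q"
    then have u: "u \<in> carrier (pmod ?D r p q)"
      "cone_diff B p q u = \<zero>\<^bsub>pmod ?D r (p - int r) (q + 1 - int r)\<^esub>" by (auto simp: cycles_def)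
    interpret M: module R "pmod B r p q" by (rule spectral_sequence_module[OF B])
    interpret L: module R "pmod B r (p + int r) (q - 1 + int r)" by (rule spectral_sequence_module[OF B])
    from u(1) obtain x y where e: "u = enc x y" "x \<in> carrier (pmod B r p q)"
      "y \<in> carrier (pmod B r (p + int r) (q - 1 + int r))" by (rule D_E)
    have dy: "pdiff B r (p + int r) (q - 1 + int r) y \<in> carrier (pmod B r p q)" using d' e by simp
    \<comment> \<open>The second entry of the cycle condition reads \<open>x - dy = 0\<close>, so
      \<open>(x, y)\<close> is \<open>(dy, y)\<close>, the boundary of
      \<open>(y, 0)\<close>.\<close>
    have "x = pdiff B r (p + int r) (q - 1 + int r) y"
      using u(2) e(2) dy unfolding e(1) enc_diff D_simps idx by (simp add: M.M.diff_eq_zero_iff)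
    moreover have "pdiff B r (p + int r + int r) (q - 1 + int r - 1 + int r)
        \<zero>\<^bsub>pmod B r (p + int r + int r) (q - 1 + int r - 1 + int r)\<^esub> = \<zero>\<^bsub>pmod B r (p + int r) (q - 1 + int r)\<^esub>"
      by (rule mod_hom_zero[OF spectral_sequence_module[OF B] spectral_sequence_module[OF B] spectral_sequence_diff_hom'[OF B]])
    ultimately have "u = cone_diff B (p + int r) (q - 1 + int r) (enc y \<zero>\<^bsub>pmod B r (p + int r + int r) (q - 1 + int r - 1 + int r)\<^esub>)"
      unfolding enc_diff e(1) using e(3) by (simp add: L.M.diff_zero)
    moreover have "enc y \<zero>\<^bsub>pmod B r (p + int r + int r) (q - 1 + int r - 1 + int r)\<^esub> \<in>
        carrier (pmod ?D r (p + int r) (q - 1 + int r))"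
      unfolding D_simps using e(3) zc by simp
    ultimately show "u \<in> boundaries r ((page ?D r)\<lparr>cdiff := cone_diff B\<rparr>) p q"
      unfolding boundaries_def cdiff_update by blast
  qed
qed

lemma spectral_sequence_cone: "spectral_sequence R (cone B)"
  using truncation.spectral_sequence_trunc[OF truncation_cone] by (simp add: cone_def)

lemma carrier_cone:
  "m \<le> r \<Longrightarrow> enc x y \<in> carrier (pmod (cone B) m p q) \<longleftrightarrow>
    x \<in> carrier (pmod B m p q) \<and> y \<in> carrier (pmod B m (p + int r) (q - 1 + int r))"
  "r < m \<Longrightarrow> pmod (cone B) m p q = zero_mod"
  by (simp_all add: cone_def page_trunc trunc_page_simps carrier_prod[OF B spectral_sequence_shift[OF B, of r]])

lemma cone_E:
  assumes "u \<in> carrier (pmod (cone B) m p q)" "m \<le> r"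
  obtains x y where "u = enc x y" "x \<in> carrier (pmod B m p q)"
    "y \<in> carrier (pmod B m (p + int r) (q - 1 + int r))"
  using assms prod_E[OF B spectral_sequence_shift[OF B, of r], of u m p q]
  by (auto simp: cone_def page_trunc trunc_page_simps)

definition cone_proj :: "('a, 'm) spse_mor" where
  "cone_proj = mor_of (cone B) B (\<lambda>m p q u. if m \<le> r then dec1 u else \<zero>\<^bsub>pmod B m p q\<^esub>)"

text \<open>The first entry of \<open>cone_diff\<close> is the differential of \<open>B\<close>, so
  \<open>dec1\<close> remains a chain map for the new differential; the second entry mixes both
  coordinates.\<close>

lemma morphism_cone_proj: "spse_morphism R cone_proj"
proof -
  note sB = spectral_sequence_shift[OF B, of r]
  let ?D = "prod_spse B (shift_spse r B)"
  let ?k = "mor_of ?D B (\<lambda>m p q. dec1)"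
  have "spse_morphism R (mor_of (trunc r ?D (cone_diff B)) B
      (\<lambda>m p q x. if m \<le> r then fmap ?k m p q x else \<zero>\<^bsub>pmod B m p q\<^esub>))"
  proof (rule truncation.morphism_from_trunc[OF truncation_cone B morphism_prod_pr(1)[OF B sB]])
    show "fmap ?k r (p - int r) (q + 1 - int r) (cone_diff B p q x) = pdiff B r p q (fmap ?k r p q x)"
      if x: "x \<in> carrier (pmod ?D r p q)" for p q x
    proof -
      have "cone_diff B p q x \<in> carrier (pmod ?D r (p - int r) (q + 1 - int r))"
        using mod_homD(1)[OF bigraded_complexD(2)[OF truncation.complex[OF truncation_cone], of p q]] x by simp
      then show ?thesis using x by (simp add: cone_diff_def)
    qed
  qed simp_all
  moreover have "mor_of (trunc r ?D (cone_diff B)) B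
      (\<lambda>m p q x. if m \<le> r then fmap ?k m p q x else \<zero>\<^bsub>pmod B m p q\<^esub>) = cone_proj"
    unfolding cone_proj_def cone_def
    by (rule mor_of_cong) (auto simp: page_trunc trunc_page_simps(4))
  ultimately show ?thesis by simp
qed

end

lemma cone_proj_simps [simp]:
  assumes "spectral_sequence R B"
  shows "src (cone_proj B) = cone B" "tgt (cone_proj B) = B"
    "w \<in> carrier (pmod (cone B) m p q) \<Longrightarrow>
      fmap (cone_proj B) m p q w = (if m \<le> r then dec1 w else \<zero>\<^bsub>pmod B m p q\<^esub>)"
  by (simp_all add: cone_proj_def[OF assms])

text \<open>Beyond page \<open>r\<close> the value \<open>undefined\<close> is the zero of
  \<open>zero_mod\<close>.\<close>

definition cone_map :: "('a, 'm) spse_mor \<Rightarrow> ('a, 'm) spse_mor" where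
  "cone_map b = mor_of (cone (src b)) (cone (tgt b)) (\<lambda>m p q w. if m \<le> r
     then enc (fmap b m p q (dec1 w)) (fmap b m (p + int r) (q - 1 + int r) (dec2 w)) else undefined)"

lemma cone_map_simps [simp]: "src (cone_map b) = cone (src b)" "tgt (cone_map b) = cone (tgt b)"
    "w \<in> carrier (pmod (cone (src b)) m p q) \<Longrightarrow> fmap (cone_map b) m p q w = (if m \<le> r
     then enc (fmap b m p q (dec1 w)) (fmap b m (p + int r) (q - 1 + int r) (dec2 w)) else undefined)"
  by (simp_all add: cone_map_def)

text \<open>The map is assembled on the product from \<open>b\<close> and its shift, then carried to
  the truncations. It respects \<open>x - dy\<close> because \<open>b\<close> is linear and a chain
  map.\<close>

lemma morphism_cone_map:
  assumes b: "spse_morphism R b"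
  shows "spse_morphism R (cone_map b)"
proof -
  note S = spse_morphismD(1)[OF b] and T = spse_morphismD(2)[OF b]
  note sS = spectral_sequence_shift[OF S, of r] and sT = spectral_sequence_shift[OF T, of r]
  let ?D = "prod_spse (src b) (shift_spse r (src b))" and ?D' = "prod_spse (tgt b) (shift_spse r (tgt b))"
  let ?sb = "mor_of (shift_spse r (src b)) (shift_spse r (tgt b)) (\<lambda>m p q. fmap b m (p + int r) (q - 1 + int r))"
  let ?k1 = "Comp (SpSe R) b (mor_of ?D (src b) (\<lambda>m p q. dec1))"
  let ?k2 = "Comp (SpSe R) ?sb (mor_of ?D (shift_spse r (src b)) (\<lambda>m p q. dec2))"
  let ?k = "mor_of ?D ?D' (\<lambda>m p q w. enc (fmap ?k1 m p q w) (fmap ?k2 m p q w))"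
  have k1: "spse_morphism R ?k1"
    unfolding SpSe_simps by (rule morphism_Comp[OF morphism_prod_pr(1)[OF S sS] b]) simp
  have k2: "spse_morphism R ?k2"
    unfolding SpSe_simps by (rule morphism_Comp[OF morphism_prod_pr(2)[OF S sS] morphism_shift[OF b]]) simp
  have s: "src ?k1 = ?D" "src ?k2 = ?D" "tgt ?k1 = tgt b" "tgt ?k2 = shift_spse r (tgt b)"
    by (simp_all add: SpSe_simps)
  have k: "spse_morphism R ?k"
    using morphism_prod_pair[OF k1 k2] unfolding s by simp
  have k_eq: "fmap ?k m p q w = enc (fmap b m p q (dec1 w)) (fmap b m (p + int r) (q - 1 + int r) (dec2 w))"
    if w: "w \<in> carrier (pmod ?D m p q)" for m p q w
  proof -
    from w obtain x y where "w = enc x y" "x \<in> carrier (pmod (src b) m p q)"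
      "y \<in> carrier (pmod (shift_spse r (src b)) m p q)" by (rule prod_E[OF S sS])
    then show ?thesis using w by (simp add: SpSe_simps)
  qed
  have "spse_morphism R (mor_of (trunc r ?D (cone_diff (src b))) (cone (tgt b))
      (\<lambda>m p q x. if m \<le> r then fmap ?k m p q x else \<zero>\<^bsub>pmod (cone (tgt b)) m p q\<^esub>))"
  proof (rule truncation.morphism_from_trunc[OF truncation_cone[OF S] spectral_sequence_cone[OF T] k])
    show "src ?k = ?D" by simp
    show "page (cone (tgt b)) m = page (tgt ?k) m" if "m < r" for m
      using that by (simp add: cone_def page_trunc trunc_page_simps)
    show "pmod (cone (tgt b)) r p q = pmod (tgt ?k) r p q" for p q
      by (simp add: cone_def page_trunc trunc_page_simps)
    show "cls (cone (tgt b)) m p q x = cls (tgt ?k) m p q x"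
      if "m < r" "x \<in> cycles m (page (tgt ?k) m) p q" for m p q x
      using that truncation.cls_trunc[OF truncation_cone[OF T], of x m p q]
      by (simp add: cone_def page_trunc trunc_page_simps)
    show "fmap ?k r (p - int r) (q + 1 - int r) (cone_diff (src b) p q w) =
        pdiff (cone (tgt b)) r p q (fmap ?k r p q w)" if w: "w \<in> carrier (pmod ?D r p q)" for p q w
    proof -
      from w obtain x y where xy: "w = enc x y" "x \<in> carrier (pmod (src b) r p q)"
        "y \<in> carrier (pmod (shift_spse r (src b)) r p q)" by (rule prod_E[OF S sS])
      then have y: "y \<in> carrier (pmod (src b) r (p + int r) (q - 1 + int r))" by simp
      have dy: "pdiff (src b) r (p + int r) (q - 1 + int r) y \<in> carrier (pmod (src b) r p q)"
        using mod_homD(1)[OF spectral_sequence_diff_hom'[OF S] y] .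
      have "cone_diff (src b) p q w \<in> carrier (pmod ?D r (p - int r) (q + 1 - int r))"
        using mod_homD(1)[OF bigraded_complexD(2)[OF truncation.complex[OF truncation_cone[OF S]], of p q]] w by simp
      note * = k_eq[OF this] k_eq[OF w]
      have idx: "p - int r + int r = p" "q + 1 - int r - 1 + int r = q" by simp_all
      have "fmap b r p q (x \<ominus>\<^bsub>pmod (src b) r p q\<^esub> pdiff (src b) r (p + int r) (q - 1 + int r) y) =
          fmap b r p q x \<ominus>\<^bsub>pmod (tgt b) r p q\<^esub> pdiff (tgt b) r (p + int r) (q - 1 + int r) (fmap b r (p + int r) (q - 1 + int r) y)"
        using morphism_minus[OF b xy(2) dy] complex_morD(3)[OF spse_morphismD(3)[OF b] y] by simp
      moreover have "cdiff (page (cone (tgt b)) r) = cone_diff (tgt b)"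
        by (simp add: cone_def page_trunc trunc_page_simps)
      ultimately show ?thesis
        unfolding * idx using morphism_diff[OF b xy(2)] by (simp add: xy(1) cone_diff_def)
    qed
  qed
  moreover have "mor_of (trunc r ?D (cone_diff (src b))) (cone (tgt b))
      (\<lambda>m p q x. if m \<le> r then fmap ?k m p q x else \<zero>\<^bsub>pmod (cone (tgt b)) m p q\<^esub>) = cone_map b"
    unfolding cone_map_def cone_def[of "src b"]
  proof (rule mor_of_cong)
    fix m p q x assume x: "x \<in> carrier (pmod (trunc r ?D (cone_diff (src b))) m p q)"
    show "(if m \<le> r then fmap ?k m p q x else \<zero>\<^bsub>pmod (cone (tgt b)) m p q\<^esub>) = (if m \<le> r
     then enc (fmap b m p q (dec1 x)) (fmap b m (p + int r) (q - 1 + int r) (dec2 x)) else undefined)"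
    proof (cases "m \<le> r")
      case True
      then have "x \<in> carrier (pmod ?D m p q)" using x by (simp add: page_trunc trunc_page_simps)
      from k_eq[OF this] True show ?thesis by (simp only: if_True)
    next
      case False
      then show ?thesis by (simp add: carrier_cone(2)[OF T])
    qed
  qed
  ultimately show ?thesis by simp
qed

end

section \<open>Functorial factorization\<close>

context spse_cone
begin

definition fact_ob :: "('a, 'm) spse_mor \<Rightarrow> ('a, 'm) spse" where
  "fact_ob u = prod_spse (src u) (cone (tgt u))"

definition fact_p :: "('a, 'm) spse_mor \<Rightarrow> ('a, 'm) spse_mor" where
  "fact_p u = mor_of (fact_ob u) (tgt u) (\<lambda>m p q t.
     fmap u m p q (dec1 t) \<oplus>\<^bsub>pmod (tgt u) m p q\<^esub> fmap (cone_proj (tgt u)) m p q (dec2 t))"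

definition fact_i :: "('a, 'm) spse_mor \<Rightarrow> ('a, 'm) spse_mor" where
  "fact_i u = mor_of (src u) (fact_ob u) (\<lambda>m p q x. enc x \<zero>\<^bsub>pmod (cone (tgt u)) m p q\<^esub>)"

definition fact_s :: "('a, 'm) spse_mor \<Rightarrow> ('a, 'm) spse_mor" where
  "fact_s u = mor_of (fact_ob u) (src u) (\<lambda>m p q. dec1)"

text \<open>A square acts on the first factor of the middle object through its edge between the
  domains, and on the cone through its edge between the codomains.\<close>

definition fact_mid :: "('a, 'm) spse_mor square \<Rightarrow> ('a, 'm) spse_mor" where
  "fact_mid \<sigma> = mor_of (fact_ob (sq_src \<sigma>)) (fact_ob (sq_tgt \<sigma>)) (\<lambda>m p q t.
     enc (fmap (sq_dom \<sigma>) m p q (dec1 t)) (fmap (cone_map (sq_cod \<sigma>)) m p q (dec2 t)))"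

lemma fact_simps [simp]:
  "src (fact_p u) = fact_ob u" "tgt (fact_p u) = tgt u"
  "src (fact_i u) = src u" "tgt (fact_i u) = fact_ob u"
  "src (fact_s u) = fact_ob u" "tgt (fact_s u) = src u"
  "src (fact_mid \<sigma>) = fact_ob (sq_src \<sigma>)" "tgt (fact_mid \<sigma>) = fact_ob (sq_tgt \<sigma>)"
  "t \<in> carrier (pmod (fact_ob u) m p q) \<Longrightarrow> fmap (fact_p u) m p q t =
     fmap u m p q (dec1 t) \<oplus>\<^bsub>pmod (tgt u) m p q\<^esub> fmap (cone_proj (tgt u)) m p q (dec2 t)"
  "x \<in> carrier (pmod (src u) m p q) \<Longrightarrow> fmap (fact_i u) m p q x = enc x \<zero>\<^bsub>pmod (cone (tgt u)) m p q\<^esub>"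
  "t \<in> carrier (pmod (fact_ob u) m p q) \<Longrightarrow> fmap (fact_s u) m p q t = dec1 t"
  "t \<in> carrier (pmod (fact_ob (sq_src \<sigma>)) m p q) \<Longrightarrow> fmap (fact_mid \<sigma>) m p q t =
     enc (fmap (sq_dom \<sigma>) m p q (dec1 t)) (fmap (cone_map (sq_cod \<sigma>)) m p q (dec2 t))"
  by (simp_all add: fact_p_def fact_i_def fact_s_def fact_mid_def)

lemma zero_in_carrier:
  assumes "spectral_sequence R S"
  shows "\<zero>\<^bsub>pmod S m p q\<^esub> \<in> carrier (pmod S m p q)"
  using cycles_carrier[OF spectral_sequence_zero_maps(1)[OF assms]] .

context
  fixes u :: "('a, 'm) spse_mor"
  assumes u: "spse_morphism R u"
begin

lemmas S = spse_morphismD(1)[OF u] and T = spse_morphismD(2)[OF u]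

lemma fact_ob_iff: "enc x w \<in> carrier (pmod (fact_ob u) m p q) \<longleftrightarrow>
    x \<in> carrier (pmod (src u) m p q) \<and> w \<in> carrier (pmod (cone (tgt u)) m p q)"
  unfolding fact_ob_def by (rule carrier_prod[OF S spectral_sequence_cone[OF T]])

lemma fact_ob_E:
  assumes "t \<in> carrier (pmod (fact_ob u) m p q)"
  obtains x w where "t = enc x w" "x \<in> carrier (pmod (src u) m p q)" "w \<in> carrier (pmod (cone (tgt u)) m p q)"
  using prod_E[OF S spectral_sequence_cone[OF T] assms[unfolded fact_ob_def]] by blast

lemma morphism_fact_s: "spse_morphism R (fact_s u)"
  unfolding fact_s_def fact_ob_def by (rule morphism_prod_pr(1)[OF S spectral_sequence_cone[OF T]])

lemma morphism_fact_i: "spse_morphism R (fact_i u)"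
proof -
  let ?i = "mor_of (src u) (src u) (\<lambda>m p q x. x)"
  let ?z = "mor_of (src u) (cone (tgt u)) (\<lambda>m p q x. \<zero>\<^bsub>pmod (cone (tgt u)) m p q\<^esub>)"
  have "spse_morphism R (mor_of (src ?i) (prod_spse (tgt ?i) (tgt ?z)) (\<lambda>m p q t. enc (fmap ?i m p q t) (fmap ?z m p q t)))"
    by (rule morphism_prod_pair[OF morphism_Id[OF S] zero_morphism[OF S spectral_sequence_cone[OF T]]]) simp
  also have "mor_of (src ?i) (prod_spse (tgt ?i) (tgt ?z)) (\<lambda>m p q t. enc (fmap ?i m p q t) (fmap ?z m p q t)) = fact_i u"
    unfolding fact_i_def fact_ob_def mor_of_simps by (rule mor_of_cong) simp
  finally show ?thesis .
qed

lemma morphism_fact_p: "spse_morphism R (fact_p u)"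
proof -
  note C = spectral_sequence_cone[OF T]
  let ?f = "Comp (SpSe R) u (mor_of (fact_ob u) (src u) (\<lambda>m p q. dec1))"
  let ?g = "Comp (SpSe R) (cone_proj (tgt u)) (mor_of (fact_ob u) (cone (tgt u)) (\<lambda>m p q. dec2))"
  have f: "spse_morphism R ?f"
    unfolding SpSe_simps fact_ob_def by (rule morphism_Comp[OF morphism_prod_pr(1)[OF S C] u]) simp
  have g: "spse_morphism R ?g"
    unfolding SpSe_simps fact_ob_def
    by (rule morphism_Comp[OF morphism_prod_pr(2)[OF S C] morphism_cone_proj[OF T]]) (simp add: T)
  have s: "src ?f = fact_ob u" "tgt ?f = tgt u" "src ?g = fact_ob u" "tgt ?g = tgt u"
    by (simp_all add: SpSe_simps T)
  have "spse_morphism R (mor_of (fact_ob u) (tgt u) (\<lambda>m p q x. fmap ?f m p q x \<oplus>\<^bsub>pmod (tgt u) m p q\<^esub> fmap ?g m p q x))"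
    using morphism_sum[OF f g] unfolding s by simp
  also have "mor_of (fact_ob u) (tgt u) (\<lambda>m p q x. fmap ?f m p q x \<oplus>\<^bsub>pmod (tgt u) m p q\<^esub> fmap ?g m p q x) = fact_p u"
    unfolding fact_p_def by (rule mor_of_cong) (simp add: SpSe_simps)
  finally show ?thesis .
qed

lemma cone_proj_zero:
  "fmap (cone_proj (tgt u)) m p q \<zero>\<^bsub>pmod (cone (tgt u)) m p q\<^esub> = \<zero>\<^bsub>pmod (tgt u) m p q\<^esub>"
  using morphism_zero[OF morphism_cone_proj[OF T], of m p q] by (simp only: cone_proj_simps(1,2)[OF T])

text \<open>The cone entry of \<open>fact_i\<close> is zero and \<open>cone_proj\<close> sends it to
  zero, so the sum in \<open>fact_p\<close> leaves \<open>u\<close>.\<close>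

lemma fact_factors: "factors (SpSe R) u (fact_p u) (fact_i u) (fact_s u)"
  unfolding factors_def
proof (intro conjI)
  show "fact_i u \<in> Hom (SpSe R) (Dom (SpSe R) u) (Cod (SpSe R) (fact_i u))"
    "fact_p u \<in> Hom (SpSe R) (Cod (SpSe R) (fact_i u)) (Cod (SpSe R) u)"
    "fact_s u \<in> Hom (SpSe R) (Cod (SpSe R) (fact_i u)) (Dom (SpSe R) u)"
    using morphism_fact_i morphism_fact_p morphism_fact_s by (simp_all add: Hom_SpSe SpSe_simps(2-4))
  have i: "enc x \<zero>\<^bsub>pmod (cone (tgt u)) m p q\<^esub> \<in> carrier (pmod (fact_ob u) m p q)"
    if "x \<in> carrier (pmod (src u) m p q)" for x m p q
    using that zero_in_carrier[OF spectral_sequence_cone[OF T]] by (simp add: fact_ob_iff)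
  show "Comp (SpSe R) (fact_p u) (fact_i u) = u"
    unfolding SpSe_simps
  proof (rule spse_mor_of_eqI[OF u])
    fix m p q x assume "x \<in> carrier (pmod (src (fact_i u)) m p q)"
    then have x: "x \<in> carrier (pmod (src u) m p q)" by simp
    interpret N: module R "pmod (tgt u) m p q" by (rule spectral_sequence_module[OF T])
    show "fmap (fact_p u) m p q (fmap (fact_i u) m p q x) = fmap u m p q x"
      using x i[OF x] morphism_closed[OF u x] by (simp add: cone_proj_zero)
  qed simp_all
  show "Comp (SpSe R) (fact_s u) (fact_i u) = Id (SpSe R) (Dom (SpSe R) u)"
    unfolding SpSe_simps fact_simps by (rule mor_of_cong) (simp add: i)
qed

lemma onto_fact_p:
  assumes "k \<le> r"
  shows "onto_at (fact_p u) k p q"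
proof -
  have "y \<in> fmap (fact_p u) k p q ` carrier (pmod (fact_ob u) k p q)" if y: "y \<in> carrier (pmod (tgt u) k p q)" for y
  proof (rule image_eqI)
    interpret N: module R "pmod (tgt u) k p q" by (rule spectral_sequence_module[OF T])
    \<comment> \<open>\<open>y\<close> is reached through the cone alone, from \<open>(y, 0)\<close>
      with zero in the factor \<open>src u\<close>. The cone contains such elements on the pages up
      to \<open>r\<close>.\<close>
    let ?w = "enc y \<zero>\<^bsub>pmod (tgt u) k (p + int r) (q - 1 + int r)\<^esub>"
    let ?t = "enc \<zero>\<^bsub>pmod (src u) k p q\<^esub> ?w"
    have w: "?w \<in> carrier (pmod (cone (tgt u)) k p q)"
      using carrier_cone(1)[OF T assms] y zero_in_carrier[OF T] by simp
    then show t: "?t \<in> carrier (pmod (fact_ob u) k p q)"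
      using zero_in_carrier[OF S] by (simp add: fact_ob_iff)
    show "y = fmap (fact_p u) k p q ?t"
      using t w y assms morphism_zero[OF u] T by simp
  qed
  then show ?thesis using morphism_closed[OF morphism_fact_p, of _ k p q] by auto
qed

text \<open>The cone vanishes on page \<open>Suc r\<close>, where the projection is therefore
  injective. On every page the elements with zero cone entry show that it is onto.\<close>

lemma acyclic_fact_s: "fact_s u \<in> E_quasi_isos R r \<inter> r_fibrations R r"
proof -
  note C = spectral_sequence_cone[OF T]
  have "onto_at (fact_s u) k p q" for k p q
  proof -
    have "x \<in> fmap (fact_s u) k p q ` carrier (pmod (fact_ob u) k p q)" if x: "x \<in> carrier (pmod (src u) k p q)" for x
    proof (rule image_eqI)
      show t: "enc x \<zero>\<^bsub>pmod (cone (tgt u)) k p q\<^esub> \<in> carrier (pmod (fact_ob u) k p q)"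
        using x zero_in_carrier[OF C] by (simp add: fact_ob_iff)
      show "x = fmap (fact_s u) k p q (enc x \<zero>\<^bsub>pmod (cone (tgt u)) k p q\<^esub>)"
        using t by simp
    qed
    then show ?thesis using morphism_closed[OF morphism_fact_s, of _ k p q] by auto
  qed
  moreover have "inj_on (fmap (fact_s u) (Suc r) p q) (carrier (pmod (fact_ob u) (Suc r) p q))" for p q
  proof (rule inj_onI)
    fix t t' assume t: "t \<in> carrier (pmod (fact_ob u) (Suc r) p q)" and t': "t' \<in> carrier (pmod (fact_ob u) (Suc r) p q)"
      and e: "fmap (fact_s u) (Suc r) p q t = fmap (fact_s u) (Suc r) p q t'"
    have z: "pmod (cone (tgt u)) (Suc r) p q = zero_mod" by (rule carrier_cone(2)[OF T]) simp
    obtain x w where "t = enc x w" "w \<in> carrier (pmod (cone (tgt u)) (Suc r) p q)" using t by (rule fact_ob_E)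
    moreover obtain x' w' where "t' = enc x' w'" "w' \<in> carrier (pmod (cone (tgt u)) (Suc r) p q)" using t' by (rule fact_ob_E)
    ultimately show "t = t'" using e t t' z by simp
  qed
  ultimately show ?thesis
    using morphism_fact_s by (simp add: E_quasi_isos_iff r_fibrations_iff bij_betw_def)
qed

end

section \<open>Functoriality of the cone and naturality of the factorization\<close>

lemma cone_map_Id:
  assumes S: "spectral_sequence R S" and w: "w \<in> carrier (pmod (cone S) m p q)"
  shows "fmap (cone_map (mor_of S S (\<lambda>m p q x. x))) m p q w = w"
proof (cases "m \<le> r")
  case True
  obtain x y where "w = enc x y" "x \<in> carrier (pmod S m p q)" "y \<in> carrier (pmod S m (p + int r) (q - 1 + int r))"
    using cone_E[OF S w True] .
  then show ?thesis using True w by simp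
next
  case False
  then show ?thesis using w carrier_cone(2)[OF S, of m p q] by simp
qed

lemma cone_map_Comp:
  assumes f: "spse_morphism R f" and g: "spse_morphism R g" and e: "tgt f = src g"
    and w: "w \<in> carrier (pmod (cone (src f)) m p q)"
  shows "fmap (cone_map (Comp (SpSe R) g f)) m p q w = fmap (cone_map g) m p q (fmap (cone_map f) m p q w)"
proof -
  have c: "fmap (cone_map f) m p q w \<in> carrier (pmod (cone (src g)) m p q)"
    using morphism_closed[OF morphism_cone_map[OF f], of w m p q] w e by simp
  show ?thesis
  proof (cases "m \<le> r")
    case True
    obtain x y where "w = enc x y" "x \<in> carrier (pmod (src f) m p q)"
      "y \<in> carrier (pmod (src f) m (p + int r) (q - 1 + int r))"
      using cone_E[OF spse_morphismD(1)[OF f] w True] .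
    then show ?thesis using True w c e by (simp add: SpSe_simps)
  next
    case False
    then show ?thesis using w c by (simp add: SpSe_simps)
  qed
qed

text \<open>Up to page \<open>r\<close> both sides apply \<open>b\<close> to the first entry of
  \<open>w\<close>; beyond it both are zero.\<close>

lemma cone_proj_natural:
  assumes b: "spse_morphism R b" and w: "w \<in> carrier (pmod (cone (src b)) m p q)"
  shows "fmap (cone_proj (tgt b)) m p q (fmap (cone_map b) m p q w) = fmap b m p q (fmap (cone_proj (src b)) m p q w)"
proof -
  note S = spse_morphismD(1)[OF b] and T = spse_morphismD(2)[OF b]
  have c: "fmap (cone_map b) m p q w \<in> carrier (pmod (cone (tgt b)) m p q)"
    using morphism_closed[OF morphism_cone_map[OF b], of w m p q] w by simp
  show ?thesis
    using w c by (simp add: S T morphism_zero[OF b])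
qed

text \<open>The square for \<open>fact_p\<close> is the one with content: additivity of
  \<open>b\<close> splits \<open>b (u x + proj w)\<close>, the first term is handled by the given
  square and the second by naturality of \<open>cone_proj\<close>. The squares for
  \<open>fact_s\<close> and \<open>fact_i\<close> compare entries.\<close>

lemma fact_mid_natural:
  assumes \<sigma>: "\<sigma> \<in> Arr (arrow_cat (SpSe R))"
  shows "fact_mid \<sigma> \<in> Hom (SpSe R) (Cod (SpSe R) (fact_i (sq_src \<sigma>))) (Cod (SpSe R) (fact_i (sq_tgt \<sigma>)))"
    and "Comp (SpSe R) (fact_p (sq_tgt \<sigma>)) (fact_mid \<sigma>) = Comp (SpSe R) (sq_cod \<sigma>) (fact_p (sq_src \<sigma>))"
    and "Comp (SpSe R) (fact_s (sq_tgt \<sigma>)) (fact_mid \<sigma>) = Comp (SpSe R) (sq_dom \<sigma>) (fact_s (sq_src \<sigma>))"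
    and "Comp (SpSe R) (fact_i (sq_tgt \<sigma>)) (sq_dom \<sigma>) = Comp (SpSe R) (fact_mid \<sigma>) (fact_i (sq_src \<sigma>))"
proof -
  define u v a b where uvab: "u = sq_src \<sigma>" "v = sq_tgt \<sigma>" "a = sq_dom \<sigma>" "b = sq_cod \<sigma>"
  have u: "spse_morphism R u" and v: "spse_morphism R v" and a: "spse_morphism R a" "src a = src u" "tgt a = src v"
    and b: "spse_morphism R b" "src b = tgt u" "tgt b = tgt v" and sq: "Comp (SpSe R) v a = Comp (SpSe R) b u"
    using \<sigma> by (auto simp: category.arrow_cat_simps[OF category_SpSe[of R]] Hom_SpSe SpSe_simps(2-4) uvab)
  note Su = spse_morphismD(1)[OF u] and Tu = spse_morphismD(2)[OF u]
  note Sv = spse_morphismD(1)[OF v] and Tv = spse_morphismD(2)[OF v]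
  have va: "fmap v m p q (fmap a m p q x) = fmap b m p q (fmap u m p q x)" if "x \<in> carrier (pmod (src u) m p q)" for x m p q
    using arg_cong[OF sq, of "\<lambda>h. fmap h m p q x"] that a(2) by (simp add: SpSe_simps)
  note cb = morphism_cone_map[OF b(1)]
  have mid: "spse_morphism R (fact_mid \<sigma>)"
  proof -
    note C = spectral_sequence_cone[OF Tu]
    let ?f = "Comp (SpSe R) a (mor_of (fact_ob u) (src u) (\<lambda>m p q. dec1))"
    let ?g = "Comp (SpSe R) (cone_map b) (mor_of (fact_ob u) (cone (tgt u)) (\<lambda>m p q. dec2))"
    have f: "spse_morphism R ?f"
      unfolding SpSe_simps fact_ob_def by (rule morphism_Comp[OF morphism_prod_pr(1)[OF Su C] a(1)]) (simp add: a)
    have g: "spse_morphism R ?g"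
      unfolding SpSe_simps fact_ob_def
      by (rule morphism_Comp[OF morphism_prod_pr(2)[OF Su C] cb]) (simp add: b)
    have s: "src ?f = fact_ob u" "tgt ?f = src v" "src ?g = fact_ob u" "tgt ?g = cone (tgt v)"
      by (simp_all add: SpSe_simps a b)
    have "spse_morphism R (mor_of (fact_ob u) (fact_ob v) (\<lambda>m p q t. enc (fmap ?f m p q t) (fmap ?g m p q t)))"
      using morphism_prod_pair[OF f g] unfolding s fact_ob_def[of v] by simp
    also have "mor_of (fact_ob u) (fact_ob v) (\<lambda>m p q t. enc (fmap ?f m p q t) (fmap ?g m p q t)) = fact_mid \<sigma>"
      unfolding fact_mid_def uvab[symmetric] by (rule mor_of_cong) (simp add: SpSe_simps)
    finally show ?thesis .
  qed
  then show "fact_mid \<sigma> \<in> Hom (SpSe R) (Cod (SpSe R) (fact_i (sq_src \<sigma>))) (Cod (SpSe R) (fact_i (sq_tgt \<sigma>)))"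
    by (simp add: Hom_SpSe SpSe_simps(2-4))
  have mid_eq: "fmap (fact_mid \<sigma>) m p q t = enc (fmap a m p q (dec1 t)) (fmap (cone_map b) m p q (dec2 t))"
    and mid_c: "fmap (fact_mid \<sigma>) m p q t \<in> carrier (pmod (fact_ob v) m p q)"
    if "t \<in> carrier (pmod (fact_ob u) m p q)" for t m p q
    using that morphism_closed[OF mid, of t m p q] by (simp_all add: uvab)
  show "Comp (SpSe R) (fact_p (sq_tgt \<sigma>)) (fact_mid \<sigma>) = Comp (SpSe R) (sq_cod \<sigma>) (fact_p (sq_src \<sigma>))"
    unfolding SpSe_simps fact_simps uvab[symmetric] b(3)
  proof (rule mor_of_cong)
    fix m p q t assume t: "t \<in> carrier (pmod (fact_ob u) m p q)"
    then obtain x w where xw: "t = enc x w" "x \<in> carrier (pmod (src u) m p q)" "w \<in> carrier (pmod (cone (tgt u)) m p q)"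
      by (rule fact_ob_E[OF u])
    have "fmap (cone_proj (tgt v)) m p q (fmap (cone_map b) m p q w) = fmap b m p q (fmap (cone_proj (tgt u)) m p q w)"
      using cone_proj_natural[OF b(1), of w m p q] xw(3) b by simp
    moreover have "fmap (cone_proj (tgt u)) m p q w \<in> carrier (pmod (tgt u) m p q)"
      using morphism_closed[OF morphism_cone_proj[OF Tu], of w m p q] xw(3) unfolding cone_proj_simps(1,2)[OF Tu] .
    ultimately show "fmap (fact_p v) m p q (fmap (fact_mid \<sigma>) m p q t) = fmap b m p q (fmap (fact_p u) m p q t)"
      using t mid_c[OF t] mid_eq[OF t] xw va[OF xw(2)] morphism_closed[OF u xw(2)]
        morphism_add[OF b(1), of "fmap u m p q x" m p q "fmap (cone_proj (tgt u)) m p q w"] b(2,3)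
      by (simp del: cone_proj_simps cone_map_simps)
  qed
  show "Comp (SpSe R) (fact_s (sq_tgt \<sigma>)) (fact_mid \<sigma>) = Comp (SpSe R) (sq_dom \<sigma>) (fact_s (sq_src \<sigma>))"
    unfolding SpSe_simps fact_simps uvab[symmetric] a(3)
  proof (rule mor_of_cong)
    fix m p q t assume t: "t \<in> carrier (pmod (fact_ob u) m p q)"
    show "fmap (fact_s v) m p q (fmap (fact_mid \<sigma>) m p q t) = fmap a m p q (fmap (fact_s u) m p q t)"
      using t mid_c[OF t] mid_eq[OF t] by simp
  qed
  show "Comp (SpSe R) (fact_i (sq_tgt \<sigma>)) (sq_dom \<sigma>) = Comp (SpSe R) (fact_mid \<sigma>) (fact_i (sq_src \<sigma>))"
    unfolding SpSe_simps fact_simps uvab[symmetric] a(2)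
  proof (rule mor_of_cong)
    fix m p q x assume x: "x \<in> carrier (pmod (src u) m p q)"
    have i: "fmap (fact_i u) m p q x \<in> carrier (pmod (fact_ob u) m p q)"
      using morphism_closed[OF morphism_fact_i[OF u], of x m p q] x by simp
    have ax: "fmap a m p q x \<in> carrier (pmod (src v) m p q)" using morphism_closed[OF a(1), of x m p q] x a by simp
    have "fmap (cone_map b) m p q \<zero>\<^bsub>pmod (cone (tgt u)) m p q\<^esub> = \<zero>\<^bsub>pmod (cone (tgt v)) m p q\<^esub>"
      using morphism_zero[OF cb, of m p q] b(2,3) by (simp del: cone_map_simps(3))
    then show "fmap (fact_i v) m p q (fmap a m p q x) = fmap (fact_mid \<sigma>) m p q (fmap (fact_i u) m p q x)"
      unfolding mid_eq[OF i] using x ax by (simp del: cone_map_simps(3))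
  qed
qed

lemma SpSe_functorial_factorization:
  "functorial_factorization (SpSe R :: (('a, 'm) spse, ('a, 'm) spse_mor) cat)
    (r_fibrations R r) (E_quasi_isos R r \<inter> r_fibrations R r)"
proof (rule category.functorial_factorizationI[OF category_SpSe, where p = fact_p and i = fact_i and s = fact_s and mid = fact_mid])
  note ac = category.arrow_cat_simps[OF category_SpSe[of R]]
  fix u :: "('a, 'm) spse_mor" assume "u \<in> Arr (SpSe R)"
  then have u: "spse_morphism R u" by (simp add: SpSe_simps)
  show "factors (SpSe R) u (fact_p u) (fact_i u) (fact_s u) \<and> fact_p u \<in> r_fibrations R r \<and>
      fact_s u \<in> E_quasi_isos R r \<inter> r_fibrations R r"
    using fact_factors[OF u] acyclic_fact_s[OF u] onto_fact_p[OF u] morphism_fact_p[OF u]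
    by (simp add: r_fibrations_iff)
  show "fact_mid (Id (arrow_cat (SpSe R)) u) = Id (SpSe R) (Cod (SpSe R) (fact_i u))"
    unfolding fact_mid_def ac square.simps SpSe_simps(3-5) fact_simps
    by (rule mor_of_cong)
      (auto elim!: fact_ob_E[OF u] simp: cone_map_Id[OF spse_morphismD(2)[OF u]] simp del: cone_map_simps)
next
  fix \<sigma> :: "('a, 'm) spse_mor square" assume \<sigma>: "\<sigma> \<in> Arr (arrow_cat (SpSe R))"
  show "fact_mid \<sigma> \<in> Hom (SpSe R) (Cod (SpSe R) (fact_i (sq_src \<sigma>))) (Cod (SpSe R) (fact_i (sq_tgt \<sigma>))) \<and>
      Comp (SpSe R) (fact_p (sq_tgt \<sigma>)) (fact_mid \<sigma>) = Comp (SpSe R) (sq_cod \<sigma>) (fact_p (sq_src \<sigma>)) \<and>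
      Comp (SpSe R) (fact_s (sq_tgt \<sigma>)) (fact_mid \<sigma>) = Comp (SpSe R) (sq_dom \<sigma>) (fact_s (sq_src \<sigma>)) \<and>
      Comp (SpSe R) (fact_i (sq_tgt \<sigma>)) (sq_dom \<sigma>) = Comp (SpSe R) (fact_mid \<sigma>) (fact_i (sq_src \<sigma>))"
    using fact_mid_natural[OF \<sigma>] by blast
  fix \<tau> :: "('a, 'm) spse_mor square"
  assume \<tau>: "\<tau> \<in> Arr (arrow_cat (SpSe R))" and e: "sq_tgt \<sigma> = sq_src \<tau>"
  note ac = category.arrow_cat_simps[OF category_SpSe[of R]]
  have s: "spse_morphism R (sq_src \<sigma>)" "spse_morphism R (sq_dom \<sigma>)" "src (sq_dom \<sigma>) = src (sq_src \<sigma>)"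
    "tgt (sq_dom \<sigma>) = src (sq_dom \<tau>)" "spse_morphism R (sq_cod \<sigma>)" "src (sq_cod \<sigma>) = tgt (sq_src \<sigma>)"
    "tgt (sq_cod \<sigma>) = src (sq_cod \<tau>)" "spse_morphism R (sq_cod \<tau>)"
    using \<sigma> \<tau> e by (auto simp: ac Hom_SpSe SpSe_simps(2-4))
  have mid: "spse_morphism R (fact_mid \<sigma>)" using fact_mid_natural(1)[OF \<sigma>] by (simp add: Hom_SpSe)
  show "fact_mid (Comp (arrow_cat (SpSe R)) \<tau> \<sigma>) = Comp (SpSe R) (fact_mid \<tau>) (fact_mid \<sigma>)"
    unfolding fact_mid_def[of "Comp (arrow_cat (SpSe R)) \<tau> \<sigma>"]
    unfolding ac square.simps SpSe_simps(6)[of R "fact_mid \<tau>"] fact_simps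
  proof (rule mor_of_cong)
    fix m p q t assume t: "t \<in> carrier (pmod (fact_ob (sq_src \<sigma>)) m p q)"
    then obtain x w where xw: "t = enc x w" "x \<in> carrier (pmod (src (sq_src \<sigma>)) m p q)"
      "w \<in> carrier (pmod (cone (tgt (sq_src \<sigma>))) m p q)" by (rule fact_ob_E[OF s(1)])
    have "fmap (fact_mid \<sigma>) m p q t \<in> carrier (pmod (fact_ob (sq_src \<tau>)) m p q)"
      using morphism_closed[OF mid, of t m p q] t e by simp
    moreover have "fmap (cone_map (Comp (SpSe R) (sq_cod \<tau>) (sq_cod \<sigma>))) m p q w =
        fmap (cone_map (sq_cod \<tau>)) m p q (fmap (cone_map (sq_cod \<sigma>)) m p q w)"
      by (rule cone_map_Comp[OF s(5,8,7)]) (use xw s in simp)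
    moreover have "fmap (Comp (SpSe R) (sq_dom \<tau>) (sq_dom \<sigma>)) m p q x = fmap (sq_dom \<tau>) m p q (fmap (sq_dom \<sigma>) m p q x)"
      using xw s by (simp add: SpSe_simps)
    ultimately show "enc (fmap (Comp (SpSe R) (sq_dom \<tau>) (sq_dom \<sigma>)) m p q (dec1 t))
        (fmap (cone_map (Comp (SpSe R) (sq_cod \<tau>) (sq_cod \<sigma>))) m p q (dec2 t)) =
      fmap (fact_mid \<tau>) m p q (fmap (fact_mid \<sigma>) m p q t)"
      using t xw(1) by (simp del: cone_map_simps)
  qed
qed

lemma SpSe_almost_brown:
  "almost_brown_category_functorial (SpSe R :: (('a, 'm) spse, ('a, 'm) spse_mor) cat)
    (E_quasi_isos R r) (r_fibrations R r)"
proof -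
  let ?C = "SpSe R :: (('a, 'm) spse, ('a, 'm) spse_mor) cat"
  interpret category ?C by (rule category_SpSe)
  show ?thesis
  proof
    show "\<exists>e. final_object ?C e" using final_zero_spse[OF R] by blast
    show "E_quasi_isos R r \<subseteq> Arr ?C" "r_fibrations R r \<subseteq> Arr ?C"
      by (auto simp: E_quasi_isos_def r_fibrations_def)
    show "isos ?C \<subseteq> E_quasi_isos R r" "isos ?C \<subseteq> r_fibrations R r"
      using isos_SpSe_acyclic_fibration by blast+
    show "\<exists>p i s. factors ?C u p i s \<and> p \<in> r_fibrations R r \<and> s \<in> E_quasi_isos R r \<inter> r_fibrations R r"
      if "u \<in> Arr ?C" for u
      using SpSe_functorial_factorization that unfolding functorial_factorization_def by blast
  qed (fact SpSe_finite_products E_quasi_isos_two_out_of_three acyclic_fibrations_pullback_closed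
      SpSe_functorial_factorization | (erule (2) r_fibrations_Comp) | (erule (1) SpSe_fibrant))+
qed

end

theorem theorem5p3p1:
  fixes R :: "('a, 'b) ring_scheme" and r :: nat
  assumes "cring R"
    and "infinite (UNIV :: 'm set)"
  shows "almost_brown_category_functorial
           (SpSe R :: (('a, 'm) spse, ('a, 'm) spse_mor) cat)
           (E_quasi_isos R r) (r_fibrations R r) \<and>
         partial_brown_category
           (SpSe R :: (('a, 'm) spse, ('a, 'm) spse_mor) cat)
           (E_quasi_isos R r) (E_quasi_isos R r \<inter> r_fibrations R r)"
proof -
  \<comment> \<open>An infinite set is equinumerous with its square; this supplies the coding of
    pairs, and its inverse supplies the two decoders.\<close>
  obtain e :: "'m \<times> 'm \<Rightarrow> 'm" where "bij_betw e UNIV UNIV"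
    using card_of_Times_same_infinite[OF assms(2)] by (auto simp: card_of_ordIso[symmetric])
  then have e: "inj e" by (simp add: bij_betw_def)
  interpret spse_cone "\<lambda>x y. e (x, y)" "\<lambda>z. fst (inv_into UNIV e z)" "\<lambda>z. snd (inv_into UNIV e z)" R r
    by (intro spse_cone.intro spse_pairing.intro pairing.intro spse_pairing_axioms.intro)
      (simp_all add: e assms(1))
  show ?thesis
    using SpSe_almost_brown almost_brown_category_functorial.partial_brown_category[OF SpSe_almost_brown]
    by blast
qed

end
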